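(* Let $q\in\mathbb{C}$ with $|q|<1$. With the series $H_\ell(1)=H_\ell(1;q)$ defined in the context, the following seven identities hold: \begin{align*} H_1(1) &= \frac{1}{(q,q^4,q^6,q^8,q^{11};q^{12})_\infty},\\ H_2(1) &= \frac{(q^6;q^{12})_\infty}{(q^2,q^3,q^4;q^{6})_\infty},\\ H_3(1) &= \frac{1}{(q^4,q^5,q^6,q^7,q^8;q^{12})_\infty},\\ H_6(1) &= \frac{(q^3;q^{12})_\infty}{(q,q^2;q^{4})_\infty},\\ H_7(1) &= \frac{(q^9;q^{12})_\infty}{(q^2,q^3;q^{4})_\infty},\\ H_{10}(1) &= \frac{1}{(q;q^3)_\infty (q^3,q^6,q^{11};q^{12})_\infty},\\ H_{11}(1) &= \frac{1}{(q^2;q^3)_\infty(q^3,q^6,q^7;q^{12})_\infty}. \end{align*}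
   Context: For $n\in\mathbb{N}_0\cup\{\infty\}$ and $x,q\in\mathbb{C}$ with $|q|<1$, $(x;q)_n:=\prod_{i=0}^{n-1}(1-xq^i)$ and $(x_1,\dots,x_m;q)_n:=(x_1;q)_n\cdots(x_m;q)_n$. For $\ell\in\{1,2,3,6,7\}$ define $$H_\ell(x;q):=\sum_{i,j,k\ge 0}(-1)^k\frac{q^{(i+2j+3k)(i+2j+3k-1)+3k^2+A_\ell(i,j,k)}}{(q;q)_i(q^4;q^4)_j(q^6;q^6)_k}x^{i+2j+3k},$$ where $A_1(i,j,k)=i+6j+6k$, $A_2(i,j,k)=2i+2j+6k$, $A_3(i,j,k)=4i+6j+12k$, $A_6(i,j,k)=i$, $A_7(i,j,k)=2i+4j+6k$. For $\ell\in\{10,11\}$ define $$H_\ell(x;q):=\sum_{i,j,k\ge 0}\frac{q^{\frac12(i+2j+3k)(i+2j+3k-1)+j^2+A_\ell(i,j,k)}}{(q;q)_i(q^2;q^2)_j(q^3;q^3)_k}x^{i+2j+3k},$$ where $A_{10}(i,j,k)=i+2j+4k$ and $A_{11}(i,j,k)=2i+4j+5k$. All these series converge absolutely for every $x\in\mathbb{C}$. $H_\ell(1)$ abbreviates $H_\ell(1;q)$, i.e. $x=1$. *)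

theory Defs
  imports "HOL-Analysis.Analysis"
begin

definition qpoch :: "complex \<Rightarrow> complex \<Rightarrow> nat \<Rightarrow> complex" where
  "qpoch x q n = (\<Prod>i<n. 1 - x * q ^ i)"

text \<open>The infinite product may have vanishing factors; \<open>prodinf\<close> then has value \<open>0\<close>, as it should.
  It converges for all \<open>x\<close> when \<open>norm q < 1\<close>.\<close>

definition qpoch_inf :: "complex \<Rightarrow> complex \<Rightarrow> complex" where
  "qpoch_inf x q = (\<Prod>i. 1 - x * q ^ i)"

definition qpochs_inf :: "complex list \<Rightarrow> complex \<Rightarrow> complex" where
  "qpochs_inf xs q = (\<Prod>x\<leftarrow>xs. qpoch_inf x q)"

definition A :: "nat \<Rightarrow> nat \<Rightarrow> nat \<Rightarrow> nat \<Rightarrow> nat" where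
  "A l i j k =
     (if l = 1 then i + 6 * j + 6 * k
      else if l = 2 then 2 * i + 2 * j + 6 * k
      else if l = 3 then 4 * i + 6 * j + 12 * k
      else if l = 6 then i
      else if l = 7 then 2 * i + 4 * j + 6 * k
      else if l = 10 then i + 2 * j + 4 * k
      else if l = 11 then 2 * i + 4 * j + 5 * k
      else undefined)"

text \<open>All exponents are natural numbers. With \<open>N = i + 2 * j + 3 * k\<close>, the truncated
  subtraction in \<open>N * (N - 1)\<close> is harmless, as the product is \<open>0\<close> for \<open>N = 0\<close>, and the
  division by \<open>2\<close> is exact. \<open>H\<close> is left unspecified at indices for which no series is given.\<close>

definition H :: "nat \<Rightarrow> complex \<Rightarrow> complex \<Rightarrow> complex" where
  "H l x q =
     (if l \<in> {1, 2, 3, 6, 7} then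
        (\<Sum>\<^sub>\<infinity>(i, j, k)\<in>UNIV.
           (-1) ^ k *
           q ^ ((i + 2 * j + 3 * k) * (i + 2 * j + 3 * k - 1) + 3 * k\<^sup>2 + A l i j k) /
           (qpoch q q i * qpoch (q ^ 4) (q ^ 4) j * qpoch (q ^ 6) (q ^ 6) k) *
           x ^ (i + 2 * j + 3 * k))
      else if l \<in> {10, 11} then
        (\<Sum>\<^sub>\<infinity>(i, j, k)\<in>UNIV.
           q ^ ((i + 2 * j + 3 * k) * (i + 2 * j + 3 * k - 1) div 2 + j\<^sup>2 + A l i j k) /
           (qpoch q q i * qpoch (q ^ 2) (q ^ 2) j * qpoch (q ^ 3) (q ^ 3) k) *
           x ^ (i + 2 * j + 3 * k))
      else undefined)"

end

theory Submission
  imports Defs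
begin

no_notation vec_nth (infixl "$" 90)
unbundle fps_syntax

text \<open>With \<open>p = q\<^sup>2\<close> (or \<open>p = q\<close> for \<open>H\<^sub>1\<^sub>0\<close>, \<open>H\<^sub>1\<^sub>1\<close>) each triple sum is \<open>\<Sum> p\<^bsup>n(n-1)/2\<^esup> G\<^sub>n\<close> for a product \<open>G\<close> of Euler series in
  \<open>z\<close>, \<open>z\<^sup>2\<close>, \<open>z\<^sup>3\<close>. Splitting off a factor \<open>1 / (c z; p)\<^sub>\<infinity>\<close> and summing it by Euler's identity leaves a single
  sum whose terms satisfy a short recurrence. For \<open>H\<^sub>6\<close>, \<open>H\<^sub>7\<close> the terms are the coefficients of a product of two Euler
  series. For \<open>H\<^sub>1\<close>, \<open>H\<^sub>2\<close>, \<open>H\<^sub>3\<close> they are the odd coefficients of \<open>\<Prod>(1 + \<surd>3 q\<^sup>n X + q\<^sup>2\<^sup>n X\<^sup>2)\<close>,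
  so that theta functions at twelfth roots of unity appear, which the quintuple product identity turns
  into products. For \<open>H\<^sub>1\<^sub>0\<close>, \<open>H\<^sub>1\<^sub>1\<close> the recurrence, found by creative telescoping, is that of a terminating
  basic hypergeometric sum, and the remaining series is an instance of the q-analogue of Gauss's
  second theorem.\<close>

section \<open>q-Pochhammer symbols\<close>

text \<open>What is split off is chosen so that the rest has a short q-difference equation: for
  \<open>H6\<close>, \<open>H7\<close> it is half of the first Euler factor, for \<open>H2\<close>,
  \<open>H3\<close> it cancels a factor of \<open>1 - q^2 z^2\<close>. The tails of infinite
  products that Euler's identity then produces supply exactly the denominators that turn the
  recurrence into a known one.

  The number \<open>sqrt 3\<close> enters as follows. Eliminating the even coefficients of the
  product with middle coefficient \<open>c\<close> gives a three-term recurrence in which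
  \<open>c^2 - 2\<close> appears, while the cubic factor of the sums demands the value 1 there.
  Hence \<open>c = 2 cos (pi / 6)\<close>, a sum of two twelfth roots of unity, and the two signs of
  \<open>sqrt 3\<close> separate even from odd coefficients. \<open>H1\<close> needs no recurrence
  of its own, being \<open>H2 + q H3\<close>.

  For \<open>H10\<close>, \<open>H11\<close> the exponent becomes diagonal in \<open>j + k\<close>
  and \<open>k\<close>, which dictates the regrouping to which creative telescoping is applied.
  Certificates and theta functions divide by \<open>q\<close>, so \<open>q = 0\<close> is settled
  separately where they occur.\<close>

lemma qpoch_0 [simp]: "qpoch x q 0 = 1"
  by (simp add: qpoch_def)

lemma qpoch_Suc: "qpoch x q (Suc n) = qpoch x q n * (1 - x * q ^ n)"
  by (simp add: qpoch_def)

lemma qpoch_add: "qpoch x q (m + n) = qpoch x q m * qpoch (x * q ^ m) q n"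
  by (induction n) (simp_all add: qpoch_Suc power_add mult_ac)

lemma qpoch_Suc_left: "qpoch x q (Suc n) = (1 - x) * qpoch (x * q) q n"
  using qpoch_add[of x q 1 n] by (simp add: qpoch_def)

lemma qpoch_zero [simp]: "qpoch 0 q n = 1"
  by (simp add: qpoch_def)

lemma one_minus_neq_0:
  fixes x :: complex
  assumes "norm x < 1"
  shows "1 - x \<noteq> 0"
  using assms by auto

lemma norm_mult_power_less_1:
  fixes x q :: complex
  assumes "norm x < 1" "norm q < 1"
  shows "norm (x * q ^ n) < 1"
proof -
  have "norm x * norm q ^ n \<le> norm x * 1"
    using assms by (intro mult_left_mono power_le_one) auto
  then show ?thesis using assms by (simp add: norm_mult norm_power)
qed

lemma norm_power_less_1:
  fixes q :: complex
  assumes "norm q < 1" "n > 0"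
  shows "norm (q ^ n) < 1"
  using assms by (simp add: norm_power power_less_one_iff)

lemma qpoch_nonzero:
  assumes "norm q < 1" "norm x < 1"
  shows "qpoch x q n \<noteq> 0"
  unfolding qpoch_def using one_minus_neq_0 norm_mult_power_less_1[OF assms(2,1)]
  by (subst prod_zero_iff) blast+

lemma abs_convergent_qpoch:
  assumes "norm (q::complex) < 1"
  shows "abs_convergent_prod (\<lambda>i. 1 - x * q ^ i)"
  by (rule summable_imp_abs_convergent_prod)
     (use assms in \<open>simp add: norm_mult norm_power summable_mult summable_geometric\<close>)

lemma qpoch_tendsto:
  assumes "norm q < 1"
  shows "qpoch x q \<longlonglongrightarrow> qpoch_inf x q"
proof -
  have "convergent_prod (\<lambda>i. 1 - x * q ^ i)"
    by (intro abs_convergent_prod_imp_convergent_prod abs_convergent_qpoch assms)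
  then have "(\<lambda>i. 1 - x * q ^ i) has_prod qpoch_inf x q"
    by (simp add: qpoch_inf_def convergent_prod_has_prod)
  from has_prod_imp_tendsto'[OF this] show ?thesis
    by (simp add: qpoch_def[abs_def])
qed

lemma qpoch_inf_nonzero:
  assumes "norm q < 1" "norm x < 1"
  shows "qpoch_inf x q \<noteq> 0"
proof -
  have "convergent_prod (\<lambda>i. 1 - x * q ^ i)"
    by (intro abs_convergent_prod_imp_convergent_prod abs_convergent_qpoch assms)
  then show ?thesis unfolding qpoch_inf_def
    using one_minus_neq_0 norm_mult_power_less_1[OF assms(2,1)] by (intro prodinf_nonzero) blast+
qed

lemma qpoch_inf_unique:
  assumes "norm q < 1" "qpoch x q \<longlonglongrightarrow> L"
  shows "qpoch_inf x q = L"
  using LIMSEQ_unique[OF qpoch_tendsto[OF assms(1)] assms(2)] .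

lemma qpoch_inf_zero [simp]: "qpoch_inf 0 q = 1"
  by (simp add: qpoch_inf_def)

lemma qpoch_inf_split:
  assumes "norm q < 1"
  shows "qpoch_inf x q = qpoch x q n * qpoch_inf (x * q ^ n) q"
proof (rule LIMSEQ_unique)
  show "(\<lambda>m. qpoch x q (n + m)) \<longlonglongrightarrow> qpoch_inf x q"
    using LIMSEQ_ignore_initial_segment[OF qpoch_tendsto[OF assms], of x n] by (simp add: add.commute)
  show "(\<lambda>m. qpoch x q (n + m)) \<longlonglongrightarrow> qpoch x q n * qpoch_inf (x * q ^ n) q"
    unfolding qpoch_add by (intro tendsto_intros qpoch_tendsto assms)
qed

lemma qpoch_inf_Suc:
  assumes "norm q < 1"
  shows "qpoch_inf x q = (1 - x) * qpoch_inf (x * q) q"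
  using qpoch_inf_split[OF assms, of x 1] by (simp add: qpoch_def)

text \<open>Sorts the factors by the residue of their exponent modulo \<open>m\<close>. This is what
  later brings products to the common base \<open>q ^ 12\<close>.\<close>

lemma qpoch_mult_dissect:
  "qpoch x q (n * m) = (\<Prod>j<m. qpoch (x * q ^ j) (q ^ m) n)"
proof (induction n)
  case (Suc n)
  have "qpoch x q (Suc n * m) = qpoch x q (n * m) * qpoch (x * q ^ (n * m)) q m"
    by (simp add: qpoch_add[symmetric] add.commute)
  also have "qpoch (x * q ^ (n * m)) q m = (\<Prod>j<m. 1 - x * q ^ j * (q ^ m) ^ n)"
    by (auto simp: qpoch_def power_mult[symmetric] mult_ac intro!: prod.cong)
  finally show ?case
    by (simp add: Suc.IH qpoch_Suc prod.distrib)
qed simp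

lemma qpoch_inf_dissect:
  assumes "norm q < 1" "m > 0"
  shows "qpoch_inf x q = (\<Prod>j<m. qpoch_inf (x * q ^ j) (q ^ m))"
proof (rule LIMSEQ_unique)
  have "strict_mono (\<lambda>n. n * m)" using assms by (simp add: strict_mono_def)
  from LIMSEQ_subseq_LIMSEQ[OF qpoch_tendsto[OF assms(1)] this]
  show "(\<lambda>n. qpoch x q (n * m)) \<longlonglongrightarrow> qpoch_inf x q" by (simp add: o_def)
  show "(\<lambda>n. qpoch x q (n * m)) \<longlonglongrightarrow> (\<Prod>j<m. qpoch_inf (x * q ^ j) (q ^ m))"
    unfolding qpoch_mult_dissect
    by (intro tendsto_intros qpoch_tendsto norm_power_less_1 assms)
qed

lemma qpoch_mult_neg: "qpoch x q n * qpoch (- x) q n = qpoch (x\<^sup>2) (q\<^sup>2) n"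
  unfolding qpoch_def prod.distrib[symmetric]
  by (intro prod.cong) (simp_all add: algebra_simps power2_eq_square power_mult_distrib)

lemma qpoch_inf_mult_neg:
  assumes "norm q < 1"
  shows "qpoch_inf x q * qpoch_inf (- x) q = qpoch_inf (x\<^sup>2) (q\<^sup>2)"
proof (rule qpoch_inf_unique[symmetric])
  show "norm (q\<^sup>2) < 1" using norm_power_less_1[OF assms, of 2] by simp
  show "qpoch (x\<^sup>2) (q\<^sup>2) \<longlonglongrightarrow> qpoch_inf x q * qpoch_inf (- x) q"
    using tendsto_mult[OF qpoch_tendsto[OF assms, of x] qpoch_tendsto[OF assms, of "- x"]]
    by (simp only: qpoch_mult_neg)
qed

text \<open>The inverses converge because the infinite product is nonzero for
  \<open>norm x < 1\<close>, and convergent sequences are bounded. Most majorants below start from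
  this bound.\<close>

lemma inverse_qpoch_bounded:
  assumes "norm q < 1" "norm x < 1"
  obtains B where "B > 0" "\<And>n. norm (inverse (qpoch x q n)) \<le> B"
proof -
  have "(\<lambda>n. inverse (qpoch x q n)) \<longlonglongrightarrow> inverse (qpoch_inf x q)"
    by (intro tendsto_intros qpoch_tendsto qpoch_inf_nonzero assms)
  then have "Bseq (\<lambda>n. inverse (qpoch x q n))"
    by (intro convergent_imp_Bseq) (auto simp: convergent_def)
  then show ?thesis using that unfolding Bseq_def by blast
qed

section \<open>Euler's identities\<close>

lemma choose_two_Suc: "Suc n choose 2 = (n choose 2) + n"
  by (simp add: numeral_2_eq_2)

text \<open>Consecutive terms have the ratio \<open>p ^ n * x\<close>, which tends to 0 whatever
  \<open>x\<close> is: the quadratic exponent beats every geometric growth.\<close>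

lemma summable_power_choose_two:
  fixes p :: "'a :: {real_normed_field, banach}"
  assumes "norm p < 1"
  shows "summable (\<lambda>n. norm (p ^ (n choose 2) * x ^ n))"
proof -
  have "(\<lambda>n. norm (p ^ n * x)) \<longlonglongrightarrow> norm (0 * x)"
    by (intro tendsto_intros LIMSEQ_power_zero assms)
  then have "eventually (\<lambda>n. norm (p ^ n * x) < 1/2) sequentially"
    by (rule order_tendstoD) simp
  then obtain N where N: "\<And>n. n \<ge> N \<Longrightarrow> norm (p ^ n * x) < 1/2"
    by (auto simp: eventually_sequentially)
  show ?thesis
  proof (rule summable_ratio_test[of "1/2" N])
    fix n assume n: "n \<ge> N"
    have "norm (p ^ (Suc n choose 2) * x ^ Suc n) =
        norm (p ^ n * x) * norm (p ^ (n choose 2) * x ^ n)"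
      unfolding choose_two_Suc by (simp add: power_add norm_mult mult_ac)
    also have "\<dots> \<le> 1/2 * norm (p ^ (n choose 2) * x ^ n)"
      using N[OF n] by (intro mult_right_mono) auto
    finally show "norm (norm (p ^ (Suc n choose 2) * x ^ Suc n)) \<le>
        1/2 * norm (norm (p ^ (n choose 2) * x ^ n))" by simp
  qed auto
qed

text \<open>Closes the iteration of functional equations that relate \<open>f x\<close> to
  \<open>f (x * q)\<close>: the leftover \<open>f (x * q ^ n)\<close> tends to the constant
  coefficient, by continuity at 0.\<close>

lemma powser_functional_limit:
  fixes a :: "nat \<Rightarrow> complex" and x q :: complex
  assumes q: "norm q < 1" and r: "r > 0" and sm: "\<And>x. norm x < r \<Longrightarrow> summable (\<lambda>n. a n * x ^ n)"
  shows "(\<lambda>n. \<Sum>k. a k * (x * q ^ n) ^ k) \<longlonglongrightarrow> a 0"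
proof -
  have s: "summable (\<lambda>n. a n * (of_real (r/2)) ^ n)"
    using r by (intro sm) auto
  have "isCont (\<lambda>x. \<Sum>k. a k * x ^ k) 0"
    using r by (intro isCont_powser[OF s]) auto
  moreover have "(\<lambda>n. x * q ^ n) \<longlonglongrightarrow> x * 0"
    by (intro tendsto_intros LIMSEQ_power_zero q)
  ultimately have "(\<lambda>n. \<Sum>k. a k * (x * q ^ n) ^ k) \<longlonglongrightarrow> (\<Sum>k. a k * 0 ^ k)"
    using isCont_tendsto_compose[of "0::complex" "\<lambda>x. \<Sum>k. a k * x ^ k" "\<lambda>n. x * q ^ n"] by simp
  then show ?thesis by (simp only: powser_zero)
qed

lemma summable_euler1:
  assumes q: "norm q < 1" and x: "norm x < 1"
  shows "summable (\<lambda>n. norm (x ^ n / qpoch q q n))"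
proof -
  obtain B where B: "\<And>n. norm (inverse (qpoch q q n)) \<le> B"
    using inverse_qpoch_bounded[OF q q] by blast
  show ?thesis
  proof (rule summable_comparison_test'[of "\<lambda>n. B * norm x ^ n"])
    show "summable (\<lambda>n. B * norm x ^ n)" using x by (intro summable_mult summable_geometric) auto
    show "norm (norm (x ^ n / qpoch q q n)) \<le> B * norm x ^ n" if "n \<ge> 0" for n
      using mult_right_mono[OF B[of n], of "norm x ^ n"]
      by (simp add: norm_divide norm_power norm_inverse field_simps)
  qed
qed

lemma summable_euler2:
  assumes q: "norm q < 1"
  shows "summable (\<lambda>n. norm ((-1) ^ n * q ^ (n choose 2) * x ^ n / qpoch q q n))"
proof -
  obtain B where B: "\<And>n. norm (inverse (qpoch q q n)) \<le> B"
    using inverse_qpoch_bounded[OF q q] by blast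
  show ?thesis
  proof (rule summable_comparison_test'[of "\<lambda>n. B * norm (q ^ (n choose 2) * x ^ n)"])
    show "summable (\<lambda>n. B * norm (q ^ (n choose 2) * x ^ n))"
      by (intro summable_mult summable_power_choose_two q)
    show "norm (norm ((-1) ^ n * q ^ (n choose 2) * x ^ n / qpoch q q n)) \<le>
        B * norm (q ^ (n choose 2) * x ^ n)" if "n \<ge> 0" for n
      using mult_right_mono[OF B[of n], of "norm (q ^ (n choose 2) * x ^ n)"]
      by (simp add: norm_divide norm_mult norm_power norm_inverse field_simps)
  qed
qed

lemma qpoch_tail:
  assumes "norm q < 1"
  shows "(1 - q ^ Suc n) / qpoch q q (Suc n) = 1 / qpoch q q n"
proof -
  have "1 - q ^ Suc n \<noteq> 0" using one_minus_neq_0 norm_power_less_1[OF assms] by blast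
  then show ?thesis by (simp add: qpoch_Suc)
qed

text \<open>The sum \<open>f\<close> satisfies \<open>f x * (1 - x) = f (x * q)\<close>. Iteration
  peels off the factors of the product, and the leftover tends to the constant coefficient
  1.\<close>

lemma euler1:
  assumes q: "norm q < 1" and x: "norm x < 1"
  shows "(\<lambda>n. x ^ n / qpoch q q n) sums (1 / qpoch_inf x q)"
proof -
  define f where "f = (\<lambda>x. \<Sum>n. (1 / qpoch q q n) * x ^ n)"
  have sm: "summable (\<lambda>n. (1 / qpoch q q n) * x ^ n)" if "norm x < 1" for x
    using summable_norm_cancel[OF summable_euler1[OF q that]] by simp
  have step: "f x * (1 - x) = f (x * q)" if x: "norm x < 1" for x
  proof -
    have xq: "norm (x * q) < 1" using norm_mult_power_less_1[OF x q, of 1] by simp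
    have "f x - f (x * q) = (\<Sum>n. (1 / qpoch q q n) * x ^ n - (1 / qpoch q q n) * (x * q) ^ n)"
      unfolding f_def by (intro suminf_diff sm x xq)
    also have "\<dots> = (\<Sum>n. x ^ n * ((1 - q ^ n) / qpoch q q n))"
      by (simp add: power_mult_distrib algebra_simps diff_divide_distrib)
    also have "\<dots> = (\<Sum>n. x ^ Suc n * ((1 - q ^ Suc n) / qpoch q q (Suc n)))"
    proof -
      have "summable (\<lambda>n. x ^ n * ((1 - q ^ n) / qpoch q q n))"
        using summable_diff[OF sm[OF x] sm[OF xq]]
        by (simp add: power_mult_distrib algebra_simps diff_divide_distrib)
      from suminf_split_head[OF this] show ?thesis by simp
    qed
    also have "\<dots> = (\<Sum>n. x * ((1 / qpoch q q n) * x ^ n))"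
      unfolding qpoch_tail[OF q] by (simp add: mult_ac)
    also have "\<dots> = x * f x" unfolding f_def by (rule suminf_mult[OF sm[OF x]])
    finally show ?thesis by (simp add: algebra_simps)
  qed
  have it: "f x * qpoch x q n = f (x * q ^ n)" for n
  proof (induction n)
    case (Suc n)
    have "f x * qpoch x q (Suc n) = f (x * q ^ n) * (1 - x * q ^ n)"
      by (simp add: qpoch_Suc Suc.IH[symmetric])
    then show ?case using step[OF norm_mult_power_less_1[OF x q, of n]]
      by (simp add: mult_ac)
  qed simp
  have "(\<lambda>n. f x * qpoch x q n) \<longlonglongrightarrow> 1 / qpoch q q 0"
    unfolding it unfolding f_def
    by (rule powser_functional_limit[OF q zero_less_one sm])
  moreover have "(\<lambda>n. f x * qpoch x q n) \<longlonglongrightarrow> f x * qpoch_inf x q"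
    by (intro tendsto_intros qpoch_tendsto q)
  ultimately have "f x * qpoch_inf x q = 1" using LIMSEQ_unique by fastforce
  then have "f x = 1 / qpoch_inf x q" using qpoch_inf_nonzero[OF q x] by (simp add: field_simps)
  then show ?thesis using summable_sums[OF sm[OF x]] by (simp add: f_def)
qed

text \<open>The same iteration with \<open>f x = (1 - x) * f (x * q)\<close>; this series is entire,
  so \<open>x\<close> is unrestricted.\<close>

lemma euler2:
  assumes q: "norm q < 1"
  shows "(\<lambda>n. (-1) ^ n * q ^ (n choose 2) * x ^ n / qpoch q q n) sums qpoch_inf x q"
proof -
  define a where "a = (\<lambda>n. (-1) ^ n * q ^ (n choose 2) / qpoch q q n)"
  define f where "f = (\<lambda>x. \<Sum>n. a n * x ^ n)"
  have sm: "summable (\<lambda>n. a n * x ^ n)" for x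
    using summable_norm_cancel[OF summable_euler2[OF q, of x]] by (simp add: a_def)
  have step: "f x = (1 - x) * f (x * q)" for x
  proof -
    have "f x - f (x * q) = (\<Sum>n. a n * x ^ n - a n * (x * q) ^ n)"
      unfolding f_def by (intro suminf_diff sm)
    also have "\<dots> = (\<Sum>n. a n * (1 - q ^ n) * x ^ n)"
      by (simp add: power_mult_distrib algebra_simps)
    also have "\<dots> = (\<Sum>n. a (Suc n) * (1 - q ^ Suc n) * x ^ Suc n)"
    proof -
      have "summable (\<lambda>n. a n * (1 - q ^ n) * x ^ n)"
        using summable_diff[OF sm[of x] sm[of "x * q"]]
        by (simp add: power_mult_distrib algebra_simps)
      from suminf_split_head[OF this] show ?thesis by simp
    qed
    also have "\<dots> = (\<Sum>n. - x * (a n * (x * q) ^ n))"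
    proof -
      have "a (Suc n) * (1 - q ^ Suc n) = - (a n * q ^ n)" for n
      proof -
        have "a (Suc n) * (1 - q ^ Suc n) =
            (-1) ^ Suc n * q ^ (Suc n choose 2) * ((1 - q ^ Suc n) / qpoch q q (Suc n))"
          by (simp add: a_def)
        then show ?thesis unfolding qpoch_tail[OF q] choose_two_Suc
          by (simp add: a_def power_add)
      qed
      then show ?thesis by (simp add: power_mult_distrib mult_ac)
    qed
    also have "\<dots> = - x * f (x * q)" unfolding f_def by (rule suminf_mult[OF sm])
    finally show ?thesis by (simp add: algebra_simps)
  qed
  have it: "f x = qpoch x q n * f (x * q ^ n)" for n
  proof (induction n)
    case (Suc n)
    then show ?case using step[of "x * q ^ n"] by (simp add: qpoch_Suc mult_ac)
  qed simp
  have "(\<lambda>n. qpoch x q n * f (x * q ^ n)) \<longlonglongrightarrow> qpoch_inf x q * a 0"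
    unfolding f_def
    by (intro tendsto_mult qpoch_tendsto q powser_functional_limit[OF q zero_less_one sm])
  then have "(\<lambda>n. f x) \<longlonglongrightarrow> qpoch_inf x q"
    unfolding it[symmetric] by (simp add: a_def numeral_2_eq_2)
  then have "f x = qpoch_inf x q" using LIMSEQ_unique tendsto_const by blast
  then show ?thesis using summable_sums[OF sm[of x]] by (simp add: f_def a_def)
qed

section \<open>Multiple sums with a quadratic weight\<close>

lemma choose_two_add: "(a + b) choose 2 = (a choose 2) + (b choose 2) + a * b"
  by (induction b) (simp_all add: choose_two_Suc)

lemma abs_summable_on_times:
  fixes f g :: "_ \<Rightarrow> 'c :: {real_normed_field, banach}"
  assumes "(\<lambda>x. norm (f x)) summable_on X" "(\<lambda>x. norm (g x)) summable_on Y"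
  shows "(\<lambda>z. norm (f (fst z) * g (snd z))) summable_on X \<times> Y"
proof -
  have "(\<Sum>\<^sub>\<infinity>y\<in>Y. norm (f x) * norm (g y)) = norm (f x) * (\<Sum>\<^sub>\<infinity>y\<in>Y. norm (g y))" for x
    by (rule infsum_cmult_right')
  then show ?thesis
    using assms by (subst Infinite_Sum.abs_summable_on_Sigma_iff)
      (auto simp: norm_mult abs_mult intro!: summable_on_cmult_right summable_on_cmult_left)
qed

lemma abs_summable_nat:
  fixes f :: "nat \<Rightarrow> 'a :: banach"
  assumes "summable (\<lambda>n. norm (f n))"
  shows "(\<lambda>n. norm (f n)) summable_on UNIV"
  using norm_summable_imp_summable_on[of "\<lambda>n. norm (f n)"] assms by simp

lemma has_sum_antidiagonal2:
  fixes f :: "nat \<times> nat \<Rightarrow> complex"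
  assumes "(f has_sum S) UNIV"
  shows "(\<lambda>n. \<Sum>m\<le>n. f (m, n - m)) sums S"
proof -
  have "((\<lambda>(n, m). f (m, n - m)) has_sum S) (SIGMA n:UNIV. {..n})"
    using assms
    by (subst has_sum_reindex_bij_witness[where i = "\<lambda>(a, b). (a + b, a)" and T = UNIV
        and j = "\<lambda>(n, m). (m, n - m)" and h = f and s' = S]) auto
  then have "((\<lambda>n. \<Sum>m\<le>n. f (m, n - m)) has_sum S) UNIV"
    by (rule has_sum_SigmaD) (simp add: has_sum_finite)
  then show ?thesis by (rule has_sum_imp_sums)
qed

text \<open>Indexing by the partial sums \<open>(a + b + c, a + b, a)\<close> makes the inner sums
  agree literally with the nested Cauchy products in \<open>f * g * h\<close>.\<close>

lemma has_sum_antidiagonal3: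
  fixes f :: "nat \<times> nat \<times> nat \<Rightarrow> complex"
  assumes "(f has_sum S) UNIV"
  shows "(\<lambda>n. \<Sum>m\<le>n. \<Sum>l\<le>m. f (l, m - l, n - m)) sums S"
proof -
  have "((\<lambda>(n, m, l). f (l, m - l, n - m)) has_sum S) (SIGMA n:UNIV. SIGMA m:{..n}. {..m})"
    using assms
    by (subst has_sum_reindex_bij_witness[where i = "\<lambda>(a, b, c). (a + b + c, a + b, a)" and T = UNIV
        and j = "\<lambda>(n, m, l). (l, m - l, n - m)" and h = f and s' = S]) auto
  then have "((\<lambda>n. \<Sum>(m, l)\<in>(SIGMA m:{..n}. {..m}). f (l, m - l, n - m)) has_sum S) UNIV"
    by (rule has_sum_SigmaD) (simp add: has_sum_finite case_prod_unfold)
  then show ?thesis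
    by (intro has_sum_imp_sums) (simp add: sum.Sigma)
qed

lemma has_sum_imp_iterated_sums:
  fixes f :: "nat \<times> nat \<Rightarrow> complex"
  assumes "(f has_sum S) UNIV" "\<And>n. (\<lambda>m. norm (f (n, m))) summable_on UNIV"
    and "\<And>n. (\<lambda>m. f (n, m)) sums g n"
  shows "g sums S"
proof -
  have "((\<lambda>m. f (n, m)) has_sum g n) UNIV" for n
  proof -
    obtain s where s: "((\<lambda>m. f (n, m)) has_sum s) UNIV"
      using Infinite_Sum.abs_summable_summable[OF assms(2)[of n]] by (auto simp: summable_on_def)
    have "s = g n" by (rule sums_unique2[OF has_sum_imp_sums[OF s] assms(3)])
    with s show ?thesis by simp
  qed
  then have "(g has_sum S) UNIV"
    using assms(1) by (rule_tac has_sum_SigmaD[where f = f and A = UNIV and B = "\<lambda>_. UNIV"]) simp_all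
  then show ?thesis by (rule has_sum_imp_sums)
qed

text \<open>Amounts to a positive radius of convergence. An explicit majorant is easy to multiply,
  and it is exactly what the weight \<open>p ^ (n choose 2)\<close> can absorb.\<close>

definition geo_bounded :: "complex fps \<Rightarrow> bool" where
  "geo_bounded f \<longleftrightarrow> (\<exists>K M. 0 \<le> K \<and> 0 \<le> M \<and> (\<forall>n. norm (f $ n) \<le> K * M ^ n))"

lemma geo_boundedI:
  assumes "\<And>n. norm (f $ n) \<le> K * M ^ n" "0 \<le> K" "0 \<le> M"
  shows "geo_bounded f"
  using assms unfolding geo_bounded_def by blast

lemma geo_boundedE:
  assumes "geo_bounded f"
  obtains K M where "\<And>n. norm (f $ n) \<le> K * M ^ n" "0 \<le> K" "0 \<le> M"
  using assms unfolding geo_bounded_def by blast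

text \<open>A Cauchy product has \<open>n + 1\<close> summands, each at most
  \<open>K * K' * L ^ n\<close> with \<open>L\<close> the larger ratio; the count is absorbed by
  \<open>n + 1 \<le> 2 ^ n\<close>, whence the ratio \<open>2 * L\<close>.\<close>

lemma geo_bounded_mult:
  assumes "geo_bounded f" "geo_bounded g"
  shows "geo_bounded (f * g)"
proof -
  obtain K M where f: "\<And>n. norm (f $ n) \<le> K * M ^ n" "0 \<le> K" "0 \<le> M" using geo_boundedE[OF assms(1)] by blast
  obtain K' M' where g: "\<And>n. norm (g $ n) \<le> K' * M' ^ n" "0 \<le> K'" "0 \<le> M'" using geo_boundedE[OF assms(2)] by blast
  define L where "L = max M M'"
  show ?thesis
  proof (rule geo_boundedI[where K = "K * K'" and M = "2 * L"])
    fix n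
    have "norm ((f * g) $ n) \<le> (\<Sum>i=0..n. norm (f $ i * g $ (n - i)))"
      unfolding fps_mult_nth by (rule norm_sum)
    also have "\<dots> \<le> (\<Sum>i=0..n. K * K' * L ^ n)"
    proof (rule sum_mono)
      fix i assume i: "i \<in> {0..n}"
      have "norm (f $ i) \<le> K * L ^ i"
        using f(1)[of i] mult_left_mono[OF power_mono[of M L i], of K] f(2,3) by (simp add: L_def)
      moreover have "norm (g $ (n - i)) \<le> K' * L ^ (n - i)"
        using g(1)[of "n - i"] mult_left_mono[OF power_mono[of M' L "n - i"], of K'] g(2,3) by (simp add: L_def)
      ultimately have "norm (f $ i) * norm (g $ (n - i)) \<le> (K * L ^ i) * (K' * L ^ (n - i))"
        using f g by (intro mult_mono) (auto simp: L_def)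
      also have "\<dots> = K * K' * L ^ n" using i by (simp add: power_add[symmetric])
      finally show "norm (f $ i * g $ (n - i)) \<le> K * K' * L ^ n" by (simp add: norm_mult)
    qed
    also have "\<dots> = real (Suc n) * (K * K' * L ^ n)" by simp
    also have "\<dots> \<le> 2 ^ n * (K * K' * L ^ n)"
    proof (rule mult_right_mono)
      show "real (Suc n) \<le> 2 ^ n"
        using less_exp[of n] by (metis Suc_leI of_nat_le_iff of_nat_numeral of_nat_power)
    qed (use f g in \<open>auto simp: L_def\<close>)
    finally show "norm ((f * g) $ n) \<le> K * K' * (2 * L) ^ n" by (simp add: power_mult_distrib mult_ac)
  qed (use f g in \<open>auto simp: L_def\<close>)
qed

lemma summable_geo_bounded:
  assumes "norm (p::complex) < 1" "geo_bounded f"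
  shows "summable (\<lambda>n. norm (p ^ (n choose 2) * f $ n))"
proof -
  obtain K M where f: "\<And>n. norm (f $ n) \<le> K * M ^ n" "0 \<le> K" "0 \<le> M" using geo_boundedE[OF assms(2)] by blast
  show ?thesis
  proof (rule summable_comparison_test'[of "\<lambda>n. K * norm (p ^ (n choose 2) * (of_real M) ^ n)"])
    show "summable (\<lambda>n. K * norm (p ^ (n choose 2) * (of_real M) ^ n))"
      by (intro summable_mult summable_power_choose_two assms)
    show "norm (norm (p ^ (n choose 2) * f $ n)) \<le> K * norm (p ^ (n choose 2) * (of_real M) ^ n)" for n
      using mult_left_mono[OF f(1)[of n], of "norm (p ^ (n choose 2))"] f(3)
      by (simp add: norm_mult norm_power mult_ac)
  qed
qed

text \<open>The cross term \<open>a * b\<close> in \<open>choose_two_add\<close> contributes a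
  factor of norm at most 1. Dropping it majorises a multiple sum by a product of single
  sums.\<close>

lemma norm_power_choose_two_add_le:
  assumes "norm (p::complex) < 1"
  shows "norm (p ^ ((a + b) choose 2)) \<le> norm (p ^ (a choose 2)) * norm (p ^ (b choose 2))"
  unfolding choose_two_add power_add norm_mult
  using assms by (intro mult_left_le mult_nonneg_nonneg) (auto simp: norm_power power_le_one)

text \<open>The linear functional sending \<open>z ^ n\<close> to \<open>p ^ (n choose 2)\<close>.
  Products of Euler series can be rearranged as formal power series before it is applied.\<close>

definition quad_sum :: "complex \<Rightarrow> complex fps \<Rightarrow> complex" where
  "quad_sum p f = (\<Sum>n. p ^ (n choose 2) * f $ n)"

lemma quad_sum_sums:
  assumes "norm p < 1" "geo_bounded f"
  shows "(\<lambda>n. p ^ (n choose 2) * f $ n) sums quad_sum p f"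
  unfolding quad_sum_def
  by (intro summable_sums summable_norm_cancel[OF summable_geo_bounded] assms)

text \<open>The weight is general because the sums for \<open>H10\<close> and \<open>H11\<close> use
  \<open>p ^ (n choose 2)\<close> divided by a q-Pochhammer symbol.\<close>

lemma abs_summable_quad2:
  fixes p :: complex and w :: "nat \<Rightarrow> complex"
  assumes p: "norm p < 1" and f: "geo_bounded f" "geo_bounded g"
    and w: "\<And>n. norm (w n) \<le> C * norm (p ^ (n choose 2))"
  shows "(\<lambda>z. norm (case z of (a, b) \<Rightarrow> w (a + b) * (f $ a * g $ b))) summable_on UNIV"
proof -
  have "(\<lambda>z. norm ((of_real C * (p ^ (fst z choose 2) * f $ fst z)) * (p ^ (snd z choose 2) * g $ snd z)))
      summable_on UNIV \<times> UNIV"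
    using summable_geo_bounded[OF p f(1)] summable_geo_bounded[OF p f(2)]
    by (intro abs_summable_on_times abs_summable_nat) (auto simp: norm_mult intro: summable_mult)
  then show ?thesis
    unfolding UNIV_Times_UNIV
  proof (rule Infinite_Sum.abs_summable_on_comparison_test)
    fix z :: "nat \<times> nat"
    obtain a b where z: "z = (a, b)" by (cases z)
    \<comment> \<open>At \<open>n = 0\<close> the assumption on the weight reads
      \<open>norm (w 0) \<le> C\<close>, as \<open>0 choose 2 = 0\<close>.\<close>
    have C: "C \<ge> 0" using w[of 0] norm_ge_zero[of "w 0"] by (simp add: numeral_2_eq_2 del: norm_ge_zero)
    have "norm (w (a + b)) \<le> C * (norm (p ^ (a choose 2)) * norm (p ^ (b choose 2)))"
      using w[of "a + b"] mult_left_mono[OF norm_power_choose_two_add_le[OF p, of a b] C] by linarith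
    from mult_right_mono[OF this, of "norm (f $ a) * norm (g $ b)"]
    show "norm (case z of (a, b) \<Rightarrow> w (a + b) * (f $ a * g $ b)) \<le>
        norm ((of_real C * (p ^ (fst z choose 2) * f $ fst z)) *
          (p ^ (snd z choose 2) * g $ snd z))"
      using C by (simp add: z norm_mult mult_ac)
  qed
qed


lemma abs_summable_quad3:
  fixes p :: complex
  assumes p: "norm p < 1" and f: "geo_bounded f" "geo_bounded g" "geo_bounded h"
  shows "(\<lambda>z. norm (case z of (a, b, c) \<Rightarrow> p ^ ((a + b + c) choose 2) * (f $ a * g $ b * h $ c))) summable_on UNIV"
proof -
  have "(\<lambda>z. norm ((p ^ (fst z choose 2) * f $ fst z) *
      (case snd z of (b, c) \<Rightarrow> p ^ ((b + c) choose 2) * (g $ b * h $ c)))) summable_on UNIV \<times> UNIV"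
    using summable_geo_bounded[OF p f(1)] abs_summable_quad2[OF p f(2,3), of "\<lambda>n. p ^ (n choose 2)" 1]
    by (intro abs_summable_on_times abs_summable_nat) auto
  then show ?thesis
    unfolding UNIV_Times_UNIV
  proof (rule Infinite_Sum.abs_summable_on_comparison_test)
    fix z :: "nat \<times> nat \<times> nat"
    obtain a b c where z: "z = (a, b, c)" by (cases z)
    from mult_right_mono[OF norm_power_choose_two_add_le[OF p, of a "b + c"],
        of "norm (f $ a) * norm (g $ b) * norm (h $ c)"]
    show "norm (case z of (a, b, c) \<Rightarrow> p ^ ((a + b + c) choose 2) * (f $ a * g $ b * h $ c)) \<le>
        norm ((p ^ (fst z choose 2) * f $ fst z) *
          (case snd z of (b, c) \<Rightarrow> p ^ ((b + c) choose 2) * (g $ b * h $ c)))"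
      by (simp add: z norm_mult mult_ac add.assoc)
  qed
qed

lemma quad_sum_mult3:
  assumes p: "norm p < 1" and f: "geo_bounded f" "geo_bounded g" "geo_bounded h"
  shows "((\<lambda>(a, b, c). p ^ ((a + b + c) choose 2) * (f $ a * g $ b * h $ c)) has_sum
    quad_sum p (f * g * h)) UNIV"
proof -
  let ?F = "\<lambda>(a, b, c). p ^ ((a + b + c) choose 2) * (f $ a * g $ b * h $ c)"
  obtain S where S: "(?F has_sum S) UNIV"
    using Infinite_Sum.abs_summable_summable[OF abs_summable_quad3[OF assms]] by (auto simp: summable_on_def)
  have "(\<Sum>m\<le>n. \<Sum>l\<le>m. ?F (l, m - l, n - m)) = p ^ (n choose 2) * (f * g * h) $ n" for n
    unfolding fps_mult_nth sum_distrib_left sum_distrib_right atMost_atLeast0[symmetric]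
    by (intro sum.cong refl) (auto simp: mult_ac)
  then have "(\<lambda>n. p ^ (n choose 2) * (f * g * h) $ n) sums S"
    using has_sum_antidiagonal3[OF S] by simp
  moreover have "(\<lambda>n. p ^ (n choose 2) * (f * g * h) $ n) sums quad_sum p (f * g * h)"
    by (intro quad_sum_sums geo_bounded_mult assms)
  ultimately show ?thesis using S sums_unique2 by blast
qed

lemma quad_sum_mult2:
  fixes p :: complex and w :: "nat \<Rightarrow> complex"
  assumes p: "norm p < 1" and f: "geo_bounded f" "geo_bounded g"
    and w: "\<And>n. norm (w n) \<le> C * norm (p ^ (n choose 2))"
  obtains S where "((\<lambda>(a, b). w (a + b) * (f $ a * g $ b)) has_sum S) UNIV"
    "(\<lambda>n. w n * (f * g) $ n) sums S"
proof -
  let ?F = "\<lambda>(a, b). w (a + b) * (f $ a * g $ b)"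
  obtain S where S: "(?F has_sum S) UNIV"
    using Infinite_Sum.abs_summable_summable[OF abs_summable_quad2[OF assms]] by (auto simp: summable_on_def)
  have "(\<Sum>m\<le>n. ?F (m, n - m)) = w n * (f * g) $ n" for n
    unfolding fps_mult_nth sum_distrib_left atMost_atLeast0[symmetric]
    by (intro sum.cong refl) auto
  then have "(\<lambda>n. w n * (f * g) $ n) sums S"
    using has_sum_antidiagonal2[OF S] by simp
  with S that show ?thesis by blast
qed

section \<open>Power series solutions of q-difference equations\<close>

text \<open>The substitution of \<open>p z\<close> for \<open>z\<close>. It lets functional
  equations of infinite products be treated as identities of formal power series, free of
  convergence questions.\<close>

definition fps_scale :: "complex \<Rightarrow> complex fps \<Rightarrow> complex fps" where
  "fps_scale p f = Abs_fps (\<lambda>n. p ^ n * f $ n)"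

lemma fps_scale_nth [simp]: "fps_scale p f $ n = p ^ n * f $ n"
  by (simp add: fps_scale_def)

lemma fps_scale_mult [simp]: "fps_scale p (f * g) = fps_scale p f * fps_scale p g"
proof (rule fps_ext)
  fix n
  have *: "p ^ n * (f $ i * g $ (n - i)) = p ^ i * f $ i * (p ^ (n - i) * g $ (n - i))" if "i \<in> {0..n}" for i
  proof -
    have "p ^ n = p ^ i * p ^ (n - i)" using that by (simp add: power_add[symmetric])
    then show ?thesis by simp
  qed
  show "fps_scale p (f * g) $ n = (fps_scale p f * fps_scale p g) $ n"
    unfolding fps_scale_nth fps_mult_nth sum_distrib_left by (intro sum.cong refl *)
qed

lemma fps_scale_diff [simp]: "fps_scale p (f - g) = fps_scale p f - fps_scale p g"
  by (simp add: fps_eq_iff algebra_simps)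

lemma fps_scale_const [simp]: "fps_scale p (fps_const c) = fps_const c"
  by (simp add: fps_eq_iff)

lemma fps_scale_1 [simp]: "fps_scale p 1 = 1"
  by (simp add: fps_eq_iff)

lemma fps_scale_X [simp]: "fps_scale p fps_X = fps_const p * fps_X"
  by (simp add: fps_eq_iff fps_X_def)

lemma fps_scale_power [simp]: "fps_scale p (f ^ n) = fps_scale p f ^ n"
  by (induction n) auto

lemma fps_scale_scale [simp]: "fps_scale p (fps_scale r f) = fps_scale (p * r) f"
  by (simp add: fps_eq_iff power_mult_distrib)

lemma geo_bounded_scale:
  assumes "geo_bounded f"
  shows "geo_bounded (fps_scale p f)"
proof -
  obtain K M where f: "\<And>n. norm (f $ n) \<le> K * M ^ n" "0 \<le> K" "0 \<le> M" using geo_boundedE[OF assms(1)] by blast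
  have "norm (fps_scale p f $ n) \<le> K * (norm p * M) ^ n" for n
    using mult_left_mono[OF f(1)[of n], of "norm p ^ n"]
    by (simp add: norm_mult norm_power power_mult_distrib mult_ac)
  then show ?thesis using f by (intro geo_boundedI[where K = K and M = "norm p * M"]) auto
qed

text \<open>If the difference \<open>h\<close> of two solutions vanishes below \<open>n\<close>,
  only the constant terms of \<open>a\<close> and \<open>b\<close> act on coefficient
  \<open>n\<close>. So \<open>h $ n = r ^ n * h $ n\<close>, which forces 0.\<close>

lemma fps_scale_eq_unique:
  assumes "a * f = b * fps_scale r f" "a * g = b * fps_scale r g"
    and "a $ 0 = 1" "b $ 0 = 1" and r: "\<And>n. n > 0 \<Longrightarrow> r ^ n \<noteq> 1" and "f $ 0 = g $ 0"
  shows "f = g"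
proof -
  define h where "h = f - g"
  have h: "a * h = b * fps_scale r h" using assms(1,2) by (simp add: h_def algebra_simps)
  have "h $ n = 0" for n
  proof (induction n rule: less_induct)
    case (less n)
    show ?case
    proof (cases "n = 0")
      case False
      have *: "(c * k) $ n = c $ 0 * k $ n" if "\<And>i. i < n \<Longrightarrow> k $ i = 0" for c k :: "complex fps"
        unfolding fps_mult_nth using that by (subst sum.remove[of _ 0]) (auto intro!: sum.neutral)
      have "h $ n = r ^ n * h $ n"
        using arg_cong[OF h, of "\<lambda>f. f $ n"] less.IH by (simp add: * assms(3,4))
      then show ?thesis using r[of n] False by auto
    qed (use assms(6) in \<open>simp add: h_def\<close>)
  qed
  then have "h = 0" by (simp add: fps_eq_iff)
  then show ?thesis by (simp add: h_def)
qed

text \<open>The series \<open>1 / (c z\<^sup>d; q)\<^sub>\<infinity>\<close> and \<open>(c z\<^sup>d; q)\<^sub>\<infinity>\<close> of Euler, as formal power series in \<open>z\<close>.\<close>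

definition fps_euler1 :: "nat \<Rightarrow> complex \<Rightarrow> complex \<Rightarrow> complex fps" where
  "fps_euler1 d q c = Abs_fps (\<lambda>n. if d dvd n then c ^ (n div d) / qpoch q q (n div d) else 0)"

definition fps_euler2 :: "nat \<Rightarrow> complex \<Rightarrow> complex \<Rightarrow> complex fps" where
  "fps_euler2 d q c = Abs_fps (\<lambda>n. if d dvd n then
     (-1) ^ (n div d) * q ^ ((n div d) choose 2) * c ^ (n div d) / qpoch q q (n div d) else 0)"

lemma fps_euler_nth_0 [simp]: "fps_euler1 d q c $ 0 = 1" "fps_euler2 d q c $ 0 = 1"
  by (simp_all add: fps_euler1_def fps_euler2_def numeral_2_eq_2)

lemma fps_euler_nth_mult [simp]:
  assumes "d > 0"
  shows "fps_euler1 d q c $ (d * n) = c ^ n / qpoch q q n"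
    "fps_euler2 d q c $ (d * n) = (-1) ^ n * q ^ (n choose 2) * c ^ n / qpoch q q n"
  using assms by (simp_all add: fps_euler1_def fps_euler2_def)

lemma fps_euler_nth_1 [simp]:
  "fps_euler1 (Suc 0) q c $ n = c ^ n / qpoch q q n"
  "fps_euler2 (Suc 0) q c $ n = (-1) ^ n * q ^ (n choose 2) * c ^ n / qpoch q q n"
  by (simp_all add: fps_euler1_def fps_euler2_def)

lemma fps_euler_nth_not_dvd:
  assumes "\<not> d dvd n"
  shows "fps_euler1 d q c $ n = 0" "fps_euler2 d q c $ n = 0"
  using assms by (simp_all add: fps_euler1_def fps_euler2_def)

lemma fps_scale_euler:
  assumes "d > 0"
  shows "fps_scale r (fps_euler1 d q c) = fps_euler1 d q (c * r ^ d)"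
    "fps_scale r (fps_euler2 d q c) = fps_euler2 d q (c * r ^ d)"
  using assms
  by (auto simp: fps_eq_iff fps_euler1_def fps_euler2_def power_mult_distrib power_mult elim!: dvdE)

lemma fps_nth_one_minus_X_power_mult:
  fixes f :: "complex fps"
  shows "((1 - fps_const c * fps_X ^ d) * f) $ n = f $ n - (if n < d then 0 else c * f $ (n - d))"
proof -
  have "(1 - fps_const c * fps_X ^ d) * f = f - fps_const c * (fps_X ^ d * f)"
    by (simp only: left_diff_distrib mult.assoc mult_1_left)
  then show ?thesis by (simp add: fps_X_power_mult_nth)
qed

text \<open>Removing the first factor of \<open>1 / (c z^d; q)_inf\<close> replaces \<open>c\<close>
  by \<open>c q\<close>, and so does the substitution of \<open>r z\<close> for \<open>z\<close>
  when \<open>r ^ d = q\<close>. The freedom in \<open>r\<close> lets factors with different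
  \<open>d\<close> and different bases be scaled by one common number.\<close>

lemma fps_euler1_eq:
  assumes q: "norm q < 1" and d: "d > 0" and r: "r ^ d = q"
  shows "(1 - fps_const c * fps_X ^ d) * fps_euler1 d q c = fps_scale r (fps_euler1 d q c)"
proof (rule fps_ext)
  fix n
  show "((1 - fps_const c * fps_X ^ d) * fps_euler1 d q c) $ n = fps_scale r (fps_euler1 d q c) $ n"
  proof (cases "d dvd n")
    case False
    then have "\<not> d dvd (n - d)" if "\<not> n < d" using that by (simp add: dvd_minus_self)
    with False show ?thesis by (simp add: fps_nth_one_minus_X_power_mult fps_euler_nth_not_dvd)
  next
    case True
    then obtain m where n: "n = d * m" by (elim dvdE)
    show ?thesis
    proof (cases m)
      case 0
      then show ?thesis using n d by (simp add: fps_nth_one_minus_X_power_mult)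
    next
      case (Suc k)
      have *: "n - d = d * k" "\<not> n < d" by (simp_all add: n Suc)
      have "((1 - fps_const c * fps_X ^ d) * fps_euler1 d q c) $ n =
          c ^ Suc k / qpoch q q (Suc k) - c ^ Suc k * (1 / qpoch q q k)"
        unfolding fps_nth_one_minus_X_power_mult * using d by (simp add: n Suc * del: mult_Suc_right)
      also have "\<dots> = q ^ Suc k * (c ^ Suc k / qpoch q q (Suc k))"
        unfolding qpoch_tail[OF q, symmetric] by (simp add: diff_divide_distrib algebra_simps)
      also have "q ^ Suc k = r ^ n" by (simp add: n Suc power_mult r del: mult_Suc_right)
      finally show ?thesis using d by (simp add: n Suc del: mult_Suc_right)
    qed
  qed
qed

lemma fps_euler2_eq:
  assumes q: "norm q < 1" and d: "d > 0" and r: "r ^ d = q"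
  shows "fps_euler2 d q c = (1 - fps_const c * fps_X ^ d) * fps_scale r (fps_euler2 d q c)"
proof (rule fps_ext)
  fix n
  show "fps_euler2 d q c $ n = ((1 - fps_const c * fps_X ^ d) * fps_scale r (fps_euler2 d q c)) $ n"
  proof (cases "d dvd n")
    case False
    then have "\<not> d dvd (n - d)" if "\<not> n < d" using that by (simp add: dvd_minus_self)
    with False show ?thesis by (simp add: fps_nth_one_minus_X_power_mult fps_euler_nth_not_dvd)
  next
    case True
    then obtain m where n: "n = d * m" by (elim dvdE)
    show ?thesis
    proof (cases m)
      case 0
      then show ?thesis using n d by (simp add: fps_nth_one_minus_X_power_mult)
    next
      case (Suc k)
      have *: "n - d = d * k" "\<not> n < d" by (simp_all add: n Suc)
      define e where "e = (-1) ^ k * q ^ (k choose 2) * q ^ k * c ^ Suc k"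
      have "((1 - fps_const c * fps_X ^ d) * fps_scale r (fps_euler2 d q c)) $ n =
          q ^ Suc k * (- e / qpoch q q (Suc k)) - e * (1 / qpoch q q k)"
        unfolding fps_nth_one_minus_X_power_mult * using d
        by (simp add: n Suc * power_mult r choose_two_Suc power_add e_def mult_ac del: mult_Suc_right)
      also have "\<dots> = - e / qpoch q q (Suc k)"
        unfolding qpoch_tail[OF q, symmetric] by (simp add: diff_divide_distrib algebra_simps)
      also have "\<dots> = fps_euler2 d q c $ n"
        using d by (simp add: n Suc e_def choose_two_Suc power_add del: mult_Suc_right)
      finally show ?thesis by simp
    qed
  qed
qed

lemma geo_bounded_euler1:
  assumes q: "norm q < 1" and d: "d > 0"
  shows "geo_bounded (fps_euler1 d q c)"
proof -
  obtain B where B: "B > 0" "\<And>n. norm (inverse (qpoch q q n)) \<le> B"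
    using inverse_qpoch_bounded[OF q q] by blast
  \<comment> \<open>The coefficient at \<open>d * m\<close> grows like \<open>norm c ^ m\<close>;
    the maximum with 1 ensures \<open>M ^ m \<le> M ^ (d * m)\<close>.\<close>
  define M where "M = max 1 (norm c)"
  have "norm (fps_euler1 d q c $ n) \<le> B * M ^ n" for n
  proof (cases "d dvd n")
    case True
    then obtain m where n: "n = d * m" by (elim dvdE)
    have "norm (c ^ m) \<le> M ^ m" unfolding norm_power by (intro power_mono) (auto simp: M_def)
    also have "\<dots> \<le> M ^ n" using d by (intro power_increasing) (auto simp: M_def n)
    finally have "norm (inverse (qpoch q q m)) * norm (c ^ m) \<le> B * M ^ n"
      using B by (intro mult_mono) (auto simp: less_imp_le)
    then show ?thesis using d by (simp add: n norm_divide norm_inverse field_simps)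
  qed (use B in \<open>simp add: fps_euler_nth_not_dvd M_def\<close>)
  then show ?thesis using B by (intro geo_boundedI[where K = B and M = M]) (auto simp: M_def)
qed

lemma geo_bounded_euler2:
  assumes q: "norm q < 1" and d: "d > 0"
  shows "geo_bounded (fps_euler2 d q c)"
proof -
  obtain K M where f: "\<And>n. norm (fps_euler1 d q c $ n) \<le> K * M ^ n" "0 \<le> K" "0 \<le> M"
    using geo_boundedE[OF geo_bounded_euler1[OF assms]] by blast
  have "norm (fps_euler2 d q c $ n) \<le> norm (fps_euler1 d q c $ n)" for n
  proof (cases "d dvd n")
    case True
    then obtain m where n: "n = d * m" by (elim dvdE)
    have "norm (q ^ (m choose 2)) * norm (c ^ m / qpoch q q m) \<le> 1 * norm (c ^ m / qpoch q q m)"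
      using q by (intro mult_right_mono) (auto simp: norm_power power_le_one)
    then show ?thesis using d by (simp add: n norm_mult norm_divide norm_power)
  qed (simp add: fps_euler_nth_not_dvd)
  then show ?thesis using f by (intro geo_boundedI[where K = K and M = M]) (auto intro: order_trans)
qed

lemma power_neq_1:
  fixes q :: complex
  assumes "norm q < 1" "n > 0"
  shows "q ^ n \<noteq> 1"
  using norm_power_less_1[OF assms] by auto

text \<open>The product is invariant under the scaling of \<open>z\<close> by \<open>q\<close>, so
  it equals its constant coefficient.\<close>

lemma fps_euler_inverse:
  assumes q: "norm q < 1"
  shows "fps_euler1 (Suc 0) q c * fps_euler2 (Suc 0) q c = 1"
proof (rule fps_scale_eq_unique[where a = 1 and b = 1 and r = q])
  let ?E = "fps_euler1 (Suc 0) q c" and ?P = "fps_euler2 (Suc 0) q c"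
  have "?E * ?P = ?E * ((1 - fps_const c * fps_X ^ Suc 0) * fps_scale q ?P)"
    by (subst fps_euler2_eq[OF q, of "Suc 0" q c]) auto
  also have "\<dots> = ((1 - fps_const c * fps_X ^ Suc 0) * ?E) * fps_scale q ?P"
    by (simp only: mult_ac)
  also have "\<dots> = fps_scale q (?E * ?P)"
    by (subst fps_euler1_eq[OF q, where r = q]) auto
  finally show "1 * (?E * ?P) = 1 * fps_scale q (?E * ?P)" by (simp only: mult_1_left)
qed (use power_neq_1[OF q] in auto)

text \<open>The cross term of \<open>p ^ ((n + m) choose 2)\<close> is \<open>(p ^ n) ^ m\<close>,
  so the sum over the index \<open>m\<close> of the split factor is Euler's second series at
  \<open>- (c * p ^ n)\<close>. Its value is an infinite product, and the double sum collapses to a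
  single one.\<close>

lemma quad_sum_mult_euler1:
  assumes p: "norm p < 1" and g: "geo_bounded g"
  shows "(\<lambda>n. p ^ (n choose 2) * g $ n * qpoch_inf (- (c * p ^ n)) p) sums
    quad_sum p (g * fps_euler1 (Suc 0) p c)"
proof -
  let ?e = "fps_euler1 (Suc 0) p c"
  obtain S where S: "((\<lambda>(a, b). p ^ ((a + b) choose 2) * (g $ a * ?e $ b)) has_sum S) UNIV"
    "(\<lambda>n. p ^ (n choose 2) * (g * ?e) $ n) sums S"
    using quad_sum_mult2[OF p g geo_bounded_euler1[OF p, of "Suc 0" c], of "\<lambda>n. p ^ (n choose 2)" 1] by auto
  have S': "S = quad_sum p (g * ?e)"
    by (intro sums_unique2[OF S(2)] quad_sum_sums geo_bounded_mult geo_bounded_euler1 p g) simp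
  have sgn: "(-1) ^ m * y * (- x) ^ m = y * x ^ m" for x y :: complex and m
  proof -
    have "(-1) ^ m * (- x) ^ m = x ^ m" unfolding power_mult_distrib[symmetric] by simp
    then show ?thesis by (metis mult.assoc mult.commute)
  qed
  have summand: "p ^ ((n + m) choose 2) * (g $ n * ?e $ m) =
      p ^ (n choose 2) * g $ n * ((-1) ^ m * p ^ (m choose 2) * (- (c * p ^ n)) ^ m / qpoch p p m)" for n m
    unfolding sgn choose_two_add power_add power_mult power_mult_distrib fps_euler_nth_1
    by (simp only: times_divide_eq_right mult_ac)
  have "(\<lambda>n. p ^ (n choose 2) * g $ n * qpoch_inf (- (c * p ^ n)) p) sums S"
  proof (rule has_sum_imp_iterated_sums[OF S(1)])
    fix n
    show "(\<lambda>m. case (n, m) of (a, b) \<Rightarrow> p ^ ((a + b) choose 2) * (g $ a * ?e $ b)) sums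
        (p ^ (n choose 2) * g $ n * qpoch_inf (- (c * p ^ n)) p)"
      unfolding prod.case summand by (intro sums_mult euler2 p)
    show "(\<lambda>m. norm (case (n, m) of (a, b) \<Rightarrow> p ^ ((a + b) choose 2) * (g $ a * ?e $ b))) summable_on UNIV"
      unfolding prod.case summand
      using summable_mult[OF summable_euler2[OF p, of "- (c * p ^ n)"], of "norm (p ^ (n choose 2) * g $ n)"]
      by (intro abs_summable_nat) (simp only: norm_mult)
  qed
  then show ?thesis by (simp add: S')
qed

section \<open>The triple sums as quadratically weighted power series\<close>

lemma has_sum_multiples:
  fixes f g h :: "complex fps"
  assumes "((\<lambda>(a, b, c). w (a + b + c) * (f $ a * g $ b * h $ c)) has_sum S) UNIV"
    and "\<And>b. \<not> 2 dvd b \<Longrightarrow> g $ b = 0" "\<And>c. \<not> 3 dvd c \<Longrightarrow> h $ c = 0"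
  shows "((\<lambda>(i, j, k). w (i + 2 * j + 3 * k) * (f $ i * g $ (2 * j) * h $ (3 * k))) has_sum S) UNIV"
proof -
  let ?F = "\<lambda>(a, b, c). w (a + b + c) * (f $ a * g $ b * h $ c)"
  let ?m = "\<lambda>(i, j, k). (i, 2 * j, 3 * k) :: nat \<times> nat \<times> nat"
  have "(?F has_sum S) (range ?m)"
  proof (rule has_sum_cong_neutral[THEN iffD1, OF _ _ _ assms(1)])
    fix z :: "nat \<times> nat \<times> nat"
    assume z: "z \<in> UNIV - range ?m"
    obtain a b c where abc: "z = (a, b, c)" by (cases z)
    have "\<not> (2 dvd b \<and> 3 dvd c)"
    proof
      assume "2 dvd b \<and> 3 dvd c"
      then obtain j k where "b = 2 * j" "c = 3 * k" by (auto elim!: dvdE)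
      then have "z = ?m (a, j, k)" by (simp add: abc)
      with z show False by blast
    qed
    then show "?F z = 0" using assms(2,3) by (auto simp: abc)
  qed auto
  moreover have "inj ?m" by (auto simp: inj_on_def)
  ultimately have "(?F \<circ> ?m has_sum S) UNIV" by (simp add: has_sum_reindex)
  moreover have "?F \<circ> ?m = (\<lambda>(i, j, k). w (i + 2 * j + 3 * k) * (f $ i * g $ (2 * j) * h $ (3 * k)))"
    by (auto simp: fun_eq_iff)
  ultimately show ?thesis by simp
qed

lemma two_mult_choose_two: "2 * (n choose 2) = n * (n - 1)"
proof (induction n)
  case (Suc n)
  then show ?case by (cases n) (simp_all add: choose_two_Suc algebra_simps)
qed (simp add: numeral_2_eq_2)

lemma square_eq_choose_two: "k\<^sup>2 = 2 * (k choose 2) + k"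
  unfolding two_mult_choose_two by (cases k) (simp_all add: power2_eq_square)

text \<open>Since \<open>k^2 = 2 * (k choose 2) + k\<close>, the term \<open>3 k^2\<close> gives the
  third Euler factor the base \<open>q ^ 6\<close> and adds 3 to the exponent of its argument. The
  sign \<open>(-1) ^ k\<close> is the one that Euler's second series carries.\<close>

lemma triple_sum_sign:
  assumes q: "norm q < 1"
  shows "(\<Sum>\<^sub>\<infinity>(i, j, k)\<in>UNIV.
      (-1) ^ k * q ^ ((i + 2 * j + 3 * k) * (i + 2 * j + 3 * k - 1) + 3 * k\<^sup>2 + (a * i + b * j + c * k)) /
      (qpoch q q i * qpoch (q ^ 4) (q ^ 4) j * qpoch (q ^ 6) (q ^ 6) k) * 1 ^ (i + 2 * j + 3 * k)) =
    quad_sum (q\<^sup>2) (fps_euler1 (Suc 0) q (q ^ a) * fps_euler1 2 (q ^ 4) (q ^ b) * fps_euler2 3 (q ^ 6) (q ^ (c + 3)))"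
    (is "infsum ?F UNIV = quad_sum _ (?f * ?g * ?h)")
proof -
  have n: "norm (q ^ n) < 1" if "n > 0" for n using norm_power_less_1[OF q that] .
  have "((\<lambda>(i, j, k). (q\<^sup>2) ^ ((i + 2 * j + 3 * k) choose 2) * (?f $ i * ?g $ (2 * j) * ?h $ (3 * k))) has_sum
      quad_sum (q\<^sup>2) (?f * ?g * ?h)) UNIV"
    by (rule has_sum_multiples[where w = "\<lambda>n. (q\<^sup>2) ^ (n choose 2)", OF quad_sum_mult3])
       (auto intro!: geo_bounded_euler1 geo_bounded_euler2 q n simp: fps_euler_nth_not_dvd)
  moreover have "(\<lambda>(i, j, k). (q\<^sup>2) ^ ((i + 2 * j + 3 * k) choose 2) * (?f $ i * ?g $ (2 * j) * ?h $ (3 * k))) = ?F"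
  proof (intro ext, clarify)
    fix i j k :: nat
    let ?N = "i + 2 * j + 3 * k"
    have e: "?N * (?N - 1) + 3 * k\<^sup>2 + (a * i + b * j + c * k) =
        2 * (?N choose 2) + a * i + b * j + 6 * (k choose 2) + (c + 3) * k"
      unfolding two_mult_choose_two[symmetric] square_eq_choose_two[of k] by (simp add: algebra_simps)
    have pw: "q ^ (?N * (?N - 1) + 3 * k\<^sup>2 + (a * i + b * j + c * k)) =
        (q\<^sup>2) ^ (?N choose 2) * (q ^ a) ^ i * (q ^ b) ^ j * (q ^ 6) ^ (k choose 2) * (q ^ (c + 3)) ^ k"
      unfolding e by (simp only: power_add power_mult)
    have "(q\<^sup>2) ^ (?N choose 2) * (?f $ i * ?g $ (2 * j) * ?h $ (3 * k)) =
        (q\<^sup>2) ^ (?N choose 2) * ((q ^ a) ^ i / qpoch q q i * ((q ^ b) ^ j / qpoch (q ^ 4) (q ^ 4) j) *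
          ((-1) ^ k * (q ^ 6) ^ (k choose 2) * (q ^ (c + 3)) ^ k / qpoch (q ^ 6) (q ^ 6) k))" by simp
    also have "\<dots> = (-1) ^ k * q ^ (?N * (?N - 1) + 3 * k\<^sup>2 + (a * i + b * j + c * k)) /
      (qpoch q q i * qpoch (q ^ 4) (q ^ 4) j * qpoch (q ^ 6) (q ^ 6) k) * 1 ^ ?N"
      unfolding pw by (simp only: times_divide_eq_left times_divide_eq_right
          divide_divide_eq_left power_one mult_1_right mult_1_left mult_ac)
    finally show "(q\<^sup>2) ^ (?N choose 2) * (?f $ i * ?g $ (2 * j) * ?h $ (3 * k)) =
      (-1) ^ k * q ^ (?N * (?N - 1) + 3 * k\<^sup>2 + (a * i + b * j + c * k)) /
      (qpoch q q i * qpoch (q ^ 4) (q ^ 4) j * qpoch (q ^ 6) (q ^ 6) k) * 1 ^ ?N" .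
  qed
  ultimately show ?thesis by (simp add: infsumI)
qed

text \<open>Here \<open>j^2\<close> makes the middle factor a series of Euler's second kind with
  base \<open>q ^ 2\<close>. The summand has no sign, so the argument is negated to cancel
  \<open>(-1) ^ j\<close>.\<close>

lemma triple_sum_half:
  assumes q: "norm q < 1"
  shows "(\<Sum>\<^sub>\<infinity>(i, j, k)\<in>UNIV.
      q ^ ((i + 2 * j + 3 * k) * (i + 2 * j + 3 * k - 1) div 2 + j\<^sup>2 + (a * i + b * j + c * k)) /
      (qpoch q q i * qpoch (q ^ 2) (q ^ 2) j * qpoch (q ^ 3) (q ^ 3) k) * 1 ^ (i + 2 * j + 3 * k)) =
    quad_sum q (fps_euler1 (Suc 0) q (q ^ a) * fps_euler2 2 (q ^ 2) (- (q ^ (b + 1))) * fps_euler1 3 (q ^ 3) (q ^ c))"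
    (is "infsum ?F UNIV = quad_sum _ (?f * ?g * ?h)")
proof -
  have n: "norm (q ^ n) < 1" if "n > 0" for n using norm_power_less_1[OF q that] .
  have "((\<lambda>(i, j, k). q ^ ((i + 2 * j + 3 * k) choose 2) * (?f $ i * ?g $ (2 * j) * ?h $ (3 * k))) has_sum
      quad_sum q (?f * ?g * ?h)) UNIV"
    by (rule has_sum_multiples[where w = "\<lambda>n. q ^ (n choose 2)", OF quad_sum_mult3])
       (auto intro!: geo_bounded_euler1 geo_bounded_euler2 q n simp: fps_euler_nth_not_dvd)
  moreover have "(\<lambda>(i, j, k). q ^ ((i + 2 * j + 3 * k) choose 2) * (?f $ i * ?g $ (2 * j) * ?h $ (3 * k))) = ?F"
  proof (intro ext, clarify)
    fix i j k :: nat
    let ?N = "i + 2 * j + 3 * k"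
    have e: "?N * (?N - 1) div 2 + j\<^sup>2 + (a * i + b * j + c * k) =
        (?N choose 2) + a * i + 2 * (j choose 2) + (b + 1) * j + c * k"
      unfolding two_mult_choose_two[symmetric] square_eq_choose_two[of j] by (simp add: algebra_simps)
    have s: "(-1) ^ j * (- x) ^ j = x ^ j" for x :: complex
      unfolding power_mult_distrib[symmetric] by simp
    have s: "(-1) ^ j * y * (- x) ^ j = y * x ^ j" for x y :: complex
      using s[of x] by (metis mult.assoc mult.commute)
    have pw: "q ^ (?N * (?N - 1) div 2 + j\<^sup>2 + (a * i + b * j + c * k)) =
        q ^ (?N choose 2) * (q ^ a) ^ i * (q\<^sup>2) ^ (j choose 2) * (q ^ (b + 1)) ^ j * (q ^ c) ^ k"
      unfolding e by (simp only: power_add power_mult)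
    have "q ^ (?N choose 2) * (?f $ i * ?g $ (2 * j) * ?h $ (3 * k)) =
        q ^ (?N choose 2) * ((q ^ a) ^ i / qpoch q q i *
          ((-1) ^ j * (q\<^sup>2) ^ (j choose 2) * (- (q ^ (b + 1))) ^ j / qpoch (q\<^sup>2) (q\<^sup>2) j) *
          ((q ^ c) ^ k / qpoch (q ^ 3) (q ^ 3) k))" by simp
    also have "\<dots> = q ^ (?N * (?N - 1) div 2 + j\<^sup>2 + (a * i + b * j + c * k)) /
      (qpoch q q i * qpoch (q ^ 2) (q ^ 2) j * qpoch (q ^ 3) (q ^ 3) k) * 1 ^ ?N"
      unfolding pw s by (simp only: times_divide_eq_left times_divide_eq_right
          divide_divide_eq_left power_one mult_1_right mult_1_left mult_ac)
    finally show "q ^ (?N choose 2) * (?f $ i * ?g $ (2 * j) * ?h $ (3 * k)) =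
      q ^ (?N * (?N - 1) div 2 + j\<^sup>2 + (a * i + b * j + c * k)) /
      (qpoch q q i * qpoch (q ^ 2) (q ^ 2) j * qpoch (q ^ 3) (q ^ 3) k) * 1 ^ ?N" .
  qed
  ultimately show ?thesis by (simp add: infsumI)
qed

lemma H_first:
  assumes q: "norm q < 1" and l: "l \<in> {1, 2, 3, 6, 7}" and A: "\<And>i j k. A l i j k = a * i + b * j + c * k"
  shows "H l 1 q = quad_sum (q\<^sup>2)
    (fps_euler1 (Suc 0) q (q ^ a) * fps_euler1 2 (q ^ 4) (q ^ b) * fps_euler2 3 (q ^ 6) (q ^ (c + 3)))"
  unfolding H_def A triple_sum_sign[OF q] using l by (simp only: if_True)

lemma H_second:
  assumes q: "norm q < 1" and l: "l \<in> {10, 11}" and A: "\<And>i j k. A l i j k = a * i + b * j + c * k"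
  shows "H l 1 q = quad_sum q
    (fps_euler1 (Suc 0) q (q ^ a) * fps_euler2 2 (q ^ 2) (- (q ^ (b + 1))) * fps_euler1 3 (q ^ 3) (q ^ c))"
proof -
  have "l \<notin> {1, 2, 3, 6, 7}" using l by auto
  then show ?thesis
    unfolding H_def A triple_sum_half[OF q] using l by (simp only: if_True if_False)
qed

text \<open>Evaluation at \<open>z = 1\<close>, where the power \<open>z ^ d\<close> is no longer
  visible.\<close>

lemma sums_fps_euler1:
  assumes q: "norm q < 1" and d: "d > 0" and c: "norm c < 1"
  shows "(\<lambda>n. fps_euler1 d q c $ n) sums (1 / qpoch_inf c q)" "summable (\<lambda>n. norm (fps_euler1 d q c $ n))"
proof -
  have m: "strict_mono (\<lambda>n. d * n)" using d by (simp add: strict_mono_def)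
  have z: "fps_euler1 d q c $ n = 0" if "n \<notin> range (\<lambda>n. d * n)" for n
    using that by (intro fps_euler_nth_not_dvd) (auto elim!: dvdE)
  show "(\<lambda>n. fps_euler1 d q c $ n) sums (1 / qpoch_inf c q)"
    by (subst sums_mono_reindex[OF m z, symmetric]) (use euler1[OF q c] d in simp_all)
  show "summable (\<lambda>n. norm (fps_euler1 d q c $ n))"
    using summable_mono_reindex[OF m, of "\<lambda>n. norm (fps_euler1 d q c $ n)"] z summable_euler1[OF q c] d by simp
qed

lemma sums_fps_euler2:
  assumes q: "norm q < 1" and d: "d > 0"
  shows "(\<lambda>n. fps_euler2 d q c $ n) sums qpoch_inf c q" "summable (\<lambda>n. norm (fps_euler2 d q c $ n))"
proof -
  have m: "strict_mono (\<lambda>n. d * n)" using d by (simp add: strict_mono_def)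
  have z: "fps_euler2 d q c $ n = 0" if "n \<notin> range (\<lambda>n. d * n)" for n
    using that by (intro fps_euler_nth_not_dvd) (auto elim!: dvdE)
  show "(\<lambda>n. fps_euler2 d q c $ n) sums qpoch_inf c q"
    by (subst sums_mono_reindex[OF m z, symmetric]) (use euler2[OF q] d in simp_all)
  show "summable (\<lambda>n. norm (fps_euler2 d q c $ n))"
    using summable_mono_reindex[OF m, of "\<lambda>n. norm (fps_euler2 d q c $ n)"] z summable_euler2[OF q] d by simp
qed

lemma sums_fps_mult:
  fixes f g :: "complex fps"
  assumes "(\<lambda>n. f $ n) sums a" "(\<lambda>n. g $ n) sums b"
    and "summable (\<lambda>n. norm (f $ n))" "summable (\<lambda>n. norm (g $ n))"
  shows "(\<lambda>n. (f * g) $ n) sums (a * b)"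
  using Cauchy_product_sums[OF assms(3,4)] sums_unique[OF assms(1)] sums_unique[OF assms(2)]
  by (simp add: fps_mult_nth atMost_atLeast0)

text \<open>Euler's identity between partitions into distinct parts and into odd parts. Both the
  parity splitting of \<open>(p; p)_inf\<close> and the product
  \<open>(p; p)_inf (-p; p)_inf\<close> bring in \<open>(p^2; p^2)_inf\<close>, which
  cancels.\<close>

lemma qpoch_inf_minus_self:
  assumes p: "norm p < 1"
  shows "qpoch_inf (- p) p * qpoch_inf p (p\<^sup>2) = 1"
proof -
  have p2: "norm (p\<^sup>2) < 1" using norm_power_less_1[OF p, of 2] by simp
  have "qpoch_inf p p = qpoch_inf p (p\<^sup>2) * qpoch_inf (p\<^sup>2) (p\<^sup>2)"
    using qpoch_inf_dissect[OF p, of 2 p] by (simp add: numeral_2_eq_2)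
  moreover have "qpoch_inf p p * qpoch_inf (- p) p = qpoch_inf (p\<^sup>2) (p\<^sup>2)"
    by (rule qpoch_inf_mult_neg[OF p])
  moreover have "qpoch_inf (p\<^sup>2) (p\<^sup>2) \<noteq> 0" by (intro qpoch_inf_nonzero p2)
  ultimately show ?thesis by (simp add: field_simps)
qed

section \<open>The sums \<open>H\<^sub>6\<close> and \<open>H\<^sub>7\<close>\<close>

lemma fps_X_nth_Suc_mult [simp]:
  fixes f :: "complex fps"
  shows "(fps_X * f) $ Suc n = f $ n" "(fps_X\<^sup>2 * f) $ Suc (Suc n) = f $ n"
    "(fps_X\<^sup>2 * f) $ Suc 0 = 0" "(fps_X\<^sup>2 * f) $ 0 = 0"
  by (simp_all add: fps_X_power_mult_nth)

text \<open>The recurrence step in bare variables: \<open>y\<close> stands for \<open>p ^ m\<close>,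
  \<open>K\<close> for \<open>p ^ (m choose 2)\<close> and \<open>Q\<close> for
  \<open>qpoch (- p) p m\<close>. By \<open>\<beta> * p = \<alpha>^2\<close>, the coefficient of
  \<open>g0\<close> times \<open>p\<close> is \<open>\<alpha>^2 * (1 + p * y)\<close>, which
  contains the next factor of the symbol; this is why dividing by the symbol simplifies the
  recurrence.\<close>

lemma quad_sum_H6_H7_step:
  fixes p :: complex
  assumes "Q \<noteq> 0" "1 + p * y \<noteq> 0" "1 + p * (p * y) \<noteq> 0" "\<beta> * p = \<alpha>\<^sup>2"
    and "g2 - \<beta> * g0 = p * (p * y) * g2 + \<alpha> * (p * y * g1) + \<alpha>\<^sup>2 * (y * g0)"
  shows "K * y * (p * y) * g2 / (Q * (1 + p * y) * (1 + p * (p * y))) =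
    (p * (p * y))\<^sup>2 * (K * y * (p * y) * g2 / (Q * (1 + p * y) * (1 + p * (p * y)))) +
    \<alpha> * ((p * y)\<^sup>2 * (K * y * g1 / (Q * (1 + p * y)))) + \<alpha>\<^sup>2 * (y\<^sup>2 * (K * g0 / Q))"
proof -
  define D where "D = Q * (1 + p * y) * (1 + p * (p * y))"
  have *: "K * y * g1 / (Q * (1 + p * y)) = K * y * g1 * (1 + p * (p * y)) / D"
    "K * g0 / Q = K * g0 * (1 + p * y) * (1 + p * (p * y)) / D"
    using assms by (simp_all add: D_def)
  have **: "K * y * (p * y) * g2 = (p * (p * y))\<^sup>2 * (K * y * (p * y) * g2) +
    \<alpha> * ((p * y)\<^sup>2 * (K * y * g1 * (1 + p * (p * y)))) +
    \<alpha>\<^sup>2 * (y\<^sup>2 * (K * g0 * (1 + p * y) * (1 + p * (p * y))))"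
    using assms(4,5) by algebra
  show ?thesis
    unfolding * D_def[symmetric] times_divide_eq_right add_divide_distrib[symmetric]
    by (rule arg_cong[OF **, of "\<lambda>x. x / D"])
qed

text \<open>The conditions on \<open>c\<close> say that \<open>c\<close> and \<open>c q\<close> are
  \<open>\<alpha>\<close> and \<open>p\<close> in some order, so \<open>1 / (c z; q)_inf\<close> is
  \<open>1 / (\<alpha> z; p)_inf\<close> times \<open>1 / (p z; p)_inf\<close>. The second part is
  split off; the rest satisfies \<open>(1 - \<beta> z^2) g(z) = (1 + \<alpha> z + \<alpha>^2 z^2)
  g(p z)\<close>.\<close>

lemma quad_sum_H6_H7:
  assumes q: "norm q < 1" and p: "p = q\<^sup>2" and \<alpha>: "norm \<alpha> < 1"
    and \<beta>: "\<beta> * p = \<alpha>\<^sup>2" and c: "c + c * q = \<alpha> + p" "c * (c * q) = \<alpha> * p"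
  shows "quad_sum p (fps_euler1 (Suc 0) q c * fps_euler1 2 (p ^ 2) \<beta> * fps_euler2 3 (p ^ 3) (\<alpha> ^ 3)) =
    qpoch_inf (- p) p * qpoch_inf (\<alpha> ^ 3) (p ^ 6) / qpoch_inf \<alpha> (p\<^sup>2)"
proof -
  define e1 where "e1 = fps_euler1 (Suc 0) q c"
  define e2 where "e2 = fps_euler1 2 (p ^ 2) \<beta>"
  define e3 where "e3 = fps_euler2 3 (p ^ 3) (\<alpha> ^ 3)"
  define e4 where "e4 = fps_euler2 (Suc 0) p p"
  define g where "g = e1 * e2 * e3 * e4"
  have np: "norm p < 1" using norm_power_less_1[OF q, of 2] by (simp add: p)
  have npn: "norm (p ^ n) < 1" if "n > 0" for n using norm_power_less_1[OF np that] .
  have geo: "geo_bounded g" unfolding g_def e1_def e2_def e3_def e4_def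
    by (intro geo_bounded_mult geo_bounded_euler1 geo_bounded_euler2 q np npn) auto

  have c': "fps_const c + fps_const c * fps_const q = fps_const \<alpha> + fps_const p"
    "fps_const c * (fps_const c * fps_const q) = fps_const \<alpha> * fps_const p"
    using c by simp_all
  have F1: "fps_scale q e1 = (1 - fps_const c * fps_X) * e1"
    using fps_euler1_eq[OF q, of "Suc 0" q c] by (simp add: e1_def)
  have "fps_scale p e1 = fps_scale q (fps_scale q e1)" by (simp add: p power2_eq_square)
  also note F1
  also have "fps_scale q ((1 - fps_const c * fps_X) * e1) =
      (1 - fps_const c * (fps_const q * fps_X)) * ((1 - fps_const c * fps_X) * e1)"
    unfolding fps_scale_mult F1 by simp
  also have "\<dots> = (1 - fps_const \<alpha> * fps_X) * (1 - fps_const p * fps_X) * e1"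
    using c' by algebra
  finally have E1: "fps_scale p e1 = (1 - fps_const \<alpha> * fps_X) * (1 - fps_const p * fps_X) * e1" .
  have E2: "fps_scale p e2 = (1 - fps_const \<beta> * fps_X\<^sup>2) * e2"
    using fps_euler1_eq[of "p ^ 2" 2 p \<beta>] npn by (simp add: e2_def)
  have E3: "e3 = (1 - fps_const \<alpha> ^ 3 * fps_X ^ 3) * fps_scale p e3"
    using fps_euler2_eq[of "p ^ 3" 3 p "\<alpha> ^ 3"] npn by (simp add: e3_def)
  have E4: "e4 = (1 - fps_const p * fps_X) * fps_scale p e4"
    using fps_euler2_eq[OF np, of "Suc 0" p p] by (simp add: e4_def)
  have "(1 - fps_const \<beta> * fps_X\<^sup>2) * g =
      (1 - fps_const \<beta> * fps_X\<^sup>2) * e1 * e2 * ((1 - fps_const \<alpha> ^ 3 * fps_X ^ 3) * fps_scale p e3) *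
      ((1 - fps_const p * fps_X) * fps_scale p e4)"
    unfolding g_def E3[symmetric] E4[symmetric] by (simp only: mult_ac)
  also have "\<dots> = (1 + fps_const \<alpha> * fps_X + fps_const \<alpha> ^ 2 * fps_X\<^sup>2) * fps_scale p g"
    unfolding g_def fps_scale_mult E1 E2 by algebra
  finally have "g - fps_const \<beta> * (fps_X\<^sup>2 * g) =
      fps_scale p g + fps_const \<alpha> * (fps_X * fps_scale p g) + fps_const (\<alpha>\<^sup>2) * (fps_X\<^sup>2 * fps_scale p g)"
    by (simp add: algebra_simps)
  note g_eq = arg_cong[OF this, of "\<lambda>f. f $ _"]
  have g0: "g $ 0 = 1" by (simp add: g_def e1_def e2_def e3_def e4_def)

  \<comment> \<open>The infinite product \<open>qpoch_inf (- (p * p ^ n)) p\<close> is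
    \<open>qpoch_inf (- p) p / qpoch (- p) p n\<close>, so up to a constant these are the summands
    after the split.\<close>
  define r where "r = Abs_fps (\<lambda>n. p ^ (n choose 2) * g $ n / qpoch (- p) p n)"
  have nz: "qpoch (- p) p n \<noteq> 0" for n using np by (intro qpoch_nonzero) auto
  have nz1: "1 + p * p ^ n \<noteq> 0" for n
    using nz[of "Suc n"] by (simp add: qpoch_Suc)
  have r_eq: "1 * r = (1 + fps_const \<alpha> * fps_X + fps_const (\<alpha>\<^sup>2) * fps_X\<^sup>2) * fps_scale (p\<^sup>2) r"
  proof -
    have "r = fps_scale (p\<^sup>2) r + fps_const \<alpha> * (fps_X * fps_scale (p\<^sup>2) r) +
        fps_const (\<alpha>\<^sup>2) * (fps_X\<^sup>2 * fps_scale (p\<^sup>2) r)"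
    proof (rule fps_ext)
      fix n
      consider "n = 0" | "n = 1" | m where "n = Suc (Suc m)" by (metis One_nat_def not0_implies_Suc)
      then show "r $ n = (fps_scale (p\<^sup>2) r + fps_const \<alpha> * (fps_X * fps_scale (p\<^sup>2) r) +
        fps_const (\<alpha>\<^sup>2) * (fps_X\<^sup>2 * fps_scale (p\<^sup>2) r)) $ n"
      proof cases
        case 2
        have "(1 - p) * g $ 1 = \<alpha>"
          using g_eq[of "Suc 0"] by (simp add: g0 algebra_simps)
        moreover have "1 + p \<noteq> 0" using nz1[of 0] by simp
        ultimately show ?thesis
          by (simp add: 2 r_def g0 qpoch_def numeral_2_eq_2 field_simps) algebra
      next
        case (3 m)
        have "g $ Suc (Suc m) - \<beta> * g $ m = p * (p * p ^ m) * g $ Suc (Suc m) +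
            \<alpha> * (p * p ^ m * g $ Suc m) + \<alpha>\<^sup>2 * (p ^ m * g $ m)"
          using g_eq[of "Suc (Suc m)"] by simp
        moreover have "1 + p * (p * p ^ m) \<noteq> 0" using nz1[of "Suc m"] by simp
        moreover note quad_sum_H6_H7_step[OF nz[of m] nz1[of m] _ \<beta>, of "g $ Suc (Suc m)"
            "g $ m" "g $ Suc m" "p ^ (m choose 2)"]
        ultimately have step: "p ^ (m choose 2) * p ^ m * (p * p ^ m) * g $ Suc (Suc m) /
            (qpoch (- p) p m * (1 + p * p ^ m) * (1 + p * (p * p ^ m))) =
          (p * (p * p ^ m))\<^sup>2 * (p ^ (m choose 2) * p ^ m * (p * p ^ m) * g $ Suc (Suc m) /
            (qpoch (- p) p m * (1 + p * p ^ m) * (1 + p * (p * p ^ m)))) +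
          \<alpha> * ((p * p ^ m)\<^sup>2 * (p ^ (m choose 2) * p ^ m * g $ Suc m / (qpoch (- p) p m * (1 + p * p ^ m)))) +
          \<alpha>\<^sup>2 * ((p ^ m)\<^sup>2 * (p ^ (m choose 2) * g $ m / qpoch (- p) p m))"
          by blast
        have r0: "r $ m = p ^ (m choose 2) * g $ m / qpoch (- p) p m"
          by (simp add: r_def)
        have r1: "r $ Suc m = p ^ (m choose 2) * p ^ m * g $ Suc m / (qpoch (- p) p m * (1 + p * p ^ m))"
          by (simp add: r_def qpoch_Suc choose_two_Suc power_add)
        have r2: "r $ Suc (Suc m) = p ^ (m choose 2) * p ^ m * (p * p ^ m) * g $ Suc (Suc m) /
            (qpoch (- p) p m * (1 + p * p ^ m) * (1 + p * (p * p ^ m)))"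
          by (simp add: r_def qpoch_Suc choose_two_Suc power_add mult.assoc)
        have sq: "(p\<^sup>2) ^ k = (p ^ k)\<^sup>2" for k
          by (simp add: power_mult[symmetric] mult.commute)
        show ?thesis
          using step
          by (simp only: 3 power_mult_distrib fps_add_nth fps_mult_left_const_nth fps_X_nth_Suc_mult fps_scale_nth sq r0[symmetric]
            r1[symmetric] r2[symmetric] power_Suc simp_thms)
      qed (simp add: r_def)
    qed
    then show ?thesis by (simp add: algebra_simps)
  qed
  \<comment> \<open>As \<open>1 + x + x^2 = (1 - x^3) / (1 - x)\<close> with
    \<open>x = \<alpha> z\<close>, iterating the equation of \<open>r\<close> in steps of
    \<open>p^2\<close> produces exactly these two products.\<close>
  define s where "s = fps_euler1 (Suc 0) (p\<^sup>2) \<alpha> * fps_euler2 3 (p ^ 6) (\<alpha> ^ 3)"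
  have s_eq: "1 * s = (1 + fps_const \<alpha> * fps_X + fps_const (\<alpha>\<^sup>2) * fps_X\<^sup>2) * fps_scale (p\<^sup>2) s"
  proof -
    define f1 where "f1 = fps_euler1 (Suc 0) (p\<^sup>2) \<alpha>"
    define f2 where "f2 = fps_euler2 3 (p ^ 6) (\<alpha> ^ 3)"
    have F1: "fps_scale (p\<^sup>2) f1 = (1 - fps_const \<alpha> * fps_X) * f1"
      using fps_euler1_eq[of "p\<^sup>2" "Suc 0" "p\<^sup>2" \<alpha>] npn by (simp add: f1_def)
    have F2: "f2 = (1 - fps_const \<alpha> ^ 3 * fps_X ^ 3) * fps_scale (p\<^sup>2) f2"
      using fps_euler2_eq[of "p ^ 6" 3 "p\<^sup>2" "\<alpha> ^ 3"] npn by (simp add: f2_def flip: power_mult)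
    have "(1 + fps_const \<alpha> * fps_X + fps_const \<alpha> ^ 2 * fps_X\<^sup>2) * fps_scale (p\<^sup>2) (f1 * f2) =
        f1 * ((1 - fps_const \<alpha> ^ 3 * fps_X ^ 3) * fps_scale (p\<^sup>2) f2)"
      unfolding fps_scale_mult F1 by algebra
    then show ?thesis unfolding F2[symmetric] by (simp add: s_def f1_def f2_def)
  qed
  have "r = s"
  proof (rule fps_scale_eq_unique[OF r_eq s_eq])
    show "(p\<^sup>2) ^ n \<noteq> 1" if "n > 0" for n
      using power_neq_1[OF npn, of 2 n] that by simp
  qed (simp_all add: r_def s_def g0 numeral_2_eq_2)
  have "(\<lambda>n. s $ n) sums (1 / qpoch_inf \<alpha> (p\<^sup>2) * qpoch_inf (\<alpha> ^ 3) (p ^ 6))"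
    unfolding s_def
    by (intro sums_fps_mult sums_fps_euler1 sums_fps_euler2 npn \<alpha>) auto
  from sums_mult[OF this, of "qpoch_inf (- p) p"]
  have "(\<lambda>n. qpoch_inf (- p) p * s $ n) sums
      (qpoch_inf (- p) p * qpoch_inf (\<alpha> ^ 3) (p ^ 6) / qpoch_inf \<alpha> (p\<^sup>2))" by simp
  moreover have "qpoch_inf (- p) p * s $ n = p ^ (n choose 2) * g $ n * qpoch_inf (- (p * p ^ n)) p" for n
    using qpoch_inf_split[OF np, of "- p" n] nz[of n] by (simp add: \<open>r = s\<close>[symmetric] r_def)
  moreover have "g * fps_euler1 (Suc 0) p p = e1 * e2 * e3"
    using fps_euler_inverse[OF np, of p] by (simp add: g_def e4_def mult.assoc mult.commute)
  ultimately show ?thesis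
    using quad_sum_mult_euler1[OF np geo, of p] sums_unique2
    by (metis (no_types, lifting) e1_def e2_def e3_def sums_cong)
qed


lemma H6_eq:
  assumes q: "norm q < 1"
  shows "H 6 1 q = qpoch_inf (q ^ 3) (q ^ 12) / qpochs_inf [q, q ^ 2] (q ^ 4)"
proof -
  have q2: "norm (q\<^sup>2) < 1" using norm_power_less_1[OF q, of 2] by simp
  have pw: "(q\<^sup>2)\<^sup>2 = q ^ 4" "(q\<^sup>2) ^ 3 = q ^ 6" "(q\<^sup>2) ^ 6 = q ^ 12" by (simp_all flip: power_mult)
  \<comment> \<open>Here \<open>\<alpha> = c = q\<close> and \<open>\<beta> = 1\<close>; for
    \<open>H7\<close> the values are \<open>\<alpha> = q^3\<close>, \<open>c = q^2\<close> and
    \<open>\<beta> = q^4\<close>.\<close>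
  have "quad_sum (q\<^sup>2) (fps_euler1 (Suc 0) q q * fps_euler1 2 ((q\<^sup>2)\<^sup>2) 1 * fps_euler2 3 ((q\<^sup>2) ^ 3) (q ^ 3)) =
      qpoch_inf (- (q\<^sup>2)) (q\<^sup>2) * qpoch_inf (q ^ 3) ((q\<^sup>2) ^ 6) / qpoch_inf q ((q\<^sup>2)\<^sup>2)"
    by (rule quad_sum_H6_H7[OF q refl q]) (simp_all add: power2_eq_square)
  moreover have "H 6 1 q = quad_sum (q\<^sup>2) (fps_euler1 (Suc 0) q q * fps_euler1 2 (q ^ 4) 1 * fps_euler2 3 (q ^ 6) (q ^ 3))"
    using H_first[OF q, of 6 1 0 0] by (simp add: A_def)
  ultimately have "H 6 1 q = qpoch_inf (- (q\<^sup>2)) (q\<^sup>2) * qpoch_inf (q ^ 3) (q ^ 12) / qpoch_inf q (q ^ 4)"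
    unfolding pw by simp
  also have "qpoch_inf (- (q\<^sup>2)) (q\<^sup>2) = 1 / qpoch_inf (q\<^sup>2) (q ^ 4)"
    using qpoch_inf_minus_self[OF q2] by (auto simp: eq_divide_eq simp flip: power_mult)
  finally show ?thesis by (simp add: qpochs_inf_def mult_ac)
qed

lemma H7_eq:
  assumes q: "norm q < 1"
  shows "H 7 1 q = qpoch_inf (q ^ 9) (q ^ 12) / qpochs_inf [q ^ 2, q ^ 3] (q ^ 4)"
proof -
  have q2: "norm (q\<^sup>2) < 1" using norm_power_less_1[OF q, of 2] by simp
  have q3: "norm (q ^ 3) < 1" using norm_power_less_1[OF q, of 3] by simp
  have pw: "(q\<^sup>2)\<^sup>2 = q ^ 4" "(q\<^sup>2) ^ 3 = q ^ 6" "(q\<^sup>2) ^ 6 = q ^ 12" "(q ^ 3) ^ 3 = q ^ 9"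
    by (simp_all flip: power_mult)
  have "quad_sum (q\<^sup>2) (fps_euler1 (Suc 0) q (q\<^sup>2) * fps_euler1 2 ((q\<^sup>2)\<^sup>2) (q ^ 4) *
      fps_euler2 3 ((q\<^sup>2) ^ 3) ((q ^ 3) ^ 3)) =
      qpoch_inf (- (q\<^sup>2)) (q\<^sup>2) * qpoch_inf ((q ^ 3) ^ 3) ((q\<^sup>2) ^ 6) / qpoch_inf (q ^ 3) ((q\<^sup>2)\<^sup>2)"
    by (rule quad_sum_H6_H7[OF q refl q3]) (simp_all add: eval_nat_numeral mult_ac)
  moreover have "H 7 1 q = quad_sum (q\<^sup>2) (fps_euler1 (Suc 0) q (q\<^sup>2) * fps_euler1 2 (q ^ 4) (q ^ 4) *
      fps_euler2 3 (q ^ 6) (q ^ 9))"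
    using H_first[OF q, of 7 2 4 6] by (simp add: A_def)
  ultimately have "H 7 1 q = qpoch_inf (- (q\<^sup>2)) (q\<^sup>2) * qpoch_inf (q ^ 9) (q ^ 12) / qpoch_inf (q ^ 3) (q ^ 4)"
    unfolding pw by simp
  also have "qpoch_inf (- (q\<^sup>2)) (q\<^sup>2) = 1 / qpoch_inf (q\<^sup>2) (q ^ 4)"
    using qpoch_inf_minus_self[OF q2] by (auto simp: eq_divide_eq simp flip: power_mult)
  finally show ?thesis by (simp add: qpochs_inf_def mult_ac)
qed

lemma choose_two_small [simp]: "0 choose 2 = 0" "Suc 0 choose 2 = 0"
  by (simp_all add: numeral_2_eq_2)

section \<open>The q-analogue of Gauss's second theorem\<close>

text \<open>Uses \<open>1 + t \<le> exp t\<close> factor by factor and then the geometric series.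
  The bound is uniform in \<open>n\<close> and in \<open>x\<close> on a disc, as needed for an
  interchange of limit and sum.\<close>

lemma norm_qpoch_le:
  assumes q: "norm q < 1" and x: "norm x \<le> R"
  shows "norm (qpoch x q n) \<le> exp (R / (1 - norm q))"
proof -
  have R: "R \<ge> 0" using x norm_ge_zero[of x] by linarith
  have "norm (qpoch x q n) = (\<Prod>i<n. norm (1 - x * q ^ i))"
    by (simp add: qpoch_def prod_norm)
  also have "\<dots> \<le> (\<Prod>i<n. exp (R * norm q ^ i))"
  proof (rule prod_mono)
    fix i
    have "norm (1 - x * q ^ i) \<le> 1 + norm x * norm q ^ i"
      using norm_triangle_ineq4[of 1 "x * q ^ i"] by (simp add: norm_mult norm_power)
    also have "\<dots> \<le> 1 + R * norm q ^ i" using x by (simp add: mult_right_mono)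
    also have "\<dots> \<le> exp (R * norm q ^ i)" by (rule exp_ge_add_one_self)
    finally show "0 \<le> norm (1 - x * q ^ i) \<and> norm (1 - x * q ^ i) \<le> exp (R * norm q ^ i)" by simp
  qed
  also have "\<dots> = exp (R * (\<Sum>i<n. norm q ^ i))"
    by (simp add: exp_sum sum_distrib_left)
  also have "\<dots> \<le> exp (R / (1 - norm q))"
  proof -
    have "(\<Sum>i<n. norm q ^ i) \<le> (\<Sum>i. norm q ^ i)"
      using q by (intro sum_le_suminf summable_geometric) auto
    also have "\<dots> = 1 / (1 - norm q)" using q by (intro suminf_geometric) auto
    finally show ?thesis using mult_left_mono[OF _ R] by fastforce
  qed
  finally show ?thesis .
qed

lemma norm_qpoch_inf_le:
  assumes q: "norm q < 1" and x: "norm x \<le> R"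
  shows "norm (qpoch_inf x q) \<le> exp (R / (1 - norm q))"
  by (rule tendsto_upperbound[OF tendsto_norm[OF qpoch_tendsto[OF q]]])
     (use norm_qpoch_le[OF q x] in auto)

lemma qpoch_inf_shift_tendsto:
  assumes q: "norm q < 1"
  shows "(\<lambda>n. qpoch_inf (x * q ^ n) q) \<longlonglongrightarrow> 1"
proof -
  define a where "a = (\<lambda>n. (-1) ^ n * q ^ (n choose 2) / qpoch q q n)"
  have s: "(\<lambda>n. a n * x ^ n) sums qpoch_inf x q" for x
    using euler2[OF q, of x] by (simp add: a_def)
  have "(\<lambda>n. \<Sum>k. a k * (x * q ^ n) ^ k) \<longlonglongrightarrow> a 0"
    by (rule powser_functional_limit[OF q zero_less_one]) (use s in \<open>auto intro: sums_summable\<close>)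
  then show ?thesis using sums_unique[OF s] by (simp add: a_def numeral_2_eq_2)
qed

text \<open>The summand \<open>(a; q)_k (b; q)_k q^(k(k+1)/2) / ((q; q)_k (abq; q^2)_k)\<close> of
  the classical series, multiplied by \<open>(abq; q^2)_inf\<close>. Only a tail of that product
  remains, so no denominator depends on \<open>a\<close> or \<open>b\<close>.\<close>

definition gauss2_term :: "complex \<Rightarrow> complex \<Rightarrow> complex \<Rightarrow> nat \<Rightarrow> complex" where
  "gauss2_term q a b k = qpoch a q k * qpoch b q k * q ^ (Suc k choose 2) *
     qpoch_inf (a * b * q ^ (1 + 2 * k)) (q\<^sup>2) / qpoch q q k"

lemma gauss2_term_bound:
  assumes q: "norm q < 1"
  obtains C where "\<And>(a::complex) k. norm a \<le> R \<Longrightarrow> norm (gauss2_term q a b k) \<le> C * norm (q ^ (k choose 2) * q ^ k)"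
proof -
  obtain B where B: "B > 0" "\<And>n. norm (inverse (qpoch q q n)) \<le> B"
    using inverse_qpoch_bounded[OF q q] by blast
  have q2: "norm (q\<^sup>2) < 1" using norm_power_less_1[OF q, of 2] by simp
  define Ca where "Ca = exp (R / (1 - norm q))"
  define Cb where "Cb = exp (norm b / (1 - norm q))"
  define Cc where "Cc = exp ((R * norm b) / (1 - norm (q\<^sup>2)))"
  show ?thesis
  proof (rule that)
    fix a :: complex and k assume a: "norm a \<le> R"
    have "norm (a * b * q ^ (1 + 2 * k)) \<le> norm a * norm b * 1"
      unfolding norm_mult by (intro mult_left_mono less_imp_le[OF norm_power_less_1[OF q]]) auto
    also have "\<dots> \<le> R * norm b" using a by (simp add: mult_right_mono)
    finally have c: "norm (qpoch_inf (a * b * q ^ (1 + 2 * k)) (q\<^sup>2)) \<le> Cc"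
      unfolding Cc_def by (rule norm_qpoch_inf_le[OF q2])
    have "norm (qpoch a q k) * norm (qpoch b q k) * norm (qpoch_inf (a * b * q ^ (1 + 2 * k)) (q\<^sup>2)) *
        norm (inverse (qpoch q q k)) \<le> Ca * Cb * Cc * B"
      using norm_qpoch_le[OF q a, of k] norm_qpoch_le[OF q order_refl, of b k] c B
      by (intro mult_mono mult_nonneg_nonneg) (auto simp: Ca_def Cb_def Cc_def)
    from mult_right_mono[OF this, of "norm (q ^ (k choose 2) * q ^ k)"]
    show "norm (gauss2_term q a b k) \<le> (Ca * Cb * Cc * B) * norm (q ^ (k choose 2) * q ^ k)"
      by (simp add: gauss2_term_def choose_two_Suc power_add norm_mult norm_divide norm_inverse divide_inverse mult_ac)
  qed
qed

lemma summable_gauss2: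
  assumes q: "norm q < 1"
  shows "summable (gauss2_term q a b)"
proof -
  obtain C where C: "\<And>a' k. norm a' \<le> norm a \<Longrightarrow> norm (gauss2_term q a' b k) \<le> C * norm (q ^ (k choose 2) * q ^ k)"
    using gauss2_term_bound[OF q] by blast
  show ?thesis
    by (rule summable_comparison_test'[OF summable_mult[OF summable_power_choose_two[OF q, of q], of C]])
       (use C in auto)
qed

text \<open>A first-order relation in \<open>a\<close>, obtained by telescoping in
  \<open>k\<close>.\<close>

lemma gauss2_shift:
  assumes q: "norm q < 1"
  shows "suminf (gauss2_term q a b) = (1 - a * q) * suminf (gauss2_term q (a * q\<^sup>2) b)"
proof -
  have q2: "norm (q\<^sup>2) < 1" using norm_power_less_1[OF q, of 2] by simp
  \<comment> \<open>For \<open>k > 0\<close>, \<open>G k\<close> is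
    \<open>gauss2_term q a b k\<close> times \<open>a * (1 - q ^ k) / (1 - a)\<close>, with
    \<open>1 - a\<close> cancelled against \<open>qpoch a q k\<close> and \<open>1 - q ^ k\<close>
    against \<open>qpoch q q k\<close>. In this form \<open>a = 1\<close> is no exception, and the
    value at \<open>k = 0\<close> is 0.\<close>
  define G where "G = (\<lambda>n. case n of 0 \<Rightarrow> 0 | Suc k \<Rightarrow> a * qpoch (a * q) q k * qpoch b q (Suc k) *
    q ^ (Suc k choose 2) * q ^ Suc k * qpoch_inf (a * b * q ^ (3 + 2 * k)) (q\<^sup>2) / qpoch q q k)"
  have tele: "gauss2_term q a b k - (1 - a * q) * gauss2_term q (a * q\<^sup>2) b k = G (Suc k) - G k" for k
  proof -
    define W where "W = qpoch_inf (a * b * q ^ (3 + 2 * k)) (q\<^sup>2)"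
    have p1: "q ^ (1 + 2 * k) = q * (q ^ k)\<^sup>2"
      by (simp add: power_mult[symmetric] mult.commute[of 2 k])
    have "3 + 2 * k = (1 + 2 * k) + 2" by simp
    then have p3: "q ^ (3 + 2 * k) = q ^ (1 + 2 * k) * q\<^sup>2" by (simp only: power_add)
    have W: "qpoch_inf (a * b * q ^ (1 + 2 * k)) (q\<^sup>2) = (1 - a * b * q * (q ^ k)\<^sup>2) * W"
      using qpoch_inf_Suc[OF q2, of "a * b * q ^ (1 + 2 * k)"] unfolding W_def p3 p1 by (simp only: mult.assoc)
    have "a * q\<^sup>2 * b * q ^ (1 + 2 * k) = a * b * (q ^ (1 + 2 * k) * q\<^sup>2)" by (simp only: mult_ac)
    then have W2: "qpoch_inf (a * q\<^sup>2 * b * q ^ (1 + 2 * k)) (q\<^sup>2) = W"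
      unfolding W_def p3 by (simp only:)
    show ?thesis
    proof (cases k)
      case 0
      have *: "gauss2_term q a b k = (1 - a * b * q) * W" "gauss2_term q (a * q\<^sup>2) b k = W"
        unfolding gauss2_term_def W W2 by (simp_all add: 0)
      have "G (Suc k) - G k = a * (1 - b) * q * W"
        by (simp add: 0 G_def W_def qpoch_def)
      then show ?thesis unfolding * by algebra
    next
      case (Suc j)
      define X where "X = qpoch (a * q) q j"
      define x where "x = q ^ k"
      have 1: "qpoch a q k = (1 - a) * X" by (simp add: X_def Suc qpoch_Suc_left)
      have 2: "qpoch (a * q) q k = X * (1 - a * x)" by (simp add: X_def x_def Suc qpoch_Suc mult_ac)
      have "(1 - a * q) * qpoch (a * q\<^sup>2) q k = qpoch (a * q) q (Suc k)"
        by (simp add: qpoch_Suc_left power2_eq_square mult_ac)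
      also have "\<dots> = X * (1 - a * x) * (1 - a * x * q)"
        unfolding qpoch_Suc[of _ _ k] 2 by (simp add: x_def mult_ac)
      finally have 3: "(1 - a * q) * qpoch (a * q\<^sup>2) q k = X * (1 - a * x) * (1 - a * x * q)" .
      have 4: "qpoch b q (Suc k) = qpoch b q k * (1 - b * x)" by (simp add: qpoch_Suc x_def)
      have 5: "1 / qpoch q q j = (1 - x) / qpoch q q k"
        using qpoch_tail[OF q, of j] by (simp add: Suc x_def)
      define T where "T = q ^ (Suc k choose 2)"
      have T: "q ^ (Suc j choose 2) * q ^ Suc j = T"
        by (simp add: T_def Suc choose_two_Suc power_add)
      have "G k = a * X * qpoch b q k * T * qpoch_inf (a * b * q ^ (3 + 2 * j)) (q\<^sup>2) * (1 / qpoch q q j)"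
        unfolding T[symmetric] by (simp add: G_def Suc X_def)
      also have "3 + 2 * j = 1 + 2 * k" by (simp add: Suc)
      finally have Gk: "G k = a * X * qpoch b q k * T * ((1 - a * b * q * x\<^sup>2) * W) * ((1 - x) / qpoch q q k)"
        unfolding W 5 x_def .
      have GSk: "G (Suc k) = a * (X * (1 - a * x)) * (qpoch b q k * (1 - b * x)) * T * (x * q) * W / qpoch q q k"
        unfolding 2[symmetric] 4[symmetric] by (simp add: G_def T_def W_def x_def mult_ac)
      have t1: "gauss2_term q a b k = (1 - a) * X * qpoch b q k * T * ((1 - a * b * q * x\<^sup>2) * W) / qpoch q q k"
        unfolding gauss2_term_def W 1 T_def x_def ..
      have t2: "(1 - a * q) * gauss2_term q (a * q\<^sup>2) b k =
          X * (1 - a * x) * (1 - a * x * q) * qpoch b q k * T * W / qpoch q q k"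
        unfolding 3[symmetric] gauss2_term_def W2 T_def by simp
      show ?thesis
      proof -
        define c where "c = X * qpoch b q k * T * W / qpoch q q k"
        have "gauss2_term q a b k = c * ((1 - a) * (1 - a * b * q * x\<^sup>2))"
          "(1 - a * q) * gauss2_term q (a * q\<^sup>2) b k = c * ((1 - a * x) * (1 - a * x * q))"
          "G k = c * (a * (1 - a * b * q * x\<^sup>2) * (1 - x))"
          "G (Suc k) = c * (a * (1 - a * x) * (1 - b * x) * x * q)"
          unfolding t1 t2 Gk GSk c_def by (simp_all only: times_divide_eq_left times_divide_eq_right mult_ac)
        moreover have "c * ((1 - a) * (1 - a * b * q * x\<^sup>2)) - c * ((1 - a * x) * (1 - a * x * q)) =
          c * (a * (1 - a * x) * (1 - b * x) * x * q) - c * (a * (1 - a * b * q * x\<^sup>2) * (1 - x))"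
          by algebra
        ultimately show ?thesis by simp
      qed
    qed
  qed
  have "G \<longlonglongrightarrow> 0"
  proof (rule LIMSEQ_imp_Suc)
    have "(\<lambda>k. a * qpoch (a * q) q k * qpoch b q (Suc k) * (q ^ (k choose 2) * q ^ k) * q ^ Suc k *
        qpoch_inf ((a * b * q ^ 3) * (q\<^sup>2) ^ k) (q\<^sup>2) * inverse (qpoch q q k)) \<longlonglongrightarrow>
        a * qpoch_inf (a * q) q * qpoch_inf b q * 0 * 0 * 1 * inverse (qpoch_inf q q)"
      by (intro tendsto_mult tendsto_const qpoch_tendsto q qpoch_inf_shift_tendsto q2
          tendsto_inverse qpoch_inf_nonzero LIMSEQ_Suc[OF LIMSEQ_power_zero[OF q]] LIMSEQ_Suc[OF qpoch_tendsto[OF q]]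
          summable_LIMSEQ_zero[OF summable_norm_cancel[OF summable_power_choose_two]])
    moreover have "G (Suc k) = a * qpoch (a * q) q k * qpoch b q (Suc k) * (q ^ (k choose 2) * q ^ k) * q ^ Suc k *
        qpoch_inf ((a * b * q ^ 3) * (q\<^sup>2) ^ k) (q\<^sup>2) * inverse (qpoch q q k)" for k
    proof -
      have "q ^ (3 + 2 * k) = q ^ 3 * (q\<^sup>2) ^ k" by (simp only: power_add power_mult)
      then show ?thesis
        unfolding G_def nat.case choose_two_Suc by (simp only: power_add divide_inverse mult_ac)
    qed
    ultimately show "(\<lambda>k. G (Suc k)) \<longlonglongrightarrow> 0"
      by simp
  qed
  from telescope_sums[OF this] have "(\<lambda>k. G (Suc k) - G k) sums 0" by (simp add: G_def)
  moreover have "(\<lambda>k. gauss2_term q a b k - (1 - a * q) * gauss2_term q (a * q\<^sup>2) b k) sums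
      (suminf (gauss2_term q a b) - (1 - a * q) * suminf (gauss2_term q (a * q\<^sup>2) b))"
    by (intro sums_diff sums_mult summable_sums summable_gauss2 q)
  ultimately show ?thesis unfolding tele using sums_unique2 by fastforce
qed

text \<open>Iterating the shift replaces \<open>a\<close> by \<open>a * q ^ (2 * n)\<close>, which
  tends to 0. The bound on the terms is uniform in \<open>a\<close>, so Tannery's theorem moves the
  limit inside the series.\<close>

lemma gauss2_limit:
  assumes q: "norm q < 1"
  shows "suminf (gauss2_term q a b) = qpoch_inf (a * q) (q\<^sup>2) * suminf (gauss2_term q 0 b)"
proof -
  have q2: "norm (q\<^sup>2) < 1" using norm_power_less_1[OF q, of 2] by simp
  have it: "suminf (gauss2_term q a b) = qpoch (a * q) (q\<^sup>2) n * suminf (gauss2_term q (a * (q\<^sup>2) ^ n) b)" for n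
  proof (induction n)
    case (Suc n)
    then show ?case using gauss2_shift[OF q, of "a * (q\<^sup>2) ^ n" b] by (simp add: qpoch_Suc mult_ac)
  qed simp
  obtain C where C: "\<And>a' k. norm a' \<le> norm a \<Longrightarrow> norm (gauss2_term q a' b k) \<le> C * norm (q ^ (k choose 2) * q ^ k)"
    using gauss2_term_bound[OF q] by blast
  have "(\<lambda>n. suminf (\<lambda>k. gauss2_term q (a * (q\<^sup>2) ^ n) b k)) \<longlonglongrightarrow> suminf (\<lambda>k. gauss2_term q 0 b k)"
  proof (rule tannerys_theorem[THEN conjunct2, THEN conjunct2])
    show "(\<lambda>n. gauss2_term q (a * (q\<^sup>2) ^ n) b k) \<longlonglongrightarrow> gauss2_term q 0 b k" for k
    proof -
      have "(\<lambda>n. (\<Prod>i<k. 1 - a * (q\<^sup>2) ^ n * q ^ i) * qpoch b q k * q ^ (Suc k choose 2) *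
          qpoch_inf ((a * b * q ^ (1 + 2 * k)) * (q\<^sup>2) ^ n) (q\<^sup>2) / qpoch q q k) \<longlonglongrightarrow>
          (\<Prod>i<k. 1 - a * 0 * q ^ i) * qpoch b q k * q ^ (Suc k choose 2) * 1 / qpoch q q k"
        by (intro tendsto_intros LIMSEQ_power_zero qpoch_inf_shift_tendsto q2 qpoch_nonzero q)
      then show ?thesis by (simp add: gauss2_term_def qpoch_def[of _ _ k] mult_ac)
    qed
    show "eventually (\<lambda>(k, n). norm (gauss2_term q (a * (q\<^sup>2) ^ n) b k) \<le>
        C * norm (q ^ (k choose 2) * q ^ k)) (at_top \<times>\<^sub>F sequentially)"
    proof (rule always_eventually, clarify)
      fix k n
      have "norm a * norm ((q\<^sup>2) ^ n) \<le> norm a * 1"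
        using q2 by (intro mult_left_mono) (auto simp: norm_power power_le_one)
      then show "norm (gauss2_term q (a * (q\<^sup>2) ^ n) b k) \<le> C * norm (q ^ (k choose 2) * q ^ k)"
        by (intro C) (simp add: norm_mult)
    qed
  qed (auto intro!: summable_mult summable_power_choose_two q)
  then have "(\<lambda>n. qpoch (a * q) (q\<^sup>2) n * suminf (gauss2_term q (a * (q\<^sup>2) ^ n) b)) \<longlonglongrightarrow>
      qpoch_inf (a * q) (q\<^sup>2) * suminf (gauss2_term q 0 b)"
    by (intro tendsto_mult qpoch_tendsto q2)
  then have "(\<lambda>n::nat. suminf (gauss2_term q a b)) \<longlonglongrightarrow> qpoch_inf (a * q) (q\<^sup>2) * suminf (gauss2_term q 0 b)"
    unfolding it[symmetric] .
  then show ?thesis using LIMSEQ_unique tendsto_const by blast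
qed

text \<open>The summand is symmetric in \<open>a\<close> and \<open>b\<close>, so the same limit
  removes \<open>b\<close> as well; with both equal to 0 the series is Euler's expansion of
  \<open>(-q; q)_inf\<close>.\<close>

lemma gauss2:
  assumes q: "norm q < 1"
  shows "gauss2_term q a b sums (qpoch_inf (a * q) (q\<^sup>2) * qpoch_inf (b * q) (q\<^sup>2) * qpoch_inf (- q) q)"
proof -
  have sym: "gauss2_term q a b = gauss2_term q b a" for a b
    by (simp add: gauss2_term_def fun_eq_iff mult_ac)
  have e: "(-1) ^ k * y * (- q) ^ k = y * q ^ k" for k y
  proof -
    have "(-1) ^ k * (- q) ^ k = q ^ k" unfolding power_mult_distrib[symmetric] by simp
    then show ?thesis by (metis mult.assoc mult.commute)
  qed
  have "(\<lambda>k. (-1) ^ k * q ^ (k choose 2) * (- q) ^ k / qpoch q q k) = gauss2_term q 0 0"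
    unfolding e by (simp add: gauss2_term_def fun_eq_iff choose_two_Suc power_add)
  then have "suminf (gauss2_term q 0 0) = qpoch_inf (- q) q"
    using sums_unique[OF euler2[OF q, of "- q"]] by simp
  then have "suminf (gauss2_term q a b) = qpoch_inf (a * q) (q\<^sup>2) * (qpoch_inf (b * q) (q\<^sup>2) * qpoch_inf (- q) q)"
    using gauss2_limit[OF q, of a b] gauss2_limit[OF q, of b 0] sym[of 0 b] by simp
  then show ?thesis using summable_sums[OF summable_gauss2[OF q, of a b]] by (simp add: mult.assoc)
qed

text \<open>The recurrence determines \<open>h\<close>, its leading coefficient being nonzero, and
  the coefficients of \<open>u(z) / (z; p)_inf\<close> with a hypergeometric \<open>u\<close> solve
  it. So \<open>d ^ m * h m\<close> are the coefficients of \<open>u(d z) / (d z; p)_inf\<close>,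
  from which the second factor is split off.\<close>

lemma gauss2_recurrence_sums:
  fixes a b d p :: complex and h :: "nat \<Rightarrow> complex"
  assumes p: "norm p < 1" "p \<noteq> 0" and d: "norm d < 1" "d \<noteq> 0" and ab: "a * b * p = d\<^sup>2"
    and h0: "h 0 = 1"
    and h1: "d * (1 - p) * (1 - d) * h (Suc 0) = (d + p - (a + b) * p) * h 0"
    and h2: "\<And>m. d * (1 - p * (p * p ^ m)) * (1 - d * (p * p ^ m)) * h (Suc (Suc m)) =
      (d + p - (a + b) * (p * (p * p ^ m))) * h (Suc m) - p * h m"
  shows "(\<lambda>m. p ^ (m choose 2) * (d ^ m * h m)) sums
    (qpoch_inf (a * p) (p\<^sup>2) * qpoch_inf (b * p) (p\<^sup>2) / (qpoch_inf p (p\<^sup>2) * qpoch_inf d p))"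
proof -
  have nz: "qpoch p p n \<noteq> 0" "qpoch d p n \<noteq> 0" "qpoch (- d) p n \<noteq> 0" for n
    using p d by (simp_all add: qpoch_nonzero)
  have p2: "norm (p\<^sup>2) < 1" using norm_power_less_1[OF p(1), of 2] by simp
  \<comment> \<open>Under the scaling by \<open>d\<close> the power \<open>(p / d) ^ k\<close>
    becomes \<open>p ^ k\<close> and completes \<open>p ^ (k choose 2)\<close> to the power in
    \<open>gauss2_term\<close>. The symbol \<open>qpoch d p k\<close> and the factor
    \<open>qpoch (- d) p k\<close> from the split combine to \<open>(d^2; p^2)_k\<close>, which is
    \<open>(a b p; p^2)_k\<close>.\<close>
  define u where "u = Abs_fps (\<lambda>k. (p / d) ^ k * qpoch a p k * qpoch b p k / (qpoch p p k * qpoch d p k))"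
  define E where "E = fps_euler1 (Suc 0) p 1"
  define B where "B = u * E"
  have u0: "u $ 0 = 1" by (simp add: u_def)
  have uSuc: "d * ((1 - p * p ^ k) * (1 - d * p ^ k)) * u $ Suc k = p * ((1 - a * p ^ k) * (1 - b * p ^ k)) * u $ k" for k
  proof -
    have "1 - p * p ^ k \<noteq> 0" "1 - d * p ^ k \<noteq> 0"
      using nz(1,2)[of "Suc k"] by (simp_all add: qpoch_Suc)
    then show ?thesis using d nz[of k] by (simp add: u_def qpoch_Suc divide_simps mult_ac)
  qed
  have aux: "d * d * (p * y * (p * y) * v' - p * (y * y * v)) =
      d * (p + d) * (p * y * v') - d * p * v' + p * p * v - p * p * (a + b) * (y * v)"
    if "d * ((1 - p * y) * (1 - d * y)) * v' = p * ((1 - a * y) * (1 - b * y)) * v" for y v v'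
    using that ab by algebra
  \<comment> \<open>The two-term recurrence of \<open>u\<close>, read as a q-difference equation of
    order two. The relation \<open>a * b * p = d^2\<close> gives the top term the factor
    \<open>1 - p z\<close>, which is absorbed by \<open>fps_scale (p * p) E\<close>; so passing from
    \<open>u\<close> to \<open>u * E\<close> keeps the coefficients polynomial.\<close>
  have op: "fps_const (d * d) * ((1 - fps_const p * fps_X) * fps_scale (p * p) u) =
      fps_const (d * (p + d)) * fps_scale p u - fps_const (d * p) * u + fps_const (p * p) * (fps_X * u) -
      fps_const (p * p * (a + b)) * (fps_X * fps_scale p u)"
  proof (rule fps_ext)
    fix n
    have e: "(1 - fps_const p * fps_X) * fps_scale (p * p) u =
        fps_scale (p * p) u - fps_const p * (fps_X * fps_scale (p * p) u)"
      by (simp add: algebra_simps)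
    show "(fps_const (d * d) * ((1 - fps_const p * fps_X) * fps_scale (p * p) u)) $ n =
      (fps_const (d * (p + d)) * fps_scale p u - fps_const (d * p) * u + fps_const (p * p) * (fps_X * u) -
      fps_const (p * p * (a + b)) * (fps_X * fps_scale p u)) $ n"
    proof (cases n)
      case 0
      then show ?thesis unfolding e by (simp add: u0 algebra_simps)
    next
      case (Suc k)
      have "d * d * (p * p ^ k * (p * p ^ k) * u $ Suc k - p * (p ^ k * p ^ k * u $ k)) =
          d * (p + d) * (p * p ^ k * u $ Suc k) - d * p * u $ Suc k + p * p * u $ k -
          p * p * (a + b) * (p ^ k * u $ k)"
        by (rule aux[OF uSuc])
      then show ?thesis unfolding e by (simp add: Suc power_mult_distrib mult_ac)
    qed
  qed
  have SE: "fps_scale p E = (1 - fps_X) * E"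
    using fps_euler1_eq[OF p(1), of "Suc 0" p 1] by (simp add: E_def)
  have SSE: "fps_scale (p * p) E = (1 - fps_const p * fps_X) * ((1 - fps_X) * E)"
    unfolding fps_scale_scale[symmetric] SE fps_scale_mult by simp
  have "fps_const (d * d) * fps_scale (p * p) B =
      (fps_const (d * (p + d)) - fps_const (p * p * (a + b)) * fps_X) * fps_scale p B +
      (fps_const (p * p) * fps_X - fps_const (d * p)) * ((1 - fps_X) * B)"
    using op unfolding B_def fps_scale_mult SE SSE by algebra
  also have "\<dots> = fps_const (d * (p + d)) * fps_scale p B - fps_const (p * p * (a + b)) * (fps_X * fps_scale p B) +
      fps_const (p * p) * (fps_X * B) - fps_const (p * p) * (fps_X\<^sup>2 * B) - fps_const (d * p) * B +
      fps_const (d * p) * (fps_X * B)" by (simp add: algebra_simps power2_eq_square)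
  finally have B_eq: "(fps_const (d * d) * fps_scale (p * p) B) $ n = (fps_const (d * (p + d)) * fps_scale p B -
      fps_const (p * p * (a + b)) * (fps_X * fps_scale p B) +
      fps_const (p * p) * (fps_X * B) - fps_const (p * p) * (fps_X\<^sup>2 * B) - fps_const (d * p) * B +
      fps_const (d * p) * (fps_X * B)) $ n" for n by simp
  have B0: "B $ 0 = 1" by (simp add: B_def u0 E_def)
  have B1: "d * (1 - p) * (1 - d) * B $ Suc 0 = (d + p - (a + b) * p) * B $ 0"
  proof -
    have "p * (d * (1 - p) * (1 - d) * B $ Suc 0) = p * ((d + p - (a + b) * p) * B $ 0)"
      using B_eq[of "Suc 0"] by simp algebra
    then show ?thesis using p(2) by simp
  qed
  have aux: "p * (d * (1 - p * (p * y)) * (1 - d * (p * y)) * v2) = p * ((d + p - (a + b) * (p * (p * y))) * v1 - p * v0)"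
    if "d * d * (p * p * (p * p * (y * y)) * v2) = d * (p + d) * (p * (p * y) * v2) - p * p * (a + b) * (p * y * v1) +
      p * p * v1 - p * p * v0 - d * p * v2 + d * p * v1" for y v0 v1 v2
    using that by algebra
  have B2: "d * (1 - p * (p * p ^ m)) * (1 - d * (p * p ^ m)) * B $ Suc (Suc m) =
      (d + p - (a + b) * (p * (p * p ^ m))) * B $ Suc m - p * B $ m" for m
  proof -
    have "d * d * (p * p * (p * p * (p ^ m * p ^ m)) * B $ Suc (Suc m)) =
        d * (p + d) * (p * (p * p ^ m) * B $ Suc (Suc m)) - p * p * (a + b) * (p * p ^ m * B $ Suc m) +
        p * p * B $ Suc m - p * p * B $ m - d * p * B $ Suc (Suc m) + d * p * B $ Suc m"
      using B_eq[of "Suc (Suc m)"] by (simp add: power_mult_distrib)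
    then have "p * (d * (1 - p * (p * p ^ m)) * (1 - d * (p * p ^ m)) * B $ Suc (Suc m)) =
        p * ((d + p - (a + b) * (p * (p * p ^ m))) * B $ Suc m - p * B $ m)" by (rule aux)
    then show ?thesis using p(2) by simp
  qed
  have n1: "1 - x * p ^ k \<noteq> 0" if "norm x < 1" for x k
    using one_minus_neq_0[OF norm_mult_power_less_1[OF that p(1), of k]] .
  have hB: "h m = B $ m \<and> h (Suc m) = B $ Suc m" for m
  proof (induction m)
    case 0
    have "d * (1 - p) * (1 - d) \<noteq> 0" using n1[OF p(1), of 0] n1[OF d(1), of 0] d(2) by simp
    moreover have "d * (1 - p) * (1 - d) * h (Suc 0) = d * (1 - p) * (1 - d) * B $ Suc 0"
      unfolding h1 B1 h0 B0 ..
    ultimately show ?case using h0 B0 by simp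
  next
    case (Suc m)
    have "d * (1 - p * (p * p ^ m)) * (1 - d * (p * p ^ m)) \<noteq> 0"
      using n1[OF p(1), of "Suc m"] n1[OF d(1), of "Suc m"] d(2) by simp
    moreover have "d * (1 - p * (p * p ^ m)) * (1 - d * (p * p ^ m)) * h (Suc (Suc m)) =
        d * (1 - p * (p * p ^ m)) * (1 - d * (p * p ^ m)) * B $ Suc (Suc m)"
      unfolding h2 B2 using Suc.IH by simp
    ultimately show ?case using Suc.IH by simp
  qed
  have geo: "geo_bounded u"
  proof -
    obtain C1 where C1: "C1 > 0" "\<And>n. norm (inverse (qpoch p p n)) \<le> C1"
      using inverse_qpoch_bounded[OF p(1) p(1)] by blast
    obtain C2 where C2: "C2 > 0" "\<And>n. norm (inverse (qpoch d p n)) \<le> C2"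
      using inverse_qpoch_bounded[OF p(1) d(1)] by blast
    define Ca where "Ca = exp (norm a / (1 - norm p))"
    define Cb where "Cb = exp (norm b / (1 - norm p))"
    have pos: "Ca > 0" "Cb > 0" by (simp_all add: Ca_def Cb_def)
    show ?thesis
    proof (rule geo_boundedI[where K = "Ca * Cb * (C1 * C2)" and M = "norm (p / d)"])
      fix n
      have "norm (qpoch a p n) * norm (qpoch b p n) * (norm (inverse (qpoch p p n)) * norm (inverse (qpoch d p n))) \<le>
          Ca * Cb * (C1 * C2)"
        using norm_qpoch_le[OF p(1) order_refl, of a n] norm_qpoch_le[OF p(1) order_refl, of b n] C1(2)[of n] C2(2)[of n]
          C1(1) C2(1) pos
        by (intro mult_mono mult_nonneg_nonneg) (auto simp: Ca_def Cb_def)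
      from mult_right_mono[OF this, of "norm (p / d) ^ n"]
      show "norm (u $ n) \<le> Ca * Cb * (C1 * C2) * norm (p / d) ^ n"
        by (simp add: u_def norm_mult norm_divide norm_power norm_inverse divide_inverse power_mult_distrib mult_ac)
    qed (use C1(1) C2(1) pos in auto)
  qed
  define K where "K = qpoch_inf (- d) p / qpoch_inf (d\<^sup>2) (p\<^sup>2)"
  have summand: "p ^ (n choose 2) * fps_scale d u $ n * qpoch_inf (- (d * p ^ n)) p = K * gauss2_term p a b n" for n
  proof -
    have "norm (d\<^sup>2) < 1" using norm_power_less_1[OF d(1), of 2] by simp
    then have W: "qpoch_inf (d\<^sup>2 * (p\<^sup>2) ^ n) (p\<^sup>2) \<noteq> 0"
      by (intro qpoch_inf_nonzero p2 norm_mult_power_less_1)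
    have 1: "qpoch_inf (- d) p = qpoch (- d) p n * qpoch_inf (- (d * p ^ n)) p"
      using qpoch_inf_split[OF p(1), of "- d" n] by simp
    have 2: "qpoch_inf (d\<^sup>2) (p\<^sup>2) = qpoch d p n * qpoch (- d) p n * qpoch_inf (d\<^sup>2 * (p\<^sup>2) ^ n) (p\<^sup>2)"
      unfolding qpoch_mult_neg by (rule qpoch_inf_split[OF p2])
    have "a * b * p ^ (1 + 2 * n) = a * b * p * (p\<^sup>2) ^ n" by (simp only: power_add power_mult power_one_right mult.assoc)
    then have 3: "a * b * p ^ (1 + 2 * n) = d\<^sup>2 * (p\<^sup>2) ^ n" by (simp only: ab)
    have 4: "fps_scale d u $ n = p ^ n * qpoch a p n * qpoch b p n / (qpoch p p n * qpoch d p n)"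
      using d(2) by (simp add: u_def power_divide)
    show ?thesis
      unfolding K_def gauss2_term_def 3 unfolding 1 2 4 choose_two_Suc power_add
      using W nz[of n] by (simp add: divide_simps)
  qed
  have "(\<lambda>n. K * gauss2_term p a b n) sums quad_sum p (fps_scale d u * fps_euler1 (Suc 0) p d)"
    using quad_sum_mult_euler1[OF p(1) geo_bounded_scale[OF geo, of d], of d] unfolding summand .
  moreover have "fps_scale d u * fps_euler1 (Suc 0) p d = fps_scale d B"
    by (simp add: B_def E_def fps_scale_euler)
  moreover have "(\<lambda>n. p ^ (n choose 2) * fps_scale d B $ n) sums quad_sum p (fps_scale d B)"
    unfolding B_def E_def by (intro quad_sum_sums geo_bounded_scale geo_bounded_mult geo geo_bounded_euler1 p) simp
  moreover have "(\<lambda>n. K * gauss2_term p a b n) sums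
      (K * (qpoch_inf (a * p) (p\<^sup>2) * qpoch_inf (b * p) (p\<^sup>2) * qpoch_inf (- p) p))"
    by (intro sums_mult gauss2 p)
  ultimately have "(\<lambda>m. p ^ (m choose 2) * (d ^ m * h m)) sums
      (K * (qpoch_inf (a * p) (p\<^sup>2) * qpoch_inf (b * p) (p\<^sup>2) * qpoch_inf (- p) p))"
    using hB sums_unique2 by fastforce
  moreover have "K = 1 / qpoch_inf d p"
    unfolding K_def qpoch_inf_mult_neg[OF p(1), symmetric]
    using qpoch_inf_nonzero[OF p(1), of "- d"] qpoch_inf_nonzero[OF p(1) d(1)] d by simp
  moreover have "qpoch_inf (- p) p = 1 / qpoch_inf p (p\<^sup>2)"
    using qpoch_inf_minus_self[OF p(1)] by (auto simp: eq_divide_eq)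
  ultimately show ?thesis by (simp add: mult_ac)
qed

section \<open>Creative telescoping for \<open>H\<^sub>1\<^sub>0\<close> and \<open>H\<^sub>1\<^sub>1\<close>\<close>

text \<open>With \<open>m = j + k\<close> the quadratic form in the exponent has no mixed term in
  \<open>m\<close> and \<open>k\<close>; this is the inner summand for fixed \<open>m\<close>. The
  last symbol stems from the split factor and has the index
  \<open>2 j + 3 k = 2 m + k\<close>.\<close>

definition ct_term :: "complex \<Rightarrow> nat \<Rightarrow> nat \<Rightarrow> nat \<Rightarrow> nat \<Rightarrow> complex" where
  "ct_term q e w m k = (if k \<le> m then q ^ (3 * (k choose 2) + w * k) /
     (qpoch (q ^ 3) (q ^ 3) k * qpoch (q\<^sup>2) (q\<^sup>2) (m - k) * qpoch (- (q ^ e)) q (2 * m + k)) else 0)"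

definition ct_sum :: "complex \<Rightarrow> nat \<Rightarrow> nat \<Rightarrow> nat \<Rightarrow> complex" where
  "ct_sum q e w m = (\<Sum>k\<le>m. ct_term q e w m k)"

lemma ct_nonzero:
  assumes q: "norm q < 1" and e: "e > 0"
  shows "qpoch (q ^ 3) (q ^ 3) k \<noteq> 0" "qpoch (q\<^sup>2) (q\<^sup>2) k \<noteq> 0" "qpoch (- (q ^ e)) q k \<noteq> 0"
  using norm_power_less_1[OF q, of 3] norm_power_less_1[OF q, of 2] norm_power_less_1[OF q e] q
  by (simp_all add: qpoch_nonzero)

text \<open>At \<open>k = Suc n\<close> both sides vanish, the right one through
  \<open>1 - q ^ 0\<close>. Sums over \<open>k \<le> Suc n\<close> can therefore be compared without
  boundary terms.\<close>

lemma ct_term_pred: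
  assumes q: "norm q < 1" "q \<noteq> 0" and e: "e > 0" and k: "k \<le> Suc n"
  shows "ct_term q e w n k = ct_term q e w (Suc n) k * ((1 - q ^ (2 * (Suc n - k))) *
    (1 + q ^ e * q ^ (2 * Suc n + k) / q) * (1 + q ^ e * q ^ (2 * Suc n + k) / q\<^sup>2))"
proof (cases "k = Suc n")
  case False
  with k have k: "k \<le> n" by simp
  define y where "y = q ^ (2 * n + k)"
  define z where "z = q ^ (2 * (n - k))"
  have e1: "q ^ (2 * (Suc n - k)) = q\<^sup>2 * z" using k by (simp add: z_def Suc_diff_le power2_eq_square)
  have e2: "q ^ (2 * Suc n + k) = q\<^sup>2 * y" by (simp add: y_def power2_eq_square)
  have e2': "q ^ e * (q\<^sup>2 * y) / q = q ^ e * (q * y)" "q ^ e * (q\<^sup>2 * y) / q\<^sup>2 = q ^ e * y"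
    using q(2) by (simp_all add: power2_eq_square)
  have e3: "qpoch (q\<^sup>2) (q\<^sup>2) (Suc n - k) = qpoch (q\<^sup>2) (q\<^sup>2) (n - k) * (1 - q\<^sup>2 * z)"
    using k by (simp add: z_def Suc_diff_le qpoch_Suc power_mult)
  have e4: "qpoch (- (q ^ e)) q (2 * Suc n + k) =
      qpoch (- (q ^ e)) q (2 * n + k) * (1 + q ^ e * y) * (1 + q ^ e * (q * y))"
    by (simp add: y_def qpoch_Suc)
  have "qpoch (q\<^sup>2) (q\<^sup>2) (Suc n - k) \<noteq> 0" "qpoch (- (q ^ e)) q (2 * Suc n + k) \<noteq> 0"
    using ct_nonzero[OF q(1) e] by blast+
  then have nz: "1 - q\<^sup>2 * z \<noteq> 0" "1 + q ^ e * y \<noteq> 0" "1 + q ^ e * (q * y) \<noteq> 0"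
    unfolding e3 e4 by auto
  show ?thesis
    using k nz ct_nonzero[OF q(1) e] unfolding ct_term_def e1 e2 e2' e3 e4 by simp
qed (simp add: ct_term_def)

lemma ct_term_Suc:
  assumes q: "norm q < 1" "q \<noteq> 0" and e: "e > 0" and k: "k \<le> m"
  shows "ct_term q e w m (Suc k) * ((1 - q ^ 3 * q ^ (3 * k)) * (1 + q ^ e * q ^ (2 * m + k))) =
    ct_term q e w m k * (q ^ w * q ^ (3 * k) * (1 - q ^ (2 * (m - k))))"
proof (cases "k = m")
  case False
  then obtain l where l: "m - k = Suc l" "m - Suc k = l" using k by (metis Suc_diff_Suc le_neq_implies_less)
  have e1: "qpoch (q\<^sup>2) (q\<^sup>2) (m - k) = qpoch (q\<^sup>2) (q\<^sup>2) l * (1 - q ^ (2 * (m - k)))"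
    unfolding l qpoch_Suc power_mult power_Suc ..
  have e2: "qpoch (q ^ 3) (q ^ 3) (Suc k) = qpoch (q ^ 3) (q ^ 3) k * (1 - q ^ 3 * q ^ (3 * k))"
    by (simp add: qpoch_Suc power_mult)
  have e3: "qpoch (- (q ^ e)) q (2 * m + Suc k) = qpoch (- (q ^ e)) q (2 * m + k) * (1 + q ^ e * q ^ (2 * m + k))"
    by (simp add: qpoch_Suc)
  have "3 * (Suc k choose 2) + w * Suc k = 3 * (k choose 2) + w * k + w + 3 * k"
    by (simp add: choose_two_Suc)
  then have e4: "q ^ (3 * (Suc k choose 2) + w * Suc k) = q ^ (3 * (k choose 2) + w * k) * q ^ w * q ^ (3 * k)"
    by (simp only: power_add)
  have "qpoch (q\<^sup>2) (q\<^sup>2) (m - k) \<noteq> 0" "qpoch (q ^ 3) (q ^ 3) (Suc k) \<noteq> 0" "qpoch (- (q ^ e)) q (2 * m + Suc k) \<noteq> 0"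
    using ct_nonzero[OF q(1) e] by blast+
  then have nz: "1 - q ^ (2 * (m - k)) \<noteq> 0" "1 - q ^ 3 * q ^ (3 * k) \<noteq> 0" "1 + q ^ e * q ^ (2 * m + k) \<noteq> 0"
    unfolding e1 e2 e3 by auto
  have "Suc k \<le> m" using False k by simp
  then show ?thesis
    using k nz ct_nonzero[OF q(1) e] unfolding ct_term_def e1 e2 e3 e4 l(2) by (simp add: divide_simps)
qed (simp add: ct_term_def)

text \<open>Zeilberger's method with abstract data. In terms of \<open>a = q ^ (2 * (M - k))\<close>
  and \<open>z = q ^ (3 * k)\<close> the quotients of neighbouring summands are rational, and
  \<open>a ^ 3 * z^2 = q ^ (6 * M)\<close> is free of \<open>k\<close>, so \<open>P0\<close> and
  \<open>P1\<close> may depend on it. The assumption \<open>cert\<close> is the telescoping identity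
  divided by the summand.\<close>

lemma ct_sum_recurrence:
  fixes P0 P1 :: "complex \<Rightarrow> complex" and s :: "complex \<Rightarrow> complex \<Rightarrow> complex"
  assumes q: "norm q < 1" "q \<noteq> 0" and e: "e > 0"
    and cert: "\<And>a z. P0 (a ^ 3 * z\<^sup>2) -
      P1 (a ^ 3 * z\<^sup>2) * ((1 - a) * (1 + q ^ e * (a * z) / q) * (1 + q ^ e * (a * z) / q\<^sup>2)) +
      P2 * ((1 - a) * (1 + q ^ e * (a * z) / q) * (1 + q ^ e * (a * z) / q\<^sup>2)) *
        ((1 - a / q\<^sup>2) * (1 + q ^ e * (a * z) / q ^ 3) * (1 + q ^ e * (a * z) / q ^ 4)) =
      q ^ w * z * (1 - a) * s (a / q\<^sup>2) (q ^ 3 * z) - (1 - z) * (1 + q ^ e * (a * z) / q) * s a z"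
  shows "P0 (q ^ (6 * Suc n)) * ct_sum q e w (Suc n) - P1 (q ^ (6 * Suc n)) * ct_sum q e w n +
    P2 * (case n of 0 \<Rightarrow> 0 | Suc l \<Rightarrow> ct_sum q e w l) = 0"
proof -
  define M where "M = Suc n"
  define F where "F = ct_term q e w M"
  define a where "a = (\<lambda>k. q ^ (2 * (M - k)))"
  define z where "z = (\<lambda>k. q ^ (3 * k))"
  define x where "x = (\<lambda>k. q ^ (2 * M + k))"
  define R1 where "R1 = (\<lambda>k. (1 - a k) * (1 + q ^ e * x k / q) * (1 + q ^ e * x k / q\<^sup>2))"
  define R2 where "R2 = (\<lambda>k. (1 - a k / q\<^sup>2) * (1 + q ^ e * x k / q ^ 3) * (1 + q ^ e * x k / q ^ 4))"
  \<comment> \<open>The factor \<open>1 - z k\<close> makes \<open>G 0\<close> vanish, and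
    \<open>F (Suc M) = 0\<close> takes care of the upper end.\<close>
  define G where "G = (\<lambda>k. F k * ((1 - z k) * (1 + q ^ e * (a k * z k) / q) * s (a k) (z k)))"
  define Y where "Y = q ^ (6 * M)"
  have az: "a k * z k = x k" if "k \<le> M" for k
  proof -
    have "2 * (M - k) + 3 * k = 2 * M + k" using that by simp
    then show ?thesis unfolding a_def z_def x_def power_add[symmetric] by (rule arg_cong)
  qed
  have Y: "a k ^ 3 * (z k)\<^sup>2 = Y" if "k \<le> M" for k
  proof -
    have "2 * (M - k) * 3 + 3 * k * 2 = 6 * M" using that by simp
    then show ?thesis by (simp add: a_def z_def Y_def flip: power_add power_mult)
  qed
  have step: "P0 Y * F k - P1 Y * (F k * R1 k) + P2 * (F k * R1 k * R2 k) = G (Suc k) - G k" if k: "k \<le> M" for k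
  proof -
    have zS: "z (Suc k) = q ^ 3 * z k" by (simp add: z_def power_add)
    have "G (Suc k) = F k * (q ^ w * z k * (1 - a k)) * s (a k / q\<^sup>2) (q ^ 3 * z k)"
    proof (cases "k = M")
      case True
      then show ?thesis by (simp add: G_def F_def ct_term_def a_def)
    next
      case False
      then have "M - k = Suc (M - Suc k)" using k by simp
      then have aS: "a (Suc k) = a k / q\<^sup>2" using q(2) by (simp add: a_def power2_eq_square)
      have "a (Suc k) * z (Suc k) / q = x k"
        using q(2) az[OF k] unfolding aS zS by (simp add: power2_eq_square power3_eq_cube field_simps)
      then have "q ^ e * (a (Suc k) * z (Suc k)) / q = q ^ e * x k"
        by (simp only: times_divide_eq_right[symmetric])
      then have "G (Suc k) = F (Suc k) * ((1 - q ^ 3 * z k) * (1 + q ^ e * x k)) * s (a k / q\<^sup>2) (q ^ 3 * z k)"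
        unfolding G_def by (simp only: aS zS mult.assoc)
      then show ?thesis
        using ct_term_Suc[OF q e k] by (simp add: F_def z_def x_def a_def)
    qed
    then have G1: "G (Suc k) = F k * (q ^ w * z k * (1 - a k) * s (a k / q\<^sup>2) (q ^ 3 * z k))"
      by (simp only: mult.assoc)
    have "P0 Y * F k - P1 Y * (F k * R1 k) + P2 * (F k * R1 k * R2 k) =
        F k * (P0 Y - P1 Y * R1 k + P2 * R1 k * R2 k)"
      by (simp add: algebra_simps)
    also have "P0 Y - P1 Y * R1 k + P2 * R1 k * R2 k = q ^ w * z k * (1 - a k) * s (a k / q\<^sup>2) (q ^ 3 * z k) -
        (1 - z k) * (1 + q ^ e * (a k * z k) / q) * s (a k) (z k)"
      using cert[of "a k" "z k"] unfolding Y[OF k] az[OF k] R1_def R2_def .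
    finally show ?thesis unfolding G1 by (simp only: G_def right_diff_distrib)
  qed
  have "(\<Sum>k\<le>M. P0 Y * F k - P1 Y * (F k * R1 k) + P2 * (F k * R1 k * R2 k)) = (\<Sum>k<Suc M. G (Suc k) - G k)"
    unfolding lessThan_Suc_atMost using step by (intro sum.cong) auto
  also have "\<dots> = G (Suc M) - G 0" by (rule sum_lessThan_telescope)
  also have "\<dots> = 0" by (simp add: G_def F_def ct_term_def z_def)
  finally have main: "P0 Y * (\<Sum>k\<le>M. F k) - P1 Y * (\<Sum>k\<le>M. F k * R1 k) + P2 * (\<Sum>k\<le>M. F k * R1 k * R2 k) = 0"
    by (simp add: sum.distrib sum_subtractf sum_distrib_left)
  have T1: "F k * R1 k = ct_term q e w n k" if "k \<le> M" for k
    using ct_term_pred[OF q e, of k n w] that by (simp add: F_def R1_def M_def a_def x_def)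
  have S1: "(\<Sum>k\<le>M. F k * R1 k) = ct_sum q e w n"
    using T1 by (simp add: M_def ct_sum_def ct_term_def)
  \<comment> \<open>For \<open>n = 0\<close> the third sum would have the index -1. It vanishes
    because \<open>a 0 = q^2\<close> makes \<open>R2 0\<close> zero, while the other term already
    carries \<open>R1 1 = 0\<close>.\<close>
  have S2: "(\<Sum>k\<le>M. F k * R1 k * R2 k) = (case n of 0 \<Rightarrow> 0 | Suc l \<Rightarrow> ct_sum q e w l)"
  proof (cases n)
    case 0
    have "F k * R1 k * R2 k = 0" if "k \<le> M" for k
    proof (cases "k = 0")
      case True
      then have "R2 k = 0" using q(2) by (simp add: R2_def a_def M_def 0)
      then show ?thesis by simp
    next
      case False
      then show ?thesis using T1[OF that] by (simp add: 0 ct_term_def)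
    qed
    then have "(\<Sum>k\<le>M. F k * R1 k * R2 k) = 0"
      by (intro sum.neutral ballI) (simp only: atMost_iff)
    then show ?thesis by (simp only: 0 nat.case)
  next
    case (Suc l)
    have "F k * R1 k * R2 k = ct_term q e w l k" if "k \<le> M" for k
    proof (cases "k = M")
      case True
      then show ?thesis using T1[of M] by (simp add: ct_term_def M_def Suc)
    next
      case False
      then have k: "k \<le> Suc l" using that by (simp add: M_def Suc)
      have "M - k = Suc (Suc l - k)" using k by (simp add: M_def Suc)
      then have "q ^ (2 * (Suc l - k)) = a k / q\<^sup>2" using q(2) by (simp add: a_def power2_eq_square)
      moreover have "q ^ e * q ^ (2 * Suc l + k) / q = q ^ e * x k / q ^ 3"
        "q ^ e * q ^ (2 * Suc l + k) / q\<^sup>2 = q ^ e * x k / q ^ 4"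
        using q(2) by (simp_all add: x_def M_def Suc field_simps eval_nat_numeral)
      ultimately show ?thesis
        using ct_term_pred[OF q e k, of w] T1[OF that] by (simp add: Suc R2_def)
    qed
    then have "(\<Sum>k\<le>M. F k * R1 k * R2 k) = (\<Sum>k\<le>M. ct_term q e w l k)" by (intro sum.cong) auto
    then show ?thesis by (simp add: M_def Suc ct_sum_def ct_term_def)
  qed
  from main show ?thesis
    unfolding S1 S2 by (simp only: F_def M_def Y_def ct_sum_def[symmetric])
qed

section \<open>Regrouping the double sum by \<open>j + k\<close>\<close>

lemma has_sum_multiples2:
  fixes g h :: "complex fps"
  assumes "((\<lambda>(a, b). w (a + b) * (h $ a * g $ b)) has_sum S) UNIV"
    and "\<And>a. \<not> 3 dvd a \<Longrightarrow> h $ a = 0" "\<And>b. \<not> 2 dvd b \<Longrightarrow> g $ b = 0"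
  shows "((\<lambda>(k, j). w (3 * k + 2 * j) * (h $ (3 * k) * g $ (2 * j))) has_sum S) UNIV"
proof -
  let ?F = "\<lambda>(a, b). w (a + b) * (h $ a * g $ b)"
  let ?m = "\<lambda>(k, j). (3 * k, 2 * j) :: nat \<times> nat"
  have "(?F has_sum S) (range ?m)"
  proof (rule has_sum_cong_neutral[THEN iffD1, OF _ _ _ assms(1)])
    fix z :: "nat \<times> nat"
    assume z: "z \<in> UNIV - range ?m"
    obtain a b where ab: "z = (a, b)" by (cases z)
    have "\<not> (3 dvd a \<and> 2 dvd b)"
    proof
      assume "3 dvd a \<and> 2 dvd b"
      then obtain k j where "a = 3 * k" "b = 2 * j" by (auto elim!: dvdE)
      then have "z = ?m (k, j)" by (simp add: ab)
      with z show False by blast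
    qed
    then show "?F z = 0" using assms(2,3) by (auto simp: ab)
  qed auto
  moreover have "inj ?m" by (auto simp: inj_on_def)
  ultimately have "(?F \<circ> ?m has_sum S) UNIV" by (simp add: has_sum_reindex)
  moreover have "?F \<circ> ?m = (\<lambda>(k, j). w (3 * k + 2 * j) * (h $ (3 * k) * g $ (2 * j)))"
    by (auto simp: fun_eq_iff)
  ultimately show ?thesis by simp
qed

text \<open>Splitting off \<open>1 / (q^e z; q)_inf\<close> leaves a double sum over
  \<open>k\<close> and \<open>j\<close>. With \<open>m = j + k\<close> the exponent is
  \<open>6 * (m choose 2) + 3 * (k choose 2)\<close> plus linear terms, which explains the base
  \<open>q ^ 6\<close>; the condition on \<open>w\<close> matches the terms linear in
  \<open>k\<close>.\<close>

lemma quad_sum_eq_ct_sum: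
  assumes q: "norm q < 1" and e: "e > 0" and w: "w + b = c + 1"
    and S: "(\<lambda>m. (q ^ 6) ^ (m choose 2) * (q ^ ((b + 2) * m) * ct_sum q e w m)) sums S"
  shows "quad_sum q (fps_euler1 (Suc 0) q (q ^ e) * fps_euler2 2 (q ^ 2) (- (q ^ (b + 1))) * fps_euler1 3 (q ^ 3) (q ^ c)) =
    qpoch_inf (- (q ^ e)) q * S"
proof -
  define g where "g = fps_euler2 2 (q ^ 2) (- (q ^ (b + 1)))"
  define h where "h = fps_euler1 3 (q ^ 3) (q ^ c)"
  define wt where "wt = (\<lambda>n. q ^ (n choose 2) / qpoch (- (q ^ e)) q n)"
  have nq: "norm (q ^ n) < 1" if "n > 0" for n using norm_power_less_1[OF q that] .
  have ne: "norm (- (q ^ e)) < 1" using nq[OF e] by simp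
  have geo: "geo_bounded g" "geo_bounded h"
    unfolding g_def h_def by (intro geo_bounded_euler1 geo_bounded_euler2 nq; simp)+
  obtain C where C: "\<And>n. norm (inverse (qpoch (- (q ^ e)) q n)) \<le> C"
    using inverse_qpoch_bounded[OF q ne] by blast
  have wt: "norm (wt n) \<le> C * norm (q ^ (n choose 2))" for n
    using mult_right_mono[OF C[of n], of "norm (q ^ (n choose 2))"]
    unfolding wt_def divide_inverse norm_mult by (simp add: mult.commute)
  obtain S0 where S0: "((\<lambda>(a, b). wt (a + b) * (h $ a * g $ b)) has_sum S0) UNIV"
    "(\<lambda>n. wt n * (h * g) $ n) sums S0"
    using quad_sum_mult2[OF q geo(2,1) wt] by blast
  have "q ^ (n choose 2) * (h * g) $ n * qpoch_inf (- (q ^ e * q ^ n)) q =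
      qpoch_inf (- (q ^ e)) q * (wt n * (h * g) $ n)" for n
    using qpoch_inf_split[OF q, of "- (q ^ e)" n] qpoch_nonzero[OF q ne, of n] by (simp add: wt_def)
  then have "(\<lambda>n. qpoch_inf (- (q ^ e)) q * (wt n * (h * g) $ n)) sums
      quad_sum q (h * g * fps_euler1 (Suc 0) q (q ^ e))"
    using quad_sum_mult_euler1[OF q geo_bounded_mult[OF geo(2,1)], of "q ^ e"] by (simp only:)
  from sums_unique2[OF this sums_mult[OF S0(2)]]
  have qs: "quad_sum q (h * g * fps_euler1 (Suc 0) q (q ^ e)) = qpoch_inf (- (q ^ e)) q * S0" .
  have "((\<lambda>(k, j). wt (3 * k + 2 * j) * (h $ (3 * k) * g $ (2 * j))) has_sum S0) UNIV"
    by (rule has_sum_multiples2[OF S0(1)]) (simp_all add: g_def h_def fps_euler_nth_not_dvd)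
  from has_sum_antidiagonal2[OF this]
  have "(\<lambda>m. \<Sum>k\<le>m. wt (3 * k + 2 * (m - k)) * (h $ (3 * k) * g $ (2 * (m - k)))) sums S0" by simp
  moreover have "(\<Sum>k\<le>m. wt (3 * k + 2 * (m - k)) * (h $ (3 * k) * g $ (2 * (m - k)))) =
      (q ^ 6) ^ (m choose 2) * (q ^ ((b + 2) * m) * ct_sum q e w m)" for m
    unfolding ct_sum_def sum_distrib_left
  proof (rule sum.cong[OF refl])
    fix k assume "k \<in> {..m}"
    then obtain j where m: "m = k + j" by (auto simp: le_iff_add)
    have t: "3 * k = k + (k + k)" "2 * j = j + j" by simp_all
    have c1: "3 * k choose 2 = 9 * (k choose 2) + 3 * k"
      unfolding t choose_two_add using square_eq_choose_two[of k] by (simp add: power2_eq_square algebra_simps)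
    have c2: "2 * j choose 2 = 4 * (j choose 2) + j"
      unfolding t choose_two_add using square_eq_choose_two[of j] by (simp add: power2_eq_square algebra_simps)
    have "w * k + b * k = c * k + k" using arg_cong[OF w, of "\<lambda>x. x * k"] by (simp add: algebra_simps)
    then have ex: "((3 * k + 2 * j) choose 2) + c * k + 2 * (j choose 2) + (b + 1) * j =
        6 * ((k + j) choose 2) + (b + 2) * (k + j) + (3 * (k choose 2) + w * k)"
      unfolding choose_two_add[of "3 * k" "2 * j"] choose_two_add[of k j] c1 c2 by (simp add: algebra_simps)
    have pw: "q ^ ((3 * k + 2 * j) choose 2) * (q ^ c) ^ k * (q\<^sup>2) ^ (j choose 2) * (q ^ (b + 1)) ^ j =
        (q ^ 6) ^ ((k + j) choose 2) * q ^ ((b + 2) * (k + j)) * q ^ (3 * (k choose 2) + w * k)"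
      unfolding power_mult[symmetric] power_add[symmetric] ex ..
    have sgn: "(-1) ^ j * y * (- x) ^ j = y * x ^ j" for x y :: complex
    proof -
      have "(-1) ^ j * (- x) ^ j = x ^ j" unfolding power_mult_distrib[symmetric] by simp
      then show ?thesis by (metis mult.assoc mult.commute)
    qed
    have "h $ (3 * k) = (q ^ c) ^ k / qpoch (q ^ 3) (q ^ 3) k"
      "g $ (2 * j) = (q\<^sup>2) ^ (j choose 2) * (q ^ (b + 1)) ^ j / qpoch (q\<^sup>2) (q\<^sup>2) j"
      unfolding g_def h_def by (simp_all only: fps_euler_nth_mult zero_less_numeral sgn)
    then have "wt (3 * k + 2 * j) * (h $ (3 * k) * g $ (2 * j)) =
        q ^ ((3 * k + 2 * j) choose 2) * (q ^ c) ^ k * (q\<^sup>2) ^ (j choose 2) * (q ^ (b + 1)) ^ j /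
        (qpoch (q ^ 3) (q ^ 3) k * qpoch (q\<^sup>2) (q\<^sup>2) j * qpoch (- (q ^ e)) q (3 * k + 2 * j))"
      unfolding wt_def by (simp only: times_divide_times_eq mult_ac)
    also have "3 * k + 2 * j = 2 * (k + j) + k" by simp
    finally have "wt (2 * (k + j) + k) * (h $ (3 * k) * g $ (2 * j)) =
        (q ^ 6) ^ ((k + j) choose 2) * (q ^ ((b + 2) * (k + j)) * ct_term q e w (k + j) k)"
      using pw by (simp add: ct_term_def mult.assoc)
    then show "wt (3 * k + 2 * (m - k)) * (h $ (3 * k) * g $ (2 * (m - k))) =
        (q ^ 6) ^ (m choose 2) * (q ^ ((b + 2) * m) * ct_term q e w m k)"
      unfolding m by (simp add: algebra_simps)
  qed
  ultimately have "(\<lambda>m. (q ^ 6) ^ (m choose 2) * (q ^ ((b + 2) * m) * ct_sum q e w m)) sums S0"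
    by (simp only:)
  then have "S0 = S" by (rule sums_unique2[OF _ S])
  then show ?thesis using qs by (simp add: g_def h_def mult_ac)
qed

text \<open>The polynomial \<open>s\<close> is the output of creative telescoping. Once it is known,
  only a polynomial identity in \<open>q\<close>, \<open>1 / q\<close>, \<open>a\<close> and
  \<open>z\<close> has to be checked.\<close>

lemma ct_certificate_H10:
  fixes q a z :: complex
  assumes q: "q \<noteq> 0"
  defines "s \<equiv> \<lambda>a z. - a\<^sup>2 - (1 / q ^ 3 + 1 / q\<^sup>2) * (a ^ 3 * z) + (1 / q\<^sup>2 - 1 / q ^ 4) * (a ^ 4 * z\<^sup>2) +
    (1 / q ^ 3 + 1 / q\<^sup>2) * (a\<^sup>2 * z) + (1 / q ^ 4) * (a ^ 3 * z\<^sup>2)"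
  shows "(1 - a ^ 3 * z\<^sup>2) * (1 - a ^ 3 * z\<^sup>2 / q\<^sup>2) -
      (1 + q\<^sup>2 - (1 / q ^ 5 + 1 / q) * (a ^ 3 * z\<^sup>2)) *
        ((1 - a) * (1 + q ^ 1 * (a * z) / q) * (1 + q ^ 1 * (a * z) / q\<^sup>2)) +
      q\<^sup>2 * ((1 - a) * (1 + q ^ 1 * (a * z) / q) * (1 + q ^ 1 * (a * z) / q\<^sup>2)) *
        ((1 - a / q\<^sup>2) * (1 + q ^ 1 * (a * z) / q ^ 3) * (1 + q ^ 1 * (a * z) / q ^ 4)) =
      q ^ 3 * z * (1 - a) * s (a / q\<^sup>2) (q ^ 3 * z) - (1 - z) * (1 + q ^ 1 * (a * z) / q) * s a z"
proof -
  \<comment> \<open>Treating \<open>1 / q\<close> as a variable subject to \<open>q * u = 1\<close>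
    makes the goal polynomial.\<close>
  define u where "u = 1 / q"
  have u: "q * u = 1" using q by (simp add: u_def)
  have pw: "x / q ^ n = x * u ^ n" "x / q = x * u" for x n by (simp_all add: u_def power_divide)
  show ?thesis unfolding s_def pw power_one_right using u by algebra
qed

lemma ct_certificate_H11:
  fixes q a z :: complex
  assumes q: "q \<noteq> 0"
  defines "s \<equiv> \<lambda>a z. - a\<^sup>2 - (1 / q + 1) * (a ^ 3 * z) + (q - 1 / q) * (a ^ 4 * z\<^sup>2) +
    (q + 1 / q) * (a\<^sup>2 * z) + (1 / q) * (a ^ 3 * z\<^sup>2)"
  shows "(1 - a ^ 3 * z\<^sup>2) * (1 - q\<^sup>2 * (a ^ 3 * z\<^sup>2)) -
      (1 + q\<^sup>2 - (1 / q ^ 3 + q) * (a ^ 3 * z\<^sup>2)) *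
        ((1 - a) * (1 + q\<^sup>2 * (a * z) / q) * (1 + q\<^sup>2 * (a * z) / q\<^sup>2)) +
      q\<^sup>2 * ((1 - a) * (1 + q\<^sup>2 * (a * z) / q) * (1 + q\<^sup>2 * (a * z) / q\<^sup>2)) *
        ((1 - a / q\<^sup>2) * (1 + q\<^sup>2 * (a * z) / q ^ 3) * (1 + q\<^sup>2 * (a * z) / q ^ 4)) =
      q\<^sup>2 * z * (1 - a) * s (a / q\<^sup>2) (q ^ 3 * z) - (1 - z) * (1 + q\<^sup>2 * (a * z) / q) * s a z"
proof -
  define u where "u = 1 / q"
  have u: "q * u = 1" using q by (simp add: u_def)
  have pw: "x / q ^ n = x * u ^ n" "x / q = x * u" for x n by (simp_all add: u_def power_divide)
  show ?thesis unfolding s_def pw power_one_right using u by algebra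
qed


section \<open>Products with base \<open>q ^ 12\<close> and the evaluation of \<open>H10\<close> and
  \<open>H11\<close>\<close>

lemma qpoch_inf_dissect_power:
  assumes q: "norm q < 1" and "b > 0" "m > 0"
  shows "qpoch_inf (q ^ r) (q ^ b) = (\<Prod>j<m. qpoch_inf (q ^ (r + b * j)) (q ^ (b * m)))"
  using qpoch_inf_dissect[OF norm_power_less_1[OF q assms(2)] assms(3), of "q ^ r"]
  by (simp add: power_add power_mult)

lemma prod_lessThan_small:
  fixes f :: "nat \<Rightarrow> complex"
  shows "(\<Prod>j<2. f j) = f 0 * f 1" "(\<Prod>j<4. f j) = f 0 * f 1 * f 2 * f 3"
    "(\<Prod>j<6. f j) = f 0 * f 1 * f 2 * f 3 * f 4 * f 5"
  by (simp_all add: lessThan_nat_numeral mult_ac)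

text \<open>Euler's identity for distinct and odd parts, with the odd exponents sorted modulo
  12.\<close>

lemma qpoch_inf_minus_q_12:
  assumes q: "norm q < 1"
  shows "qpoch_inf (- q) q * (qpoch_inf q (q ^ 12) * qpoch_inf (q ^ 3) (q ^ 12) * qpoch_inf (q ^ 5) (q ^ 12) *
    qpoch_inf (q ^ 7) (q ^ 12) * qpoch_inf (q ^ 9) (q ^ 12) * qpoch_inf (q ^ 11) (q ^ 12)) = 1"
  using qpoch_inf_minus_self[OF q] qpoch_inf_dissect_power[OF q, of 2 6 1] unfolding prod_lessThan_small
  by (simp add: mult_ac numeral_eq_Suc del: power_Suc)

lemma H10_eq:
  assumes q: "norm q < 1" "q \<noteq> 0"
  shows "H 10 1 q = 1 / (qpoch_inf q (q ^ 3) * qpochs_inf [q ^ 3, q ^ 6, q ^ 11] (q ^ 12))"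
proof -
  define u where "u = 1 / q"
  have u: "q * u = 1" using q by (simp add: u_def)
  have pw: "x / q ^ n = x * u ^ n" "x / q = x * u" for x n by (simp_all add: u_def power_divide)
  define h where "h = ct_sum q 1 3"
  have rec: "(1 - q ^ (6 * Suc n)) * (1 - q ^ (6 * Suc n) / q\<^sup>2) * h (Suc n) -
      (1 + q\<^sup>2 - (1 / q ^ 5 + 1 / q) * q ^ (6 * Suc n)) * h n +
      q\<^sup>2 * (case n of 0 \<Rightarrow> 0 | Suc l \<Rightarrow> h l) = 0" for n
    unfolding h_def by (rule ct_sum_recurrence[OF q zero_less_one ct_certificate_H10[OF q(2)]])
  have aux: "q ^ 4 * (1 - q ^ 6 * y) * (1 - q ^ 4 * y) * h2 =
      (q ^ 4 + q ^ 6 - (u + q ^ 3) * (q ^ 6 * y)) * h1 - q ^ 6 * h0"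
    if "(1 - q ^ 6 * y) * (1 - q ^ 6 * y / q\<^sup>2) * h2 -
      (1 + q\<^sup>2 - (1 / q ^ 5 + 1 / q) * (q ^ 6 * y)) * h1 + q\<^sup>2 * h0 = 0" for y h0 h1 h2
    using that u unfolding pw by algebra
  have h1: "q ^ 4 * (1 - q ^ 6) * (1 - q ^ 4) * h (Suc 0) = (q ^ 4 + q ^ 6 - (u + q ^ 3) * q ^ 6) * h 0"
    using aux[of 1 "h (Suc 0)" "h 0" 0] rec[of 0] by simp
  have h2: "q ^ 4 * (1 - q ^ 6 * (q ^ 6 * (q ^ 6) ^ m)) * (1 - q ^ 4 * (q ^ 6 * (q ^ 6) ^ m)) * h (Suc (Suc m)) =
      (q ^ 4 + q ^ 6 - (u + q ^ 3) * (q ^ 6 * (q ^ 6 * (q ^ 6) ^ m))) * h (Suc m) - q ^ 6 * h m" for m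
  proof -
    have "q ^ (6 * Suc (Suc m)) = q ^ 6 * (q ^ 6 * (q ^ 6) ^ m)" by (simp only: power_mult power_Suc)
    then show ?thesis using rec[of "Suc m"] by (intro aux) (simp only: nat.case)
  qed
  have h0: "h 0 = 1" by (simp add: h_def ct_sum_def ct_term_def)
  have n: "norm (q ^ 6) < 1" "q ^ 6 \<noteq> 0" "norm (q ^ 4) < 1" "q ^ 4 \<noteq> 0"
    using norm_power_less_1[OF q(1), of 6] norm_power_less_1[OF q(1), of 4] q(2) by simp_all
  \<comment> \<open>The recurrence is matched with base \<open>q ^ 6\<close>,
    \<open>d = q ^ 4\<close>, \<open>a = 1 / q\<close> and \<open>b = q ^ 3\<close>.\<close>
  have ab: "u * q ^ 3 * q ^ 6 = (q ^ 4)\<^sup>2" "u * q ^ 6 = q ^ 5" using u by algebra+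
  have e: "q ^ 3 * q ^ 6 = q ^ 9" "(q ^ 6)\<^sup>2 = q ^ 12" by (simp_all flip: power_add power_mult)
  let ?X = "\<lambda>r. qpoch_inf (q ^ r) (q ^ 12)"
  have "(\<lambda>m. (q ^ 6) ^ (m choose 2) * ((q ^ 4) ^ m * h m)) sums (?X 5 * ?X 9 / (?X 6 * qpoch_inf (q ^ 4) (q ^ 6)))"
    using gauss2_recurrence_sums[OF n ab(1) h0 h1 h2] unfolding ab e .
  then have "quad_sum q (fps_euler1 (Suc 0) q (q ^ 1) * fps_euler2 2 (q ^ 2) (- (q ^ (2 + 1))) * fps_euler1 3 (q ^ 3) (q ^ 4)) =
      qpoch_inf (- (q ^ 1)) q * (?X 5 * ?X 9 / (?X 6 * qpoch_inf (q ^ 4) (q ^ 6)))"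
    unfolding h_def power_mult[symmetric]
    by (intro quad_sum_eq_ct_sum[where w = 3] q) (simp_all add: power_mult)
  then have "H 10 1 q = qpoch_inf (- (q ^ 1)) q * (?X 5 * ?X 9 / (?X 6 * qpoch_inf (q ^ 4) (q ^ 6)))"
    using H_second[OF q(1), of 10 1 2 4] by (simp add: A_def)
  moreover have "qpoch_inf (q ^ 4) (q ^ 6) = ?X 4 * ?X 10"
    using qpoch_inf_dissect_power[OF q(1), of 6 2 4] unfolding prod_lessThan_small by (simp add: mult_ac numeral_eq_Suc del: power_Suc)
  moreover have "qpoch_inf q (q ^ 3) = ?X 1 * ?X 4 * ?X 7 * ?X 10"
    using qpoch_inf_dissect_power[OF q(1), of 3 4 1] unfolding prod_lessThan_small by (simp add: mult_ac numeral_eq_Suc del: power_Suc)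
  moreover have nz: "?X r \<noteq> 0" if "r > 0" for r
    using that by (intro qpoch_inf_nonzero norm_power_less_1 q) auto
  moreover have "qpoch_inf (- (q ^ 1)) q = 1 / (?X 1 * ?X 3 * ?X 5 * ?X 7 * ?X 9 * ?X 11)"
    using qpoch_inf_minus_q_12[OF q(1)] nz[of 1] nz[of 3] nz[of 5] nz[of 7] nz[of 9] nz[of 11]
    by (simp add: eq_divide_eq)
  ultimately have
    "H 10 1 q = 1 / (?X 1 * ?X 3 * ?X 5 * ?X 7 * ?X 9 * ?X 11) * (?X 5 * ?X 9 / (?X 6 * (?X 4 * ?X 10)))"
    and "qpoch_inf q (q ^ 3) = ?X 1 * ?X 4 * ?X 7 * ?X 10"
    by (simp_all only:)
  \<comment> \<open>With variables in place of the infinite products, the cancellation is plain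
    field arithmetic.\<close>
  moreover have "1 / (x1 * x3 * x5 * x7 * x9 * x11) * (x5 * x9 / (x6 * (x4 * x10))) =
      1 / (x1 * x4 * x7 * x10 * (x3 * (x6 * x11)))" if "x5 \<noteq> 0" "x9 \<noteq> 0"
    for x1 x3 x4 x5 x6 x7 x9 x10 x11 :: complex
    using that by simp
  ultimately show ?thesis
    using nz[of 5] nz[of 9] by (simp only: qpochs_inf_def list.map prod_list.Cons prod_list.Nil mult_1_right) simp
qed

lemma H11_eq:
  assumes q: "norm q < 1" "q \<noteq> 0"
  shows "H 11 1 q = 1 / (qpoch_inf (q ^ 2) (q ^ 3) * qpochs_inf [q ^ 3, q ^ 6, q ^ 7] (q ^ 12))"
proof -
  define u where "u = 1 / q"
  have u: "q * u = 1" using q by (simp add: u_def)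
  have pw: "x / q ^ n = x * u ^ n" "x / q = x * u" for x n by (simp_all add: u_def power_divide)
  define c where "c = ct_sum q 2 2"
  \<comment> \<open>The factor \<open>1 - q ^ 8 * y\<close> in the recurrence forces
    \<open>d = q ^ 8\<close>, and then the other coefficients match only after rescaling by
    \<open>q ^ (-2 m)\<close>. The rescaling is compensated in the series by
    \<open>(q ^ 8) ^ m * h m = (q ^ 6) ^ m * c m\<close>.\<close>
  define h where "h = (\<lambda>m. (u\<^sup>2) ^ m * c m)"
  have rec: "(1 - q ^ (6 * Suc n)) * (1 - q\<^sup>2 * q ^ (6 * Suc n)) * c (Suc n) -
      (1 + q\<^sup>2 - (1 / q ^ 3 + q) * q ^ (6 * Suc n)) * c n +
      q\<^sup>2 * (case n of 0 \<Rightarrow> 0 | Suc l \<Rightarrow> c l) = 0" for n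
    unfolding c_def by (rule ct_sum_recurrence[OF q zero_less_numeral ct_certificate_H11[OF q(2)]])
  have aux: "q ^ 8 * (1 - q ^ 6 * y) * (1 - q ^ 8 * y) * (u\<^sup>2 * v * c2) =
      (q ^ 8 + q ^ 6 - (q ^ 3 + q ^ 7) * (q ^ 6 * y)) * (v * c1) - q ^ 6 * (q\<^sup>2 * v * c0)"
    if "(1 - q ^ 6 * y) * (1 - q\<^sup>2 * (q ^ 6 * y)) * c2 -
      (1 + q\<^sup>2 - (1 / q ^ 3 + q) * (q ^ 6 * y)) * c1 + q\<^sup>2 * c0 = 0" for y v c0 c1 c2
    using that u unfolding pw by algebra
  have h1: "q ^ 8 * (1 - q ^ 6) * (1 - q ^ 8) * h (Suc 0) = (q ^ 8 + q ^ 6 - (q ^ 3 + q ^ 7) * q ^ 6) * h 0"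
    using aux[of 1 "c (Suc 0)" "c 0" 0 1] rec[of 0] by (simp add: h_def)
  have h2: "q ^ 8 * (1 - q ^ 6 * (q ^ 6 * (q ^ 6) ^ m)) * (1 - q ^ 8 * (q ^ 6 * (q ^ 6) ^ m)) * h (Suc (Suc m)) =
      (q ^ 8 + q ^ 6 - (q ^ 3 + q ^ 7) * (q ^ 6 * (q ^ 6 * (q ^ 6) ^ m))) * h (Suc m) - q ^ 6 * h m" for m
  proof -
    have "q ^ (6 * Suc (Suc m)) = q ^ 6 * (q ^ 6 * (q ^ 6) ^ m)" by (simp only: power_mult power_Suc)
    then have r: "(1 - q ^ 6 * (q ^ 6 * (q ^ 6) ^ m)) * (1 - q\<^sup>2 * (q ^ 6 * (q ^ 6 * (q ^ 6) ^ m))) * c (Suc (Suc m)) -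
      (1 + q\<^sup>2 - (1 / q ^ 3 + q) * (q ^ 6 * (q ^ 6 * (q ^ 6) ^ m))) * c (Suc m) + q\<^sup>2 * c m = 0"
      using rec[of "Suc m"] by (simp only: nat.case)
    have "q\<^sup>2 * (u\<^sup>2 * (u\<^sup>2) ^ m) = (u\<^sup>2) ^ m"
      using u by (simp add: mult.assoc[symmetric] flip: power_mult_distrib)
    then show ?thesis
      using aux[OF r, of "u\<^sup>2 * (u\<^sup>2) ^ m"] by (simp only: h_def power_Suc mult.assoc)
  qed
  have h0: "h 0 = 1" by (simp add: h_def c_def ct_sum_def ct_term_def)
  have n: "norm (q ^ 6) < 1" "q ^ 6 \<noteq> 0" "norm (q ^ 8) < 1" "q ^ 8 \<noteq> 0"
    using norm_power_less_1[OF q(1), of 6] norm_power_less_1[OF q(1), of 8] q(2) by simp_all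
  have ab: "q ^ 3 * q ^ 7 * q ^ 6 = (q ^ 8)\<^sup>2" by (simp flip: power_add power_mult)
  have e: "q ^ 3 * q ^ 6 = q ^ 9" "q ^ 7 * q ^ 6 = q ^ 13" "(q ^ 6)\<^sup>2 = q ^ 12" by (simp_all flip: power_add power_mult)
  have d: "(q ^ 8) ^ m * h m = q ^ ((4 + 2) * m) * c m" for m
  proof -
    have "q ^ 8 * u\<^sup>2 = q ^ 6" using u by algebra
    then have "(q ^ 8) ^ m * (u\<^sup>2) ^ m = (q ^ 6) ^ m" by (simp only: power_mult_distrib[symmetric])
    then show ?thesis by (simp add: h_def power_mult mult.assoc[symmetric])
  qed
  let ?X = "\<lambda>r. qpoch_inf (q ^ r) (q ^ 12)"
  have "(\<lambda>m. (q ^ 6) ^ (m choose 2) * ((q ^ 8) ^ m * h m)) sums (?X 9 * ?X 13 / (?X 6 * qpoch_inf (q ^ 8) (q ^ 6)))"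
    using gauss2_recurrence_sums[OF n ab h0 h1 h2] unfolding e .
  then have "quad_sum q (fps_euler1 (Suc 0) q (q ^ 2) * fps_euler2 2 (q ^ 2) (- (q ^ (4 + 1))) * fps_euler1 3 (q ^ 3) (q ^ 5)) =
      qpoch_inf (- (q ^ 2)) q * (?X 9 * ?X 13 / (?X 6 * qpoch_inf (q ^ 8) (q ^ 6)))"
    unfolding d unfolding c_def by (intro quad_sum_eq_ct_sum[where w = 2] q) simp_all
  then have "H 11 1 q = qpoch_inf (- (q ^ 2)) q * (?X 9 * ?X 13 / (?X 6 * qpoch_inf (q ^ 8) (q ^ 6)))"
    using H_second[OF q(1), of 11 2 4 5] by (simp add: A_def)
  moreover have nz: "?X r \<noteq> 0" if "r > 0" for r
    using that by (intro qpoch_inf_nonzero norm_power_less_1 q) auto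
  \<comment> \<open>The exponent 13 exceeds the period 12 and is folded back at the cost of
    \<open>1 - q\<close>. The similar corrections \<open>1 - q^2\<close> and \<open>1 + q\<close>
    below cancel against it in the end.\<close>
  moreover have "?X 13 = ?X 1 / (1 - q)"
  proof -
    have "?X 1 = (1 - q) * ?X 13"
      using qpoch_inf_Suc[OF norm_power_less_1[OF q(1), of 12], of q] by (simp flip: power_Suc)
    then show ?thesis using one_minus_neq_0[OF q(1)] by (simp add: eq_divide_eq)
  qed
  moreover have "qpoch_inf (q ^ 8) (q ^ 6) = ?X 2 * ?X 8 / (1 - q\<^sup>2)"
  proof -
    have "qpoch_inf (q ^ 2) (q ^ 6) = (1 - q\<^sup>2) * qpoch_inf (q ^ 8) (q ^ 6)"
      using qpoch_inf_Suc[OF norm_power_less_1[OF q(1), of 6], of "q\<^sup>2"] by (simp flip: power_add)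
    moreover have "qpoch_inf (q ^ 2) (q ^ 6) = ?X 2 * ?X 8"
      using qpoch_inf_dissect_power[OF q(1), of 6 2 2] unfolding prod_lessThan_small by (simp add: mult_ac numeral_eq_Suc del: power_Suc)
    ultimately show ?thesis
      using one_minus_neq_0[OF norm_power_less_1[OF q(1), of 2]] by (simp add: eq_divide_eq)
  qed
  moreover have "qpoch_inf (q ^ 2) (q ^ 3) = ?X 2 * ?X 5 * ?X 8 * ?X 11"
    using qpoch_inf_dissect_power[OF q(1), of 3 4 2] unfolding prod_lessThan_small by (simp add: mult_ac numeral_eq_Suc del: power_Suc)
  moreover have "qpoch_inf (- (q ^ 2)) q = 1 / ((1 + q) * (?X 1 * ?X 3 * ?X 5 * ?X 7 * ?X 9 * ?X 11))"
  proof -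
    have "qpoch_inf (- q) q = (1 + q) * qpoch_inf (- (q ^ 2)) q"
      using qpoch_inf_Suc[OF q(1), of "- q"] by (simp add: power2_eq_square)
    then have "(1 + q) * qpoch_inf (- (q ^ 2)) q * (?X 1 * ?X 3 * ?X 5 * ?X 7 * ?X 9 * ?X 11) = 1"
      using qpoch_inf_minus_q_12[OF q(1)] by simp
    then have *: "qpoch_inf (- (q ^ 2)) q * ((1 + q) * (?X 1 * ?X 3 * ?X 5 * ?X 7 * ?X 9 * ?X 11)) = 1"
      by (simp only: mult_ac)
    then have **: "(1 + q) * (?X 1 * ?X 3 * ?X 5 * ?X 7 * ?X 9 * ?X 11) \<noteq> 0"
      by (intro notI) (simp only: mult_zero_right zero_neq_one)
    show ?thesis by (rule nonzero_eq_divide_eq[THEN iffD2, OF ** *])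
  qed
  moreover have "1 - q \<noteq> 0" "1 + q \<noteq> 0" "1 - q\<^sup>2 \<noteq> 0" "1 - q\<^sup>2 = (1 - q) * (1 + q)"
    using one_minus_neq_0[OF q(1)] one_minus_neq_0[of "- q"] one_minus_neq_0[OF norm_power_less_1[OF q(1), of 2]] q
    by (simp_all add: power2_eq_square algebra_simps)
  ultimately have
    "H 11 1 q = 1 / ((1 + q) * (?X 1 * ?X 3 * ?X 5 * ?X 7 * ?X 9 * ?X 11)) *
      (?X 9 * (?X 1 / (1 - q)) / (?X 6 * (?X 2 * ?X 8 / ((1 - q) * (1 + q)))))"
    and "qpoch_inf (q ^ 2) (q ^ 3) = ?X 2 * ?X 5 * ?X 8 * ?X 11" and "1 - q \<noteq> 0" "1 + q \<noteq> 0"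
    by (simp_all only: simp_thms)
  moreover have "1 / (t * (x1 * x3 * x5 * x7 * x9 * x11)) * (x9 * (x1 / s) / (x6 * (x2 * x8 / (s * t)))) =
      1 / (x2 * x5 * x8 * x11 * (x3 * (x6 * x7)))" if "x1 \<noteq> 0" "x9 \<noteq> 0" "s \<noteq> 0" "t \<noteq> 0"
    for x1 x2 x3 x5 x6 x7 x8 x9 x11 s t :: complex
    using that by simp
  ultimately show ?thesis
    using nz[of 1] nz[of 9] by (simp only: qpochs_inf_def list.map prod_list.Cons prod_list.Nil mult_1_right) simp
qed

section \<open>Theta functions\<close>

lemma has_sum_times:
  fixes f g :: "_ \<Rightarrow> complex"
  assumes f: "(f has_sum a) X" "(\<lambda>x. norm (f x)) summable_on X"
    and g: "(g has_sum b) Y" "(\<lambda>y. norm (g y)) summable_on Y"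
  shows "((\<lambda>z. f (fst z) * g (snd z)) has_sum a * b) (X \<times> Y)"
proof -
  obtain S where S: "((\<lambda>z. f (fst z) * g (snd z)) has_sum S) (X \<times> Y)"
    using Infinite_Sum.abs_summable_summable[OF abs_summable_on_times[OF f(2) g(2)]] by (auto simp: summable_on_def)
  have "((\<lambda>x. f x * b) has_sum S) X"
  proof (rule has_sum_SigmaD[OF S])
    fix x
    show "((\<lambda>y. f (fst (x, y)) * g (snd (x, y))) has_sum f x * b) Y"
      using has_sum_cmult_right[OF g(1), of "f x"] by simp
  qed
  moreover have "((\<lambda>x. f x * b) has_sum a * b) X" by (rule has_sum_cmult_left[OF f(1)])
  ultimately have "S = a * b" by (rule has_sum_unique)
  with S show ?thesis by simp
qed

text \<open>\<open>n choose 2\<close> continued to negative integers, as a bilateral series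
  requires.\<close>

definition tri :: "int \<Rightarrow> int" where
  "tri n = n * (n - 1) div 2"

lemma two_tri: "2 * tri n = n * (n - 1)"
proof -
  have "even (n * (n - 1))" by auto
  then show ?thesis by (simp add: tri_def)
qed

lemma tri_of_nat: "tri (int m) = int (m choose 2)"
proof -
  have "2 * int (m choose 2) = int m * (int m - 1)"
    using arg_cong[OF two_mult_choose_two[of m], of int] by (cases m) (simp_all add: algebra_simps)
  then show ?thesis using two_tri[of "int m"] by linarith
qed

lemma tri_add: "tri (m + n) = tri m + tri n + m * n"
  using two_tri[of "m + n"] two_tri[of m] two_tri[of n] by (simp add: algebra_simps)

lemma tri_uminus: "tri (- n) = tri n + n"
  using two_tri[of "- n"] two_tri[of n] by (simp add: algebra_simps)

definition theta_term :: "complex \<Rightarrow> complex \<Rightarrow> int \<Rightarrow> complex" where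
  "theta_term z q n = q powi tri n * (- z) powi n"

definition theta :: "complex \<Rightarrow> complex \<Rightarrow> complex" where
  "theta z q = (\<Sum>\<^sub>\<infinity>n\<in>UNIV. theta_term z q n)"

lemma theta_term_of_nat: "theta_term z q (int m) = q ^ (m choose 2) * (- z) ^ m"
  by (simp add: theta_term_def tri_of_nat)

lemma theta_term_neg:
  assumes "q \<noteq> 0" "z \<noteq> 0"
  shows "theta_term z q (- int m) = q ^ (m choose 2) * (- (q / z)) ^ m"
proof -
  have "theta_term z q (- int m) = q powi (int (m choose 2) + int m) * (- z) powi (- int m)"
    by (simp add: theta_term_def tri_uminus tri_of_nat)
  also have "\<dots> = q ^ (m choose 2) * q ^ m * inverse ((- z) ^ m)"
    using assms by (simp add: power_int_add power_int_minus)
  also have "\<dots> = q ^ (m choose 2) * (q * inverse (- z)) ^ m"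
    by (simp only: power_mult_distrib power_inverse mult.assoc)
  also have "q * inverse (- z) = - (q / z)" by (simp add: divide_inverse)
  finally show ?thesis .
qed

text \<open>Each half of the bilateral series has the form \<open>q ^ (m choose 2) * x ^ m\<close>,
  with \<open>x = - z\<close> for the indices \<open>m\<close> and \<open>x = - (q / z)\<close> for
  the indices \<open>- m\<close>.\<close>

lemma theta_abs_summable:
  assumes q: "norm q < 1" "q \<noteq> 0" and z: "z \<noteq> 0"
  shows "(\<lambda>n. norm (theta_term z q n)) summable_on UNIV"
proof -
  let ?f = "\<lambda>n. norm (theta_term z q n)"
  have s: "(\<lambda>m. norm (q ^ (m choose 2) * x ^ m)) summable_on UNIV" for x
    by (intro abs_summable_nat summable_power_choose_two q)
  have "(?f \<circ> int) summable_on UNIV"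
    using s[of "- z"] by (simp add: o_def theta_term_of_nat)
  then have 1: "?f summable_on range int" by (simp add: summable_on_reindex)
  have "(?f \<circ> (\<lambda>m. - int m)) summable_on UNIV"
    using s[of "- (q / z)"] by (simp add: o_def theta_term_neg[OF q(2) z])
  then have 2: "?f summable_on range (\<lambda>m. - int m)" by (subst summable_on_reindex) (auto simp: inj_on_def)
  have "?f summable_on (range int \<union> (range (\<lambda>m. - int m) - range int))"
    by (intro summable_on_Un_disjoint 1 summable_on_subset_banach[OF 2]) auto
  moreover have "range int \<union> (range (\<lambda>m. - int m) - range int) = UNIV"
  proof -
    have "n \<in> range int \<union> range (\<lambda>m. - int m)" for n
      by (cases n rule: int_cases2) auto
    then show ?thesis by auto
  qed
  ultimately show ?thesis by simp
qed

lemma theta_has_sum: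
  assumes "norm q < 1" "q \<noteq> 0" "z \<noteq> 0"
  shows "(theta_term z q has_sum theta z q) UNIV"
  unfolding theta_def
  by (rule has_sum_infsum[OF Infinite_Sum.abs_summable_summable[OF theta_abs_summable[OF assms]]])

text \<open>Writing \<open>1 / (q; q)\<^sub>n = (q\<^sup>n\<^sup>+\<^sup>1; q)\<^sub>\<infinity> / (q; q)\<^sub>\<infinity>\<close> turns Euler's expansion of \<open>(z; q)\<^sub>\<infinity>\<close> into
  a sum over all integers, as the numerator vanishes for negative \<open>n\<close>.\<close>

lemma jacobi_triple_product:
  assumes q: "norm q < 1" "q \<noteq> 0" and z: "norm q < norm z"
  shows "theta z q = qpoch_inf z q * qpoch_inf (q / z) q * qpoch_inf q q"
proof -
  have z0: "z \<noteq> 0" using z norm_ge_zero[of q] by auto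
  \<comment> \<open>The bound on \<open>z\<close> serves to expand \<open>1 / (q / z; q)_inf\<close>
    by Euler's first identity. The theta series is multiplied by this expansion, and the double sum
    is evaluated in two ways.\<close>
  have qz: "norm (q / z) < 1" using z z0 by (simp add: norm_divide)
  define E where "E = (\<lambda>m. (q / z) ^ m / qpoch q q m)"
  have E: "(E has_sum (1 / qpoch_inf (q / z) q)) UNIV" "(\<lambda>m. norm (E m)) summable_on UNIV"
    unfolding E_def
    by (rule norm_summable_imp_has_sum[OF summable_euler1[OF q(1) qz] euler1[OF q(1) qz]],
        rule abs_summable_nat[OF summable_euler1[OF q(1) qz]])
  let ?F = "\<lambda>x. theta_term z q (fst x) * E (snd x)"
  have F: "(?F has_sum (theta z q * (1 / qpoch_inf (q / z) q))) (UNIV \<times> UNIV)"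
    by (intro has_sum_times theta_has_sum theta_abs_summable q z0 E)
  \<comment> \<open>Replacing the theta index by \<open>n + m\<close> turns the inner sum over
    \<open>m\<close> into Euler's series for \<open>qpoch_inf (q powi (n + 1)) q\<close>.\<close>
  let ?G = "\<lambda>(n, m). theta_term z q n * ((-1) ^ m * q ^ (m choose 2) * (q powi (n + 1)) ^ m / qpoch q q m)"
  have G_eq: "?F (n + int m, m) = ?G (n, m)" for n m
  proof -
    have 1: "q powi tri (n + int m) = q powi tri n * q ^ (m choose 2) * q powi (n * int m)"
      using q(2) by (simp add: tri_add tri_of_nat power_int_add)
    have 2: "(- z) powi (n + int m) = (- z) powi n * (- z) ^ m" using z0 by (simp add: power_int_add)
    have 3: "(q powi (n + 1)) ^ m = q powi (n * int m) * q ^ m"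
    proof -
      have "(q powi (n + 1)) ^ m = q powi ((n + 1) * int m)" by (simp add: power_int_mult)
      also have "(n + 1) * int m = n * int m + int m" by (simp add: algebra_simps)
      finally show ?thesis using q(2) by (simp add: power_int_add)
    qed
    have "(- z) ^ m * (q / z) ^ m = ((- z) * (q / z)) ^ m" by (simp only: power_mult_distrib)
    also have "(- z) * (q / z) = (-1) * q" using z0 by simp
    finally have 4: "(- z) ^ m * (q / z) ^ m = (-1) ^ m * q ^ m" by (simp only: power_mult_distrib)
    have "?F (n + int m, m) = q powi tri n * (- z) powi n *
        (q ^ (m choose 2) * q powi (n * int m) * ((- z) ^ m * (q / z) ^ m) / qpoch q q m)"
      unfolding theta_term_def E_def 1 2 fst_conv snd_conv by (simp only: times_divide_eq_right mult_ac)
    then show ?thesis unfolding 4 theta_term_def prod.case 3 by (simp only: mult_ac)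
  qed
  have "(?G has_sum (theta z q * (1 / qpoch_inf (q / z) q))) (UNIV \<times> UNIV)"
  proof (subst has_sum_reindex_bij_witness[where i = "\<lambda>(N, m). (N - int m, m)" and j = "\<lambda>(n, m). (n + int m, m)"
        and T = "UNIV \<times> UNIV" and h = ?F and s' = "theta z q * (1 / qpoch_inf (q / z) q)"])
    fix x :: "int \<times> nat"
    show "?F (case x of (n, m) \<Rightarrow> (n + int m, m)) = ?G x"
      using G_eq[of "fst x" "snd x"] by (simp add: case_prod_unfold)
    show "(?F has_sum (theta z q * (1 / qpoch_inf (q / z) q))) (UNIV \<times> UNIV)" by (rule F)
  qed auto
  then have g: "((\<lambda>n. theta_term z q n * qpoch_inf (q powi (n + 1)) q) has_sum
      (theta z q * (1 / qpoch_inf (q / z) q))) UNIV"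
  proof (rule has_sum_SigmaD)
    fix n
    let ?x = "q powi (n + 1)"
    have "((\<lambda>m. (-1) ^ m * q ^ (m choose 2) * ?x ^ m / qpoch q q m) has_sum qpoch_inf ?x q) UNIV"
      by (intro norm_summable_imp_has_sum summable_euler2 euler2 q)
    from has_sum_cmult_right[OF this, of "theta_term z q n"]
    show "((\<lambda>m. ?G (n, m)) has_sum theta_term z q n * qpoch_inf ?x q) UNIV" by simp
  qed
  have van: "qpoch_inf (q powi (n + 1)) q = 0" if "n \<notin> range int" for n
  proof (cases n rule: int_cases)
    case (nonneg k)
    with that show ?thesis by blast
  next
    case n: (neg k)
    have e: "n + 1 = - int k" by (simp add: n)
    have "1 - q powi (n + 1) * q ^ k = 0" using q(2) unfolding e by (simp add: power_int_minus)
    then have "qpoch (q powi (n + 1)) q (Suc k) = 0" by (simp add: qpoch_Suc)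
    then show ?thesis using qpoch_inf_split[OF q(1), of "q powi (n + 1)" "Suc k"] by simp
  qed
  have "((\<lambda>n. theta_term z q n * qpoch_inf (q powi (n + 1)) q) has_sum
      (theta z q * (1 / qpoch_inf (q / z) q))) (range int)"
    by (rule has_sum_cong_neutral[THEN iffD1, OF _ _ _ g]) (use van in auto)
  then have s1: "(\<lambda>k. theta_term z q (int k) * qpoch_inf (q powi (int k + 1)) q) sums
      (theta z q * (1 / qpoch_inf (q / z) q))"
    by (intro has_sum_imp_sums) (simp add: has_sum_reindex o_def)
  have s2: "theta_term z q (int k) * qpoch_inf (q powi (int k + 1)) q =
      qpoch_inf q q * ((-1) ^ k * q ^ (k choose 2) * z ^ k / qpoch q q k)" for k
  proof -
    have "q powi (int k + 1) = q * q ^ k" using q(2) by (simp add: power_int_add)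
    moreover have "(- z) ^ k = (-1) ^ k * z ^ k" by (rule power_minus)
    moreover have "qpoch_inf (q * q ^ k) q = qpoch_inf q q / qpoch q q k"
      using qpoch_inf_split[OF q(1), of q k] qpoch_nonzero[OF q(1) q(1), of k] by simp
    ultimately show ?thesis unfolding theta_term_of_nat by simp
  qed
  have s3: "(\<lambda>k. qpoch_inf q q * ((-1) ^ k * q ^ (k choose 2) * z ^ k / qpoch q q k)) sums
      (qpoch_inf q q * qpoch_inf z q)"
    by (intro sums_mult euler2 q)
  have "theta z q * (1 / qpoch_inf (q / z) q) = qpoch_inf q q * qpoch_inf z q"
    by (rule sums_unique2[OF s1[unfolded s2] s3])
  then show ?thesis using qpoch_inf_nonzero[OF q(1) qz] by (simp add: field_simps)
qed

lemma theta_shift: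
  assumes q: "norm q < 1" "q \<noteq> 0" and z: "z \<noteq> 0"
  shows "theta (q * z) q = - (theta z q / z)"
proof -
  have t: "theta_term (q * z) q n = (- (1 / z)) * theta_term z q (n + 1)" for n
  proof -
    have "tri (n + 1) = tri n + n" by (simp add: tri_add) (simp add: tri_def)
    moreover have "(- (q * z)) powi n = q powi n * (- z) powi n"
      by (simp flip: power_int_mult_distrib)
    ultimately show ?thesis using q(2) z by (simp add: theta_term_def power_int_add)
  qed
  have "((\<lambda>n. theta_term z q (n + 1)) has_sum theta z q) UNIV"
    using theta_has_sum[OF q z]
    by (subst has_sum_reindex_bij_witness[where i = "\<lambda>n. n - 1" and j = "\<lambda>n. n + 1" and T = UNIV
        and h = "theta_term z q" and s' = "theta z q"]) auto
  moreover have "theta_term (q * z) q = (\<lambda>n. (- (1 / z)) * theta_term z q (n + 1))"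
    by (rule ext) (rule t)
  ultimately have "(theta_term (q * z) q has_sum (- (1 / z)) * theta z q) UNIV"
    by (simp only: has_sum_cmult_right)
  from infsumI[OF this] show ?thesis by (simp add: theta_def)
qed

lemma has_sum_residues:
  fixes F :: "int \<Rightarrow> 'a \<Rightarrow> complex"
  assumes "((\<lambda>(t, x). F t x) has_sum S) ({a..<b} \<times> UNIV)" "\<And>t. t \<in> {a..<b} \<Longrightarrow> ((\<lambda>x. F t x) has_sum G t) UNIV"
  shows "S = (\<Sum>t\<in>{a..<b::int}. G t)"
proof -
  have "(G has_sum S) {a..<b}"
    by (rule has_sum_SigmaD[where f = "\<lambda>(t, x). F t x" and B = "\<lambda>_. UNIV"]) (use assms in simp_all)
  then show ?thesis by (simp add: has_sum_finite_iff)
qed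

text \<open>The exponent of the double series has the leading part \<open>m^2 / 2 + n^2\<close>.
  Putting \<open>r + t - 2 n\<close> for \<open>m\<close> and \<open>n + r\<close> for
  \<open>n\<close> removes the mixed term in \<open>r\<close> and \<open>n\<close>. The new
  variables reach exactly the pairs with \<open>m + 2 n = 3 r + t\<close>, so \<open>t\<close> is a
  residue modulo 3 and there are three products.\<close>

lemma theta_mult:
  assumes q: "norm q < 1" "q \<noteq> 0" and z: "z \<noteq> 0"
  shows "theta z q * theta (q * z\<^sup>2) (q\<^sup>2) =
    theta (- (q * z ^ 3)) (q ^ 3) * theta (q ^ 4) (q ^ 6) -
    z * theta (- (q\<^sup>2 * z ^ 3)) (q ^ 3) * theta (q\<^sup>2) (q ^ 6) +
    q * z\<^sup>2 * theta (- (q ^ 3 * z ^ 3)) (q ^ 3) * theta 1 (q ^ 6)"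
proof -
  have nq: "norm (q ^ n) < 1" if "n > 0" for n using norm_power_less_1[OF q(1) that] .
  let ?F = "\<lambda>x. theta_term z q (fst x) * theta_term (q * z\<^sup>2) (q\<^sup>2) (snd x)"
  have F: "(?F has_sum (theta z q * theta (q * z\<^sup>2) (q\<^sup>2))) (UNIV \<times> UNIV)"
    using q z nq[of 2] by (intro has_sum_times theta_has_sum theta_abs_summable) auto
  let ?c = "\<lambda>t. q powi tri t * (- z) powi t"
  let ?G = "\<lambda>t x. ?c t * (theta_term (- (q powi (t + 1) * z ^ 3)) (q ^ 3) (fst x) *
    theta_term (q powi (4 - 2 * t)) (q ^ 6) (snd x))"
  have F_eq: "?F (r + t - 2 * n, n + r) = ?G t (r, n)" for r t n
  proof -
    have 1: "theta_term (q * z\<^sup>2) (q\<^sup>2) k = q powi (2 * tri k + k) * (- 1) powi k * z powi (2 * k)" for k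
    proof -
      have "(- (q * z\<^sup>2)) powi k = ((-1) * (q * z powi 2)) powi k" by simp
      also have "\<dots> = (-1) powi k * (q powi k * z powi (2 * k))"
        by (simp only: power_int_mult_distrib power_int_mult)
      finally show ?thesis using q(2) by (simp add: theta_term_def power_int_mult power_int_add)
    qed
    have 2: "theta_term z q k = q powi tri k * (- 1) powi k * z powi k" for k
      by (simp add: theta_term_def flip: power_int_mult_distrib mult.assoc)
    have 3: "theta_term (- (q powi (t + 1) * z ^ 3)) (q ^ 3) r = q powi (3 * tri r + (t + 1) * r) * z powi (3 * r)"
    proof -
      have "(q powi (t + 1) * z ^ 3) powi r = q powi ((t + 1) * r) * z powi (3 * r)"
        by (simp add: power_int_mult_distrib power_int_mult)
      then show ?thesis using q(2) by (simp add: theta_term_def power_int_add power_int_mult)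
    qed
    have 4: "theta_term (q powi (4 - 2 * t)) (q ^ 6) n = q powi (6 * tri n + (4 - 2 * t) * n) * (-1) powi n"
    proof -
      have "(- (q powi (4 - 2 * t))) powi n = ((-1) * q powi (4 - 2 * t)) powi n" by simp
      also have "\<dots> = (-1) powi n * q powi ((4 - 2 * t) * n)"
        by (simp only: power_int_mult_distrib power_int_mult)
      finally show ?thesis using q(2) by (simp add: theta_term_def power_int_add power_int_mult)
    qed
    have 5: "?c t = q powi tri t * (-1) powi t * z powi t"
      by (simp flip: power_int_mult_distrib mult.assoc)
    have ex: "tri (r + t - 2 * n) + (2 * tri (n + r) + (n + r)) =
        tri t + (3 * tri r + (t + 1) * r) + (6 * tri n + (4 - 2 * t) * n)"
      using two_tri[of "r + t - 2 * n"] two_tri[of "n + r"] two_tri[of t] two_tri[of r] two_tri[of n]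
      by (simp add: algebra_simps)
    have zx: "(r + t - 2 * n) + 2 * (n + r) = t + 3 * r" by simp
    have sx: "(-1 :: complex) powi (r + t - 2 * n) * (-1) powi (n + r) = (-1) powi t * (-1) powi n"
    proof -
      have "(-1 :: complex) powi (r + t - 2 * n) * (-1) powi (n + r) = (-1) powi (t + n + 2 * (r - n))"
        by (subst power_int_add[symmetric]) (simp_all add: algebra_simps)
      also have "\<dots> = (-1) powi t * (-1) powi n * ((-1) powi 2) powi (r - n)"
        by (simp only: power_int_add power_int_mult simp_thms neg_equal_0_iff_equal zero_neq_one one_neq_zero)
      finally show ?thesis by simp
    qed
    have "?F (r + t - 2 * n, n + r) = (q powi tri (r + t - 2 * n) * q powi (2 * tri (n + r) + (n + r))) *
        ((-1) powi (r + t - 2 * n) * (-1) powi (n + r)) * (z powi (r + t - 2 * n) * z powi (2 * (n + r)))"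
      unfolding fst_conv snd_conv 1 2 by (simp only: mult_ac)
    also have "q powi tri (r + t - 2 * n) * q powi (2 * tri (n + r) + (n + r)) =
        q powi tri t * q powi (3 * tri r + (t + 1) * r) * q powi (6 * tri n + (4 - 2 * t) * n)"
      using q(2) by (simp only: power_int_add[symmetric] ex simp_thms)
    also have "z powi (r + t - 2 * n) * z powi (2 * (n + r)) = z powi t * z powi (3 * r)"
      using z by (simp only: power_int_add[symmetric] zx simp_thms)
    finally show ?thesis unfolding sx fst_conv snd_conv 3 4 5 by (simp only: mult_ac)
  qed
  have "((\<lambda>(t, x). ?G t x) has_sum (theta z q * theta (q * z\<^sup>2) (q\<^sup>2))) ({0..<3} \<times> UNIV)"
  proof (subst has_sum_reindex_bij_witness[where
        i = "\<lambda>(m, n). ((m + 2 * n) mod 3, ((m + 2 * n) div 3, n - (m + 2 * n) div 3))"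
        and j = "\<lambda>(t, (r, n)). (r + t - 2 * n, n + r)"
        and T = "UNIV \<times> UNIV" and h = ?F and s' = "theta z q * theta (q * z\<^sup>2) (q\<^sup>2)"])
    fix x :: "int \<times> int \<times> int" assume x: "x \<in> {0..<3} \<times> UNIV"
    obtain t r n where x': "x = (t, r, n)" by (cases x)
    have "r + t - 2 * n + 2 * (n + r) = t + 3 * r" by simp
    moreover have "(t + 3 * r) mod 3 = t" "(t + 3 * r) div 3 = r" using x by (auto simp: x')
    ultimately show "(case case x of (t, r, n) \<Rightarrow> (r + t - 2 * n, n + r) of
        (m, n) \<Rightarrow> ((m + 2 * n) mod 3, (m + 2 * n) div 3, n - (m + 2 * n) div 3)) = x"
      by (simp only: x' prod.case) simp
    show "?F (case x of (t, r, n) \<Rightarrow> (r + t - 2 * n, n + r)) = (case x of (t, x) \<Rightarrow> ?G t x)"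
      unfolding x' prod.case by (rule F_eq)
  next
    fix y :: "int \<times> int"
    obtain m n where y: "y = (m, n)" by (cases y)
    show "(case case y of (m, n) \<Rightarrow> ((m + 2 * n) mod 3, (m + 2 * n) div 3, n - (m + 2 * n) div 3) of
        (t, r, n) \<Rightarrow> (r + t - 2 * n, n + r)) = y"
    proof -
      define d where "d = (m + 2 * n) div 3"
      define r where "r = (m + 2 * n) mod 3"
      have "3 * d + r = m + 2 * n" unfolding d_def r_def by (rule mult_div_mod_eq)
      then have *: "d + r - 2 * (n - d) = m" by simp
      show ?thesis unfolding y prod.case d_def[symmetric] r_def[symmetric] * by simp
    qed
    show "(?F has_sum (theta z q * theta (q * z\<^sup>2) (q\<^sup>2))) (UNIV \<times> UNIV)" by (rule F)
  qed auto
  then have "theta z q * theta (q * z\<^sup>2) (q\<^sup>2) = (\<Sum>t\<in>{0..<3}. ?c t *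
      (theta (- (q powi (t + 1) * z ^ 3)) (q ^ 3) * theta (q powi (4 - 2 * t)) (q ^ 6)))"
  proof (rule has_sum_residues)
    fix t :: int
    show "(?G t has_sum ?c t * (theta (- (q powi (t + 1) * z ^ 3)) (q ^ 3) * theta (q powi (4 - 2 * t)) (q ^ 6))) UNIV"
      unfolding UNIV_Times_UNIV[symmetric] using q z nq[of 3] nq[of 6]
      by (intro has_sum_cmult_right has_sum_times theta_has_sum theta_abs_summable) auto
  qed
  also have "{0..<3} = {0, 1, 2 :: int}" by auto
  finally show ?thesis by (simp add: tri_def power_int_minus)
qed

text \<open>In \<open>theta_mult\<close> the third term vanishes, as the triple product for
  \<open>theta 1\<close> contains the factor \<open>1 - 1\<close>. The values at
  \<open>q ^ 4\<close> and \<open>q ^ 2\<close> in the other two are both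
  \<open>(q^2, q^4, q^6; q^6)_inf\<close>.\<close>

lemma quintuple_product:
  assumes q: "norm q < 1" "q \<noteq> 0" and z: "z \<noteq> 0"
  shows "theta z q * theta (q * z\<^sup>2) (q\<^sup>2) =
    qpoch_inf (q\<^sup>2) (q\<^sup>2) * (theta (- (q * z ^ 3)) (q ^ 3) - z * theta (- (q\<^sup>2 * z ^ 3)) (q ^ 3))"
proof -
  have nq: "norm (q ^ n) < 1" if "n > 0" for n using norm_power_less_1[OF q(1) that] .
  have lt: "norm (q ^ 6) < norm (q ^ n)" if "n < 6" for n
    using q that by (simp add: norm_power power_strict_decreasing)
  have "q ^ 6 / q ^ 4 = q\<^sup>2" "q ^ 6 / q\<^sup>2 = q ^ 4" using q(2) by (simp_all flip: power_diff)
  moreover have "qpoch_inf (q\<^sup>2) (q\<^sup>2) = qpoch_inf (q\<^sup>2) (q ^ 6) * qpoch_inf (q ^ 4) (q ^ 6) * qpoch_inf (q ^ 6) (q ^ 6)"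
  proof -
    have "(\<Prod>j<3. f j) = f 0 * f 1 * f 2" for f :: "nat \<Rightarrow> complex"
      by (simp add: lessThan_nat_numeral mult_ac)
    then show ?thesis using qpoch_inf_dissect_power[OF q(1), of 2 3 2]
      by (simp add: mult_ac numeral_eq_Suc del: power_Suc)
  qed
  ultimately have "theta (q ^ 4) (q ^ 6) = qpoch_inf (q\<^sup>2) (q\<^sup>2)" "theta (q\<^sup>2) (q ^ 6) = qpoch_inf (q\<^sup>2) (q\<^sup>2)"
    using jacobi_triple_product[OF nq[of 6] _ lt[of 4]] jacobi_triple_product[OF nq[of 6] _ lt[of 2]] q(2)
    by (simp_all add: mult_ac)
  moreover have "theta 1 (q ^ 6) = 0"
    using jacobi_triple_product[OF nq[of 6] _ lt[of 0]] q(2) qpoch_inf_Suc[OF nq[of 6], of 1] by simp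
  ultimately show ?thesis unfolding theta_mult[OF assms] by (simp add: algebra_simps)
qed

text \<open>With the index written as \<open>6 r + b\<close> one has
  \<open>z ^ (6 r) = (-1) ^ r\<close>. The range from -2 to 3 is chosen because \<open>b\<close> and
  \<open>1 - b\<close> have the same \<open>tri\<close> and arguments with product
  \<open>q ^ 36\<close>, so that the six theta values pair up.\<close>

lemma theta_six_dissection:
  assumes q: "norm q < 1" "q \<noteq> 0" and z: "z ^ 6 = -1"
  shows "theta (- z) q = (\<Sum>b\<in>{-2..<4}. z powi b * q powi tri b * theta (q powi (15 + 6 * b)) (q ^ 36))"
proof -
  have z0: "z \<noteq> 0" using z by auto
  have n36: "norm (q ^ 36) < 1" using norm_power_less_1[OF q(1), of 36] by simp
  let ?G = "\<lambda>b r. z powi b * q powi tri b * theta_term (q powi (15 + 6 * b)) (q ^ 36) r"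
  have eq: "theta_term (- z) q (6 * r + b) = ?G b r" for r b
  proof -
    have "tri (6 * r + b) = tri b + (36 * tri r + (15 + 6 * b) * r)"
      using two_tri[of "6 * r + b"] two_tri[of b] two_tri[of r] by (simp add: algebra_simps)
    then have 1: "q powi tri (6 * r + b) = q powi tri b * ((q ^ 36) powi tri r * (q powi (15 + 6 * b)) powi r)"
      using q(2) by (simp add: power_int_add power_int_mult)
    have 2: "z powi (6 * r + b) = (-1) powi r * z powi b"
      using z0 z by (simp add: power_int_add power_int_mult)
    have "(- (q powi (15 + 6 * b))) powi r = ((-1) * q powi (15 + 6 * b)) powi r" by simp
    then have 3: "(- (q powi (15 + 6 * b))) powi r = (-1) powi r * (q powi (15 + 6 * b)) powi r"
      by (simp only: power_int_mult_distrib)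
    show ?thesis unfolding theta_term_def minus_minus 1 2 3 by (simp only: mult_ac)
  qed
  have "((\<lambda>(b, r). ?G b r) has_sum theta (- z) q) ({-2..<4} \<times> UNIV)"
  proof (subst has_sum_reindex_bij_witness[where
        i = "\<lambda>n. ((n + 2) mod 6 - 2, (n + 2) div 6)" and j = "\<lambda>(b, r). 6 * r + b"
        and T = UNIV and h = "theta_term (- z) q" and s' = "theta (- z) q"])
    fix x :: "int \<times> int" assume x: "x \<in> {-2..<4} \<times> UNIV"
    obtain b r where x': "x = (b, r)" by (cases x)
    have "(b + 2 + 6 * r) mod 6 = b + 2" "(b + 2 + 6 * r) div 6 = r" using x by (auto simp: x')
    moreover have "6 * r + b + 2 = b + 2 + 6 * r" by simp
    ultimately show "(((case x of (b, r) \<Rightarrow> 6 * r + b) + 2) mod 6 - 2, ((case x of (b, r) \<Rightarrow> 6 * r + b) + 2) div 6) = x"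
      by (simp only: x' prod.case) simp
    show "theta_term (- z) q (case x of (b, r) \<Rightarrow> 6 * r + b) = (case x of (b, r) \<Rightarrow> ?G b r)"
      unfolding x' prod.case by (rule eq)
  next
    fix n :: int
    show "(case ((n + 2) mod 6 - 2, (n + 2) div 6) of (b, r) \<Rightarrow> 6 * r + b) = n"
      unfolding prod.case using mult_div_mod_eq[of 6 "n + 2"] by linarith
    have "0 \<le> (n + 2) mod 6" "(n + 2) mod 6 < 6" by simp_all
    then show "((n + 2) mod 6 - 2, (n + 2) div 6) \<in> {-2..<4} \<times> UNIV" by simp
    show "(theta_term (- z) q has_sum theta (- z) q) UNIV"
      by (rule theta_has_sum[OF q]) (use z0 in simp)
  qed auto
  then show ?thesis
  proof (rule has_sum_residues)
    fix b :: int
    show "(?G b has_sum z powi b * q powi tri b * theta (q powi (15 + 6 * b)) (q ^ 36)) UNIV"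
      using q n36 by (intro has_sum_cmult_right theta_has_sum) auto
  qed
qed

text \<open>The quintuple product with base \<open>q ^ 12\<close> at \<open>z = - (q ^ a)\<close>.
  Negative arguments are removed by multiplying with the corresponding positive ones, as
  \<open>(x; p)_inf (-x; p)_inf = (x^2; p^2)_inf\<close>.\<close>

lemma quintuple_product_12:
  assumes q: "norm q < 1" "q \<noteq> 0" and a: "0 < a" "a < 6"
  shows "(theta (q ^ (12 + 3 * a)) (q ^ 36) + q ^ a * theta (q ^ (24 + 3 * a)) (q ^ 36)) *
      (qpoch_inf (q ^ a) (q ^ 12) * qpoch_inf (q ^ (12 - a)) (q ^ 12)) =
    qpoch_inf (q ^ 12) (q ^ 12) * (qpoch_inf (q ^ (2 * a)) (q ^ 12) * qpoch_inf (q ^ (12 - 2 * a)) (q ^ 12))"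
proof -
  have nq: "norm (q ^ n) < 1" if "n > 0" for n using norm_power_less_1[OF q(1) that] .
  have lt: "norm (q ^ m) < norm (q ^ n)" if "n < m" for n m
    using q that by (simp add: norm_power power_strict_decreasing)
  have dv: "q ^ m / q ^ n = q ^ (m - n)" if "n \<le> m" for m n using q(2) that by (simp add: power_diff)
  have Q2: "(q ^ 12)\<^sup>2 = q ^ 24" "(q ^ 12) ^ 3 = q ^ 36" by (simp_all flip: power_mult)
  have z2: "q ^ 12 * (- (q ^ a))\<^sup>2 = q ^ (12 + 2 * a)" by (simp add: power_add power_mult mult.commute[of 2 a])
  have zc: "- (q ^ 12 * (- (q ^ a)) ^ 3) = q ^ (12 + 3 * a)" "- (q ^ 24 * (- (q ^ a)) ^ 3) = q ^ (24 + 3 * a)"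
    by (simp_all add: power_add power_mult mult.commute[of 3 a] power3_eq_cube)
  define L where "L = theta (q ^ (12 + 3 * a)) (q ^ 36) + q ^ a * theta (q ^ (24 + 3 * a)) (q ^ 36)"
  have m1: "theta (- (q ^ a)) (q ^ 12) * theta (q ^ (12 + 2 * a)) (q ^ 24) = qpoch_inf (q ^ 24) (q ^ 24) * L"
    using quintuple_product[OF nq[of 12], of "- (q ^ a)"] q(2) unfolding Q2 z2 zc L_def by simp
  have m2: "theta (- (q ^ a)) (q ^ 12) = qpoch_inf (- (q ^ a)) (q ^ 12) * qpoch_inf (- (q ^ (12 - a))) (q ^ 12) *
      qpoch_inf (q ^ 12) (q ^ 12)"
    using jacobi_triple_product[OF nq[of 12], of "- (q ^ a)"] lt[of a 12] a q(2) dv[of a 12] by simp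
  have m3: "theta (q ^ (12 + 2 * a)) (q ^ 24) = qpoch_inf (q ^ (12 + 2 * a)) (q ^ 24) *
      qpoch_inf (q ^ (12 - 2 * a)) (q ^ 24) * qpoch_inf (q ^ 24) (q ^ 24)"
  proof -
    have "q ^ 24 / q ^ (12 + 2 * a) = q ^ (12 - 2 * a)" using dv[of "12 + 2 * a" 24] a by simp
    then show ?thesis
      using jacobi_triple_product[OF nq[of 24] _ lt[of "12 + 2 * a" 24]] a q(2) by simp
  qed
  have m4: "qpoch_inf (q ^ 24) (q ^ 24) \<noteq> 0" by (intro qpoch_inf_nonzero nq) auto
  have "qpoch_inf (q ^ 24) (q ^ 24) * L = qpoch_inf (q ^ 24) (q ^ 24) *
      (qpoch_inf (- (q ^ a)) (q ^ 12) * qpoch_inf (- (q ^ (12 - a))) (q ^ 12) * qpoch_inf (q ^ 12) (q ^ 12) *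
        (qpoch_inf (q ^ (12 + 2 * a)) (q ^ 24) * qpoch_inf (q ^ (12 - 2 * a)) (q ^ 24)))"
    unfolding m1[symmetric] m2 m3 by (simp only: mult_ac)
  then have L: "L = qpoch_inf (- (q ^ a)) (q ^ 12) * qpoch_inf (- (q ^ (12 - a))) (q ^ 12) * qpoch_inf (q ^ 12) (q ^ 12) *
      (qpoch_inf (q ^ (12 + 2 * a)) (q ^ 24) * qpoch_inf (q ^ (12 - 2 * a)) (q ^ 24))"
    by (rule mult_left_cancel[OF m4, THEN iffD1])
  have neg: "qpoch_inf (q ^ n) (q ^ 12) * qpoch_inf (- (q ^ n)) (q ^ 12) = qpoch_inf (q ^ (2 * n)) (q ^ 24)" for n
    using qpoch_inf_mult_neg[OF nq[of 12], of "q ^ n"] unfolding Q2 by (simp add: power_mult[symmetric] mult.commute[of 2 n])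
  have two: "qpoch_inf (q ^ n) (q ^ 12) = qpoch_inf (q ^ n) (q ^ 24) * qpoch_inf (q ^ (12 + n)) (q ^ 24)" for n
    using qpoch_inf_dissect_power[OF q(1), of 12 2 n] unfolding prod_lessThan_small by (simp add: add.commute)
  have "2 * (12 - a) = 12 + (12 - 2 * a)" using a by simp
  then have n2: "qpoch_inf (q ^ (12 - a)) (q ^ 12) * qpoch_inf (- (q ^ (12 - a))) (q ^ 12) =
      qpoch_inf (q ^ (12 + (12 - 2 * a))) (q ^ 24)"
    using neg[of "12 - a"] by (simp only:)
  have "L * (qpoch_inf (q ^ a) (q ^ 12) * qpoch_inf (q ^ (12 - a)) (q ^ 12)) =
      qpoch_inf (q ^ 12) (q ^ 12) * ((qpoch_inf (q ^ a) (q ^ 12) * qpoch_inf (- (q ^ a)) (q ^ 12)) *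
        qpoch_inf (q ^ (12 + 2 * a)) (q ^ 24) *
        (qpoch_inf (q ^ (12 - 2 * a)) (q ^ 24) * (qpoch_inf (q ^ (12 - a)) (q ^ 12) * qpoch_inf (- (q ^ (12 - a))) (q ^ 12))))"
    unfolding L by (simp only: mult_ac)
  also have "\<dots> = qpoch_inf (q ^ 12) (q ^ 12) * (qpoch_inf (q ^ (2 * a)) (q ^ 12) * qpoch_inf (q ^ (12 - 2 * a)) (q ^ 12))"
    unfolding n2 neg[of a] two[symmetric] ..
  finally show ?thesis unfolding L_def .
qed

text \<open>By the triple product \<open>theta z p\<close> is symmetric under exchanging
  \<open>z\<close> with \<open>p / z\<close>; the last equation also uses one shift by
  \<open>p = q ^ 36\<close>.\<close>

lemma theta_36:
  assumes q: "norm q < 1" "q \<noteq> 0"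
  shows "theta (q ^ 21) (q ^ 36) = theta (q ^ 15) (q ^ 36)" "theta (q ^ 9) (q ^ 36) = theta (q ^ 27) (q ^ 36)"
    "theta (q ^ 3) (q ^ 36) = theta (q ^ 33) (q ^ 36)" "q ^ 3 * theta (q ^ 39) (q ^ 36) = - theta (q ^ 33) (q ^ 36)"
proof -
  have n36: "norm (q ^ 36) < 1" using norm_power_less_1[OF q(1), of 36] by simp
  have lt: "norm (q ^ 36) < norm (q ^ n)" if "n < 36" for n
    using q that by (simp add: norm_power power_strict_decreasing)
  have J: "theta (q ^ n) (q ^ 36) = qpoch_inf (q ^ n) (q ^ 36) * qpoch_inf (q ^ (36 - n)) (q ^ 36) * qpoch_inf (q ^ 36) (q ^ 36)"
    if "n < 36" for n
  proof -
    have "q ^ 36 / q ^ n = q ^ (36 - n)" using q(2) that by (simp add: power_diff)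
    then show ?thesis using jacobi_triple_product[OF n36 _ lt[OF that]] q(2) by simp
  qed
  show "theta (q ^ 21) (q ^ 36) = theta (q ^ 15) (q ^ 36)" "theta (q ^ 9) (q ^ 36) = theta (q ^ 27) (q ^ 36)"
    and 3: "theta (q ^ 3) (q ^ 36) = theta (q ^ 33) (q ^ 36)"
    by (simp_all add: J)
  have "q ^ 36 * q ^ 3 = q ^ 39" by (simp flip: power_add)
  then have "theta (q ^ 39) (q ^ 36) = - (theta (q ^ 3) (q ^ 36) / q ^ 3)"
    using theta_shift[OF n36, of "q ^ 3"] q(2) by simp
  then show "q ^ 3 * theta (q ^ 39) (q ^ 36) = - theta (q ^ 33) (q ^ 36)" using q(2) 3 by simp
qed

section \<open>The sums \<open>H\<^sub>1\<close>, \<open>H\<^sub>2\<close> and \<open>H\<^sub>3\<close>\<close>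

text \<open>The assumptions force \<open>z ^ 6 = -1\<close>, so the six-term dissection applies.
  After pairing equal theta values the factor \<open>1 + z\<close>, which separates
  \<open>theta (- z) q\<close> from the product on the left, can be cancelled.\<close>

lemma theta_twelfth_root:
  assumes q: "norm q < 1" "q \<noteq> 0" and z: "z * w = 1" "(z + w)\<^sup>2 = 3"
  shows "qpoch_inf q q * (qpoch_inf (- (z * q)) q * qpoch_inf (- (w * q)) q) =
    theta (q ^ 15) (q ^ 36) + (z + w - 1) * (q * theta (q ^ 27) (q ^ 36)) +
    (2 - (z + w)) * (q ^ 3 * theta (q ^ 33) (q ^ 36))"
proof -
  have z6: "z ^ 6 = -1" using z by algebra
  have z0: "z \<noteq> 0" using z(1) by auto
  have zw: "w = inverse z" using z(1) by (simp add: inverse_unique)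
  have "norm z ^ 6 = 1" using arg_cong[OF z6, of norm] by (simp add: norm_power)
  then have nz: "norm z = 1" using power_eq_1_iff[of "norm z" 6] by simp
  have z1: "1 + z \<noteq> 0"
  proof
    assume "1 + z = 0"
    then have "z = -1" by (simp add: add_eq_0_iff)
    with z6 show False by simp
  qed
  have "theta (- z) q = qpoch_inf (- z) q * qpoch_inf (- (w * q)) q * qpoch_inf q q"
    using jacobi_triple_product[OF q, of "- z"] q(1) by (simp add: nz zw divide_inverse mult.commute)
  also have "qpoch_inf (- z) q = (1 + z) * qpoch_inf (- (z * q)) q"
    using qpoch_inf_Suc[OF q(1), of "- z"] by simp
  finally have 1: "theta (- z) q = (1 + z) * (qpoch_inf q q * (qpoch_inf (- (z * q)) q * qpoch_inf (- (w * q)) q))"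
    by (simp only: mult_ac)
  let ?T1 = "theta (q ^ 15) (q ^ 36)" and ?T2 = "theta (q ^ 27) (q ^ 36)" and ?T3 = "theta (q ^ 33) (q ^ 36)"
  have "{-2..<4} = {-2, -1, 0, 1, 2, 3 :: int}" by auto
  then have "theta (- z) q = w\<^sup>2 * (q ^ 3 * theta (q ^ 3) (q ^ 36)) + w * (q * theta (q ^ 9) (q ^ 36)) + ?T1 +
      z * theta (q ^ 21) (q ^ 36) + z\<^sup>2 * (q * ?T2) + z ^ 3 * (q ^ 3 * ?T3)"
    unfolding theta_six_dissection[OF q z6]
    by (simp add: tri_def power_int_minus zw power_inverse mult.assoc)
  then have 2: "theta (- z) q = w\<^sup>2 * (q ^ 3 * ?T3) + w * (q * ?T2) + ?T1 + z * ?T1 + z\<^sup>2 * (q * ?T2) + z ^ 3 * (q ^ 3 * ?T3)"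
    unfolding theta_36[OF q] .
  \<comment> \<open>The coefficients factor as
    \<open>w + z^2 = w (1 + z^3) = (1 + z) (z + w - 1)\<close> and
    \<open>w^2 + z^3 = w^2 (1 + z^5) = (1 + z) (2 - (z + w))\<close>, the latter by
    \<open>z^2 + w^2 = 1\<close>.\<close>
  have "(1 + z) * X = w\<^sup>2 * t3 + w * t2 + t1 + z * t1 + z\<^sup>2 * t2 + z ^ 3 * t3 \<Longrightarrow>
      (1 + z) * X = (1 + z) * (t1 + (z + w - 1) * t2 + (2 - (z + w)) * t3)" for X t1 t2 t3
    using z by algebra
  from this[OF 2[unfolded 1]] show ?thesis using z1 by simp
qed

lemma sums_even_odd:
  fixes f :: "nat \<Rightarrow> complex"
  assumes "f sums a" "(\<lambda>n. (-1) ^ n * f n) sums b"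
  shows "(\<lambda>n. f (2 * n)) sums ((a + b) / 2)" "(\<lambda>n. f (2 * n + 1)) sums ((a - b) / 2)"
proof -
  have m: "strict_mono (\<lambda>n::nat. 2 * n)" "strict_mono (\<lambda>n::nat. 2 * n + 1)" by (simp_all add: strict_mono_def)
  define e where "e = (\<lambda>n. (f n + (-1) ^ n * f n) / 2)"
  define d where "d = (\<lambda>n. (f n - (-1) ^ n * f n) / 2)"
  have e0: "e n = 0" if "n \<notin> range (\<lambda>n::nat. 2 * n)" for n
  proof -
    have "odd n" using that by (metis evenE rangeI)
    then show ?thesis by (simp add: e_def)
  qed
  have d0: "d n = 0" if "n \<notin> range (\<lambda>n::nat. 2 * n + 1)" for n
  proof -
    have "even n" using that by (metis oddE rangeI)
    then show ?thesis by (simp add: d_def)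
  qed
  have "e sums ((a + b) / 2)" unfolding e_def by (intro sums_divide sums_add assms)
  then have "(\<lambda>n. e (2 * n)) sums ((a + b) / 2)" by (subst sums_mono_reindex[where f = e, OF m(1)]) (use e0 in simp_all)
  then show "(\<lambda>n. f (2 * n)) sums ((a + b) / 2)" by (simp add: e_def)
  have "d sums ((a - b) / 2)" unfolding d_def by (intro sums_divide sums_diff assms)
  then have "(\<lambda>n. d (2 * n + 1)) sums ((a - b) / 2)" by (subst sums_mono_reindex[where f = d, OF m(2)]) (use d0 in simp_all)
  then show "(\<lambda>n. f (2 * n + 1)) sums ((a - b) / 2)" by (simp add: d_def)
qed

text \<open>The coefficients of the product of four Euler series below are, up to an explicit factor, the odd
  coefficients of \<open>\<Prod>(1 + c q\<^sup>n X + q\<^sup>2\<^sup>n X\<^sup>2)\<close> with \<open>c\<^sup>2 = 3\<close>.\<close>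

lemma quad_sum_H2_H3:
  assumes q: "norm q < 1" "q \<noteq> 0" and z: "z * w = 1" and c: "z + w = c" "c\<^sup>2 = 3"
  defines "G \<equiv> fps_euler1 (Suc 0) q (q\<^sup>2) * fps_euler1 2 (q ^ 4) (q\<^sup>2) * fps_euler2 3 (q ^ 6) (q ^ 9)"
    and "pp \<equiv> qpoch_inf (- (z * q)) q * qpoch_inf (- (w * q)) q"
    and "pm \<equiv> qpoch_inf (z * q) q * qpoch_inf (w * q) q"
  shows "c * q * quad_sum (q\<^sup>2) (fps_scale (q\<^sup>2) G) = qpoch_inf q (q\<^sup>2) * ((pp - pm) / 2)"
    "c * quad_sum (q\<^sup>2) G = qpoch_inf q (q\<^sup>2) * (c * ((pp + pm) / 2) + (pp - pm) / 2)"
proof -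
  define p where "p = q\<^sup>2"
  have c0: "c \<noteq> 0" using c(2) by auto
  have np: "norm p < 1" unfolding p_def using norm_power_less_1[OF q(1), of 2] by simp
  have p0: "p \<noteq> 0" using q(2) by (simp add: p_def)
  have nq: "norm (q ^ n) < 1" if "n > 0" for n using norm_power_less_1[OF q(1) that] .
  define e1 where "e1 = fps_euler1 (Suc 0) q (q\<^sup>2)"
  define e2 where "e2 = fps_euler1 2 (q ^ 4) (q\<^sup>2)"
  define e3 where "e3 = fps_euler2 3 (q ^ 6) (q ^ 9)"
  \<comment> \<open>The factor \<open>(-q z; p)_inf\<close> cancels one half of
    \<open>1 - q^2 z^2 = (1 - q z) (1 + q z)\<close>, which leaves
    \<open>(1 - q z) (1 - q^2 z) g(z) = (1 + q^3 z + q^6 z^2) g(p z)\<close>.\<close>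
  define e4 where "e4 = fps_euler2 (Suc 0) p (- q)"
  define g where "g = G * e4"
  have G: "G = e1 * e2 * e3" by (simp add: G_def e1_def e2_def e3_def)
  have geo: "geo_bounded G" "geo_bounded g" unfolding g_def G e1_def e2_def e3_def e4_def
    by (intro geo_bounded_mult geo_bounded_euler1 geo_bounded_euler2 q np nq; simp)+
  let ?q = "fps_const q"
  have F1: "fps_scale q e1 = (1 - ?q\<^sup>2 * fps_X) * e1"
    using fps_euler1_eq[OF q(1), of "Suc 0" q "q\<^sup>2"] by (simp add: e1_def)
  have "fps_scale p e1 = fps_scale q (fps_scale q e1)" by (simp add: p_def power2_eq_square)
  also have "\<dots> = (1 - ?q\<^sup>2 * (?q * fps_X)) * ((1 - ?q\<^sup>2 * fps_X) * e1)"
    unfolding F1 fps_scale_mult by (simp flip: fps_const_power)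
  finally have E1: "fps_scale p e1 = (1 - ?q ^ 3 * fps_X) * ((1 - ?q\<^sup>2 * fps_X) * e1)"
    by (simp add: power2_eq_square power3_eq_cube mult.assoc)
  have E2: "fps_scale p e2 = (1 - ?q\<^sup>2 * fps_X\<^sup>2) * e2"
    using fps_euler1_eq[of "q ^ 4" 2 p "q\<^sup>2"] nq[of 4] by (simp add: e2_def p_def flip: power_mult)
  have E3: "e3 = (1 - ?q ^ 9 * fps_X ^ 3) * fps_scale p e3"
    using fps_euler2_eq[of "q ^ 6" 3 p "q ^ 9"] nq[of 6] by (simp add: e3_def p_def flip: power_mult)
  have E4: "e4 = (1 + ?q * fps_X) * fps_scale p e4"
    using fps_euler2_eq[OF np, of "Suc 0" p "- q"] by (simp add: e4_def flip: fps_const_neg)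
  have "(1 - ?q * fps_X) * (1 - ?q\<^sup>2 * fps_X) * g =
      (1 - ?q * fps_X) * (1 - ?q\<^sup>2 * fps_X) * e1 * e2 * ((1 - ?q ^ 9 * fps_X ^ 3) * fps_scale p e3) *
      ((1 + ?q * fps_X) * fps_scale p e4)"
    unfolding g_def G E3[symmetric] E4[symmetric] by (simp only: mult_ac)
  also have "\<dots> = (1 + ?q ^ 3 * fps_X + ?q ^ 6 * fps_X\<^sup>2) * fps_scale p g"
    unfolding g_def G fps_scale_mult E1 E2 by algebra
  finally have "g - fps_const (q + q\<^sup>2) * (fps_X * g) + fps_const (q ^ 3) * (fps_X\<^sup>2 * g) =
      fps_scale p g + fps_const (q ^ 3) * (fps_X * fps_scale p g) + fps_const (q ^ 6) * (fps_X\<^sup>2 * fps_scale p g)"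
    unfolding fps_const_power[symmetric] fps_const_add[symmetric] by algebra
  note g_eq = arg_cong[OF this, of "\<lambda>f. f $ _"]
  have g0: "g $ 0 = 1" by (simp add: g_def G e1_def e2_def e3_def e4_def)
  have g1: "(1 - p) * g $ Suc 0 = q + q\<^sup>2 + q ^ 3"
    using g_eq[of "Suc 0"] by (simp add: g0 algebra_simps)
  have g2: "(1 - p * (p * p ^ n)) * g $ Suc (Suc n) =
      (q + q\<^sup>2 + q ^ 3 * (p * p ^ n)) * g $ Suc n + (q ^ 6 * p ^ n - q ^ 3) * g $ n" for n
  proof -
    have "g $ Suc (Suc n) - (q + q\<^sup>2) * g $ Suc n + q ^ 3 * g $ n =
        p * (p * p ^ n) * g $ Suc (Suc n) + q ^ 3 * (p * p ^ n * g $ Suc n) + q ^ 6 * (p ^ n * g $ n)"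
      using g_eq[of "Suc (Suc n)"] by simp
    then show ?thesis by (simp add: algebra_simps)
  qed

  define f where "f = fps_euler2 (Suc 0) q (- (z * q)) * fps_euler2 (Suc 0) q (- (w * q))"
  have f0: "f $ 0 = 1" by (simp add: f_def)
  have f_eq: "f = (1 + fps_const (c * q) * fps_X + fps_const (q\<^sup>2) * fps_X\<^sup>2) * fps_scale q f"
  proof -
    define f1 where "f1 = fps_euler2 (Suc 0) q (- (z * q))"
    define f2 where "f2 = fps_euler2 (Suc 0) q (- (w * q))"
    have 1: "f1 = (1 + fps_const (z * q) * fps_X) * fps_scale q f1" "f2 = (1 + fps_const (w * q) * fps_X) * fps_scale q f2"
      using fps_euler2_eq[OF q(1), of "Suc 0" q "- (z * q)"] fps_euler2_eq[OF q(1), of "Suc 0" q "- (w * q)"]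
      by (simp_all add: f1_def f2_def flip: fps_const_neg)
    have "c * q = z * q + w * q" by (simp add: c(1)[symmetric] distrib_right)
    moreover have "(z * q) * (w * q) = (z * w) * q\<^sup>2" by (simp only: power2_eq_square mult_ac)
    ultimately have 2: "fps_const (c * q) = fps_const (z * q) + fps_const (w * q)"
      "fps_const (q\<^sup>2) = fps_const (z * q) * fps_const (w * q)" using z by simp_all
    have "f1 * f2 = ((1 + fps_const (z * q) * fps_X) * fps_scale q f1) * ((1 + fps_const (w * q) * fps_X) * fps_scale q f2)"
      unfolding 1[symmetric] ..
    also have "\<dots> = (1 + fps_const (c * q) * fps_X + fps_const (q\<^sup>2) * fps_X\<^sup>2) * fps_scale q (f1 * f2)"
      unfolding 2 fps_scale_mult by algebra
    finally show ?thesis by (simp only: f_def f1_def f2_def)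
  qed
  then have "f = fps_scale q f + fps_const (c * q) * (fps_X * fps_scale q f) + fps_const (q\<^sup>2) * (fps_X\<^sup>2 * fps_scale q f)"
    by (simp only: distrib_right mult_1_left mult.assoc)
  note f_nth = arg_cong[OF this, of "\<lambda>f. f $ _"]
  have f1: "(1 - q) * f $ Suc 0 = c * q" using f_nth[of "Suc 0"] by (simp add: f0 algebra_simps)
  have f2: "(1 - q * (q * q ^ n)) * f $ Suc (Suc n) = q * (q * q ^ n) * (c * f $ Suc n + f $ n)" for n
    using f_nth[of "Suc (Suc n)"] by (simp add: algebra_simps power2_eq_square)

  have qn: "1 - q * q ^ n \<noteq> 0" for n using power_neq_1[OF q(1), of "Suc n"] by simp
  have odd3: "(1 - p) * (1 - q * p) * f $ 3 = q * p * ((1 + q + p) * f $ 1)"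
    using f2[of 1] f2[of 0] f1 f0 c(2) unfolding p_def by (simp add: eval_nat_numeral) algebra
  \<comment> \<open>Eliminating \<open>v2\<close> and \<open>v4\<close> gives \<open>v3\<close> the
    coefficient \<open>1 + q + (c^2 - 2) q^4 x\<close>; the value \<open>c^2 = 3\<close> makes it
    agree with the recurrence \<open>g2\<close>.\<close>
  have aux_f: "(1 - q ^ 4 * x) * (1 - q ^ 5 * x) * v5 = q ^ 5 * x * ((1 + q + q ^ 4 * x) * v3 - q ^ 4 * x * v1)"
    if "(1 - q ^ 3 * x) * v3 = q ^ 3 * x * (c * v2 + v1)" "(1 - q ^ 4 * x) * v4 = q ^ 4 * x * (c * v3 + v2)"
      "(1 - q ^ 5 * x) * v5 = q ^ 5 * x * (c * v4 + v3)" for x v1 v2 v3 v4 v5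
  proof -
    have "q ^ 4 * x * (c * v2) = q * ((1 - q ^ 3 * x) * v3) - q ^ 4 * x * v1"
      unfolding that(1) by algebra
    moreover have "(1 - q ^ 4 * x) * ((1 - q ^ 5 * x) * v5) =
        q ^ 5 * x * (c * (q ^ 4 * x * (c * v3 + v2)) + (1 - q ^ 4 * x) * v3)"
      unfolding that(2)[symmetric] that(3) by algebra
    ultimately show ?thesis using c(2) by algebra
  qed
  have px: "p ^ n = q ^ (2 * n)" for n by (simp add: p_def power_mult)
  have odd5: "(1 - q ^ 4 * p ^ n) * (1 - q ^ 5 * p ^ n) * f $ (2 * n + 5) =
      q ^ 5 * p ^ n * ((1 + q + q ^ 4 * p ^ n) * f $ (2 * n + 3) - q ^ 4 * p ^ n * f $ (2 * n + 1))" for n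
  proof (rule aux_f)
    show "(1 - q ^ 3 * p ^ n) * f $ (2 * n + 3) = q ^ 3 * p ^ n * (c * f $ (2 * n + 2) + f $ (2 * n + 1))"
      using f2[of "2 * n + 1"] unfolding px by (simp add: eval_nat_numeral mult.assoc)
    show "(1 - q ^ 4 * p ^ n) * f $ (2 * n + 4) = q ^ 4 * p ^ n * (c * f $ (2 * n + 3) + f $ (2 * n + 2))"
      using f2[of "2 * n + 2"] unfolding px by (simp add: eval_nat_numeral mult.assoc)
    show "(1 - q ^ 5 * p ^ n) * f $ (2 * n + 5) = q ^ 5 * p ^ n * (c * f $ (2 * n + 4) + f $ (2 * n + 3))"
      using f2[of "2 * n + 3"] unfolding px by (simp add: eval_nat_numeral mult.assoc)
  qed
  define K where "K = (\<lambda>n. p ^ (n choose 2) * p ^ n)"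
  have KS: "K (Suc n) = K n * (p * p ^ n)" for n by (simp add: K_def choose_two_Suc power_add)
  have QS: "qpoch q p (Suc (Suc n)) = qpoch q p (Suc n) * (1 - q * (p * p ^ n))" for n
    by (simp add: qpoch_Suc)
  have pn: "1 - p * p ^ n \<noteq> 0" for n using power_neq_1[OF np, of "Suc n"] by simp
  have aux_g: "c * q * (k * v * (p * v) * a2) = Q * (1 - q * v) * (1 - q * (p * v)) * y5"
    if "1 - p * v \<noteq> 0" "c * q * (k * a0) = Q * y1" "c * q * (k * v * a1) = Q * (1 - q * v) * y3"
      "(1 - p * v) * a2 = (q + q\<^sup>2 + q ^ 3 * v) * a1 + (q ^ 4 * v - q ^ 3) * a0"
      "(1 - q\<^sup>2 * v) * (1 - q ^ 3 * v) * y5 = q ^ 3 * v * ((1 + q + q\<^sup>2 * v) * y3 - q\<^sup>2 * v * y1)"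
    for v k Q a0 a1 a2 y1 y3 y5
  proof -
    have "(1 - p * v) * (c * q * (k * v * (p * v) * a2)) = c * q * k * v * (p * v) * ((1 - p * v) * a2)" by algebra
    also have "\<dots> = p * v * ((q + q\<^sup>2 + q ^ 3 * v) * (c * q * (k * v * a1)) + v * (q ^ 4 * v - q ^ 3) * (c * q * (k * a0)))"
      unfolding that(4) by algebra
    also have "\<dots> = Q * (1 - q * v) * (q ^ 3 * v * ((1 + q + q\<^sup>2 * v) * y3 - q\<^sup>2 * v * y1))"
      unfolding that(2,3) p_def by algebra
    also have "\<dots> = (1 - p * v) * (Q * (1 - q * v) * (1 - q * (p * v)) * y5)"
      unfolding that(5)[symmetric] p_def by algebra
    finally show ?thesis using that(1) by simp
  qed
  \<comment> \<open>Both sequences obey recurrences of order two, so two consecutive instances are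
    carried through the induction.\<close>
  have claim: "c * q * (K n * g $ n) = qpoch q p (Suc n) * f $ (2 * n + 1) \<and>
      c * q * (K (Suc n) * g $ Suc n) = qpoch q p (Suc (Suc n)) * f $ (2 * n + 3)" for n
  proof (induction n)
    case 0
    have "c * q * (p * g $ Suc 0) = (1 - q) * (1 - q * p) * f $ 3"
    proof -
      have "(1 - p) * (c * q * (p * g $ Suc 0)) = c * q * p * ((1 - p) * g $ Suc 0)" by (simp only: mult_ac)
      also have "\<dots> = c * q * p * (q + q\<^sup>2 + q ^ 3)" unfolding g1 ..
      also have "\<dots> = q * p * (1 + q + p) * ((1 - q) * f $ Suc 0)" unfolding f1 p_def by algebra
      also have "\<dots> = (1 - q) * (q * p * ((1 + q + p) * f $ 1))" by (simp only: One_nat_def mult_ac)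
      also have "\<dots> = (1 - p) * ((1 - q) * (1 - q * p) * f $ 3)"
        unfolding odd3[symmetric] by (simp only: mult_ac)
      finally show ?thesis using pn[of 0] by simp
    qed
    then show ?case using f1 by (simp add: K_def g0 qpoch_def choose_two_Suc)
  next
    case (Suc n)
    have "c * q * (K n * (p * p ^ n) * (p * (p * p ^ n)) * g $ Suc (Suc n)) =
        qpoch q p (Suc n) * (1 - q * (p * p ^ n)) * (1 - q * (p * (p * p ^ n))) * f $ (2 * n + 5)"
    proof (rule aux_g)
      show "1 - p * (p * p ^ n) \<noteq> 0" using pn[of "Suc n"] by simp
      show "c * q * (K n * g $ n) = qpoch q p (Suc n) * f $ (2 * n + 1)" using Suc.IH by blast
      show "c * q * (K n * (p * p ^ n) * g $ Suc n) = qpoch q p (Suc n) * (1 - q * (p * p ^ n)) * f $ (2 * n + 3)"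
        using Suc.IH unfolding KS QS by blast
      have "q ^ 6 * p ^ n = q ^ 4 * (p * p ^ n)" by (simp add: p_def flip: mult.assoc power_add)
      then show "(1 - p * (p * p ^ n)) * g $ Suc (Suc n) =
          (q + q\<^sup>2 + q ^ 3 * (p * p ^ n)) * g $ Suc n + (q ^ 4 * (p * p ^ n) - q ^ 3) * g $ n"
        using g2[of n] by simp
      have e: "q\<^sup>2 * (p * p ^ n) = q ^ 4 * p ^ n" "q ^ 3 * (p * p ^ n) = q ^ 5 * p ^ n"
        by (simp_all add: p_def flip: mult.assoc power_add)
      show "(1 - q\<^sup>2 * (p * p ^ n)) * (1 - q ^ 3 * (p * p ^ n)) * f $ (2 * n + 5) = q ^ 3 * (p * p ^ n) *
          ((1 + q + q\<^sup>2 * (p * p ^ n)) * f $ (2 * n + 3) - q\<^sup>2 * (p * p ^ n) * f $ (2 * n + 1))"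
        unfolding e by (rule odd5)
    qed
    moreover have "2 * Suc n + 1 = 2 * n + 3" "2 * Suc n + 3 = 2 * n + 5" by simp_all
    ultimately show ?case using Suc.IH by (simp only: KS QS power_Suc simp_thms)
  qed
  have cl: "c * q * (K n * g $ n) = qpoch q p (Suc n) * f $ (2 * n + 1)" for n using claim by blast

  have f_sums: "(\<lambda>n. f $ n) sums pp" unfolding f_def pp_def
    by (intro sums_fps_mult sums_fps_euler2 q) auto
  have "fps_scale (-1) f = fps_euler2 (Suc 0) q (z * q) * fps_euler2 (Suc 0) q (w * q)"
    by (simp add: f_def fps_scale_euler)
  moreover have "(\<lambda>n. (fps_euler2 (Suc 0) q (z * q) * fps_euler2 (Suc 0) q (w * q)) $ n) sums pm" unfolding pm_def
    by (intro sums_fps_mult sums_fps_euler2 q) auto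
  ultimately have "(\<lambda>n. (-1) ^ n * f $ n) sums pm" by (simp flip: fps_scale_nth)
  note eo = sums_even_odd[OF f_sums this]

  have inv: "g * fps_euler1 (Suc 0) p (- q) = G"
    using fps_euler_inverse[OF np, of "- q"] by (simp add: g_def e4_def mult.assoc mult.commute)
  have "fps_scale p G = fps_scale p g * fps_scale p (fps_euler1 (Suc 0) p (- q))"
    unfolding inv[symmetric] by simp
  also have "fps_scale p (fps_euler1 (Suc 0) p (- q)) = fps_euler1 (Suc 0) p (- (q * p))"
    by (simp add: fps_scale_euler)
  finally have "(\<lambda>n. p ^ (n choose 2) * fps_scale p g $ n * qpoch_inf (- (- (q * p) * p ^ n)) p) sums quad_sum p (fps_scale p G)"
    using quad_sum_mult_euler1[OF np geo_bounded_scale[OF geo(2), of p], of "- (q * p)"] by simp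
  from sums_mult[OF this, of "c * q"]
  have "(\<lambda>n. c * q * (p ^ (n choose 2) * fps_scale p g $ n * qpoch_inf (- (- (q * p) * p ^ n)) p)) sums
      (c * q * quad_sum p (fps_scale p G))" .
  moreover have "c * q * (p ^ (n choose 2) * fps_scale p g $ n * qpoch_inf (- (- (q * p) * p ^ n)) p) =
      qpoch_inf q p * f $ (2 * n + 1)" for n
  proof -
    have 1: "qpoch_inf q p = qpoch q p (Suc n) * qpoch_inf (- (- (q * p) * p ^ n)) p"
      using qpoch_inf_split[OF np, of q "Suc n"] by (simp add: mult.assoc)
    have "c * q * (p ^ (n choose 2) * fps_scale p g $ n * y) = (c * q * (K n * g $ n)) * y" for y
      by (simp add: K_def)
    also have "(c * q * (K n * g $ n)) * y = qpoch q p (Suc n) * f $ (2 * n + 1) * y" for y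
      unfolding cl ..
    finally have 2: "c * q * (p ^ (n choose 2) * fps_scale p g $ n * y) = qpoch q p (Suc n) * f $ (2 * n + 1) * y" for y .
    show ?thesis unfolding 2 unfolding 1 by (simp only: mult_ac)
  qed
  ultimately have "(\<lambda>n. qpoch_inf q p * f $ (2 * n + 1)) sums (c * q * quad_sum p (fps_scale p G))" by (simp only:)
  from sums_unique2[OF this sums_mult[OF eo(2)]]
  show "c * q * quad_sum (q\<^sup>2) (fps_scale (q\<^sup>2) G) = qpoch_inf q (q\<^sup>2) * ((pp - pm) / 2)" unfolding p_def .

  \<comment> \<open>The odd coefficients moved by one place, with 0 for the index -1, so that the
    relation \<open>fh\<close> between neighbouring coefficients also covers \<open>n = 0\<close>.
    The move does not change the sum.\<close>
  define h where "h = (\<lambda>n. if n = 0 then 0 else f $ (2 * n - 1))"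
  have "(\<lambda>n. h (Suc n)) sums ((pp - pm) / 2)" using eo(2) by (simp add: h_def)
  then have h: "h sums ((pp - pm) / 2)" using sums_Suc[of h] by (simp add: h_def)
  have fh: "(1 - q * p ^ n) * f $ (2 * n + 1) = q * p ^ n * (c * f $ (2 * n) + h n)" for n
  proof (cases n)
    case (Suc m)
    then show ?thesis using f2[of "2 * m + 1"] unfolding px by (simp add: h_def mult.assoc)
  qed (use f1 in \<open>simp add: h_def f0\<close>)
  have "(\<lambda>n. c * (p ^ (n choose 2) * g $ n * qpoch_inf (- (- q * p ^ n)) p)) sums (c * quad_sum p G)"
    using sums_mult[OF quad_sum_mult_euler1[OF np geo(2), of "- q"], of c] unfolding inv by simp
  moreover have "c * (p ^ (n choose 2) * g $ n * qpoch_inf (- (- q * p ^ n)) p) =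
      qpoch_inf q p * (c * f $ (2 * n) + h n)" for n
  proof -
    have 1: "qpoch_inf q p = qpoch q p n * qpoch_inf (- (- q * p ^ n)) p"
      using qpoch_inf_split[OF np, of q n] by simp
    have "q * p ^ n * (c * (p ^ (n choose 2) * g $ n * qpoch_inf (- (- q * p ^ n)) p)) =
        (c * q * (K n * g $ n)) * qpoch_inf (- (- q * p ^ n)) p" by (simp only: K_def mult_ac)
    also have "\<dots> = qpoch_inf q p * ((1 - q * p ^ n) * f $ (2 * n + 1))"
      unfolding cl qpoch_Suc 1 by (simp only: mult_ac)
    also have "\<dots> = q * p ^ n * (qpoch_inf q p * (c * f $ (2 * n) + h n))"
      unfolding fh by (simp only: mult_ac)
    finally show ?thesis using q(2) p0 by simp
  qed
  ultimately have "(\<lambda>n. qpoch_inf q p * (c * f $ (2 * n) + h n)) sums (c * quad_sum p G)" by (simp only:)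
  from sums_unique2[OF this sums_mult[OF sums_add[OF sums_mult[OF eo(1)] h]]]
  show "c * quad_sum (q\<^sup>2) G = qpoch_inf q (q\<^sup>2) * (c * ((pp + pm) / 2) + (pp - pm) / 2)" unfolding p_def .
qed

text \<open>The quotient of the two products of Euler series is
  \<open>(1 - q^2 z^2) / (1 - q z) = 1 + q z\<close>. Under the weight
  \<open>p ^ (n choose 2)\<close> a factor \<open>z\<close> acts as the scaling by \<open>p\<close>,
  because \<open>Suc n choose 2 = (n choose 2) + n\<close>.\<close>

lemma quad_sum_H1:
  assumes q: "norm q < 1"
  defines "G \<equiv> fps_euler1 (Suc 0) q (q\<^sup>2) * fps_euler1 2 (q ^ 4) (q\<^sup>2) * fps_euler2 3 (q ^ 6) (q ^ 9)"
  shows "quad_sum (q\<^sup>2) (fps_euler1 (Suc 0) q q * fps_euler1 2 (q ^ 4) (q ^ 6) * fps_euler2 3 (q ^ 6) (q ^ 9)) =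
    quad_sum (q\<^sup>2) G + q * quad_sum (q\<^sup>2) (fps_scale (q\<^sup>2) G)"
proof -
  define p where "p = q\<^sup>2"
  have np: "norm p < 1" unfolding p_def using norm_power_less_1[OF q, of 2] by simp
  have nq: "norm (q ^ n) < 1" if "n > 0" for n using norm_power_less_1[OF q that] .
  have geo: "geo_bounded G" unfolding G_def
    by (intro geo_bounded_mult geo_bounded_euler1 geo_bounded_euler2 q nq) simp_all
  define e3 where "e3 = fps_euler2 3 (q ^ 6) (q ^ 9)"
  define e2 where "e2 = fps_euler1 2 (q ^ 4) (q\<^sup>2)"
  define e1 where "e1 = fps_euler1 (Suc 0) q q"
  define G1 where "G1 = e1 * fps_euler1 2 (q ^ 4) (q ^ 6) * e3"
  have 1: "fps_euler1 (Suc 0) q (q\<^sup>2) = (1 - fps_const q * fps_X) * e1"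
    using fps_euler1_eq[OF q, of "Suc 0" q q] by (simp add: fps_scale_euler e1_def power2_eq_square)
  have "fps_scale (q\<^sup>2) e2 = (1 - fps_const (q\<^sup>2) * fps_X\<^sup>2) * e2"
    unfolding e2_def by (rule fps_euler1_eq[symmetric]) (use nq[of 4] in \<open>simp_all flip: power_mult\<close>)
  moreover have "q\<^sup>2 * (q\<^sup>2)\<^sup>2 = q ^ 6" by (simp flip: power_mult power_add)
  ultimately have 2: "fps_euler1 2 (q ^ 4) (q ^ 6) = (1 - fps_const (q\<^sup>2) * fps_X\<^sup>2) * e2"
    by (simp add: e2_def fps_scale_euler)
  have "G1 = G + fps_const q * (fps_X * G)"
    unfolding G1_def 2 G_def 1 e2_def[symmetric] e3_def[symmetric] fps_const_power[symmetric] by algebra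
  then have G1: "G1 $ n = G $ n + q * (fps_X * G) $ n" for n by simp
  have "(\<lambda>n. p ^ (n choose 2) * fps_scale p G $ n) sums quad_sum p (fps_scale p G)"
    by (intro quad_sum_sums np geo_bounded_scale geo)
  then have "(\<lambda>n. p ^ (Suc n choose 2) * (fps_X * G) $ Suc n) sums quad_sum p (fps_scale p G)"
    by (simp add: choose_two_Suc power_add mult.assoc)
  from sums_Suc[OF this] have "(\<lambda>n. p ^ (n choose 2) * (fps_X * G) $ n) sums quad_sum p (fps_scale p G)" by simp
  from sums_add[OF quad_sum_sums[OF np geo] sums_mult[OF this, of q]]
  have "(\<lambda>n. p ^ (n choose 2) * G1 $ n) sums (quad_sum p G + q * quad_sum p (fps_scale p G))"
    unfolding G1 by (simp only: distrib_left mult.left_commute)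
  from sums_unique[OF this] show ?thesis
    by (simp add: quad_sum_def p_def G1_def e1_def e3_def)
qed

lemma H1_H2_H3_eq:
  assumes q: "norm q < 1" "q \<noteq> 0"
  shows "H 1 1 q = 1 / qpochs_inf [q, q ^ 4, q ^ 6, q ^ 8, q ^ 11] (q ^ 12)"
    "H 2 1 q = qpoch_inf (q ^ 6) (q ^ 12) / qpochs_inf [q ^ 2, q ^ 3, q ^ 4] (q ^ 6)"
    "H 3 1 q = 1 / qpochs_inf [q ^ 4, q ^ 5, q ^ 6, q ^ 7, q ^ 8] (q ^ 12)"
proof -
  define G where "G = fps_euler1 (Suc 0) q (q\<^sup>2) * fps_euler1 2 (q ^ 4) (q\<^sup>2) * fps_euler2 3 (q ^ 6) (q ^ 9)"
  have H2: "H 2 1 q = quad_sum (q\<^sup>2) G"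
    using H_first[OF q(1), of 2 2 2 6] by (simp add: A_def G_def)
  have "q\<^sup>2 * q\<^sup>2 = q ^ 4" "q\<^sup>2 * (q\<^sup>2)\<^sup>2 = q ^ 6" "q ^ 9 * (q\<^sup>2) ^ 3 = q ^ 15"
    by (simp_all flip: power_mult power_add)
  then have H3: "H 3 1 q = quad_sum (q\<^sup>2) (fps_scale (q\<^sup>2) G)"
    using H_first[OF q(1), of 3 4 6 12] by (simp add: A_def G_def fps_scale_euler)
  have H1: "H 1 1 q = H 2 1 q + q * H 3 1 q"
    using H_first[OF q(1), of 1 1 6 6] quad_sum_H1[OF q(1)] unfolding H2 H3 G_def by (simp add: A_def)

  \<comment> \<open>The numbers \<open>z\<close> and \<open>w\<close> are the twelfth root of unity
    \<open>exp (i pi / 6)\<close> and its conjugate, with product 1 and sum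
    \<open>sqrt 3\<close>.\<close>
  define c where "c = complex_of_real (sqrt 3)"
  define z where "z = (c + \<i>) / 2"
  define w where "w = (c - \<i>) / 2"
  have c2: "c\<^sup>2 = 3"
  proof -
    have "c\<^sup>2 = complex_of_real ((sqrt 3)\<^sup>2)" unfolding c_def by (rule of_real_power[symmetric])
    then show ?thesis by simp
  qed
  then have c0: "c \<noteq> 0" by auto
  have "4 * (z * w) = c\<^sup>2 - \<i> * \<i>" by (simp add: z_def w_def field_simps power2_eq_square)
  then have zw: "z * w = 1" by (simp add: c2)
  have zc: "z + w = c" by (simp add: z_def w_def field_simps)
  define t1 where "t1 = theta (q ^ 15) (q ^ 36)"
  define t2 where "t2 = theta (q ^ 27) (q ^ 36)"
  define t3 where "t3 = theta (q ^ 33) (q ^ 36)"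
  define pp where "pp = qpoch_inf (- (z * q)) q * qpoch_inf (- (w * q)) q"
  define pm where "pm = qpoch_inf (z * q) q * qpoch_inf (w * q) q"
  have pp: "qpoch_inf q q * pp = t1 + (c - 1) * (q * t2) + (2 - c) * (q ^ 3 * t3)"
    using theta_twelfth_root[OF q zw] c2 unfolding zc pp_def t1_def t2_def t3_def by blast
  \<comment> \<open>Negating both roots replaces \<open>c\<close> by \<open>- c\<close> in the
    evaluation of \<open>pp\<close>.\<close>
  have m1: "- z * - w = 1" using zw by simp
  have m2: "- z + - w = - c" unfolding zc[symmetric] by simp
  have m3: "(- z + - w)\<^sup>2 = 3" unfolding m2 using c2 by simp
  from m1 m3 m2 have pm: "qpoch_inf q q * pm = t1 + (- c - 1) * (q * t2) + (2 + c) * (q ^ 3 * t3)"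
    using theta_twelfth_root[OF q, of "- z" "- w"] unfolding pm_def t1_def t2_def t3_def by simp
  define qo where "qo = qpoch_inf q (q\<^sup>2)"
  define qe where "qe = qpoch_inf (q\<^sup>2) (q\<^sup>2)"
  have qq: "qpoch_inf q q = qo * qe"
    using qpoch_inf_dissect_power[OF q(1), of 1 2 1] unfolding prod_lessThan_small qo_def qe_def
    by (simp add: numeral_eq_Suc)
  have h3: "c * q * H 3 1 q = qo * ((pp - pm) / 2)" and h2: "c * H 2 1 q = qo * (c * ((pp + pm) / 2) + (pp - pm) / 2)"
    unfolding H2 H3 G_def qo_def pp_def pm_def by (rule quad_sum_H2_H3[OF q zw zc c2])+
  \<comment> \<open>The difference of \<open>pp\<close> and \<open>pm\<close> drops the part without
    \<open>c\<close>, the sum drops the part with \<open>c\<close>. In the combination for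
    \<open>H2\<close> the multiples of \<open>t2\<close> cancel.\<close>
  have "c * q * (qe * H 3 1 q) = qe * (c * q * H 3 1 q)" by (simp only: mult_ac)
  also have "\<dots> = (qo * qe * pp - qo * qe * pm) / 2" unfolding h3 by (simp add: algebra_simps)
  also have "\<dots> = c * q * (t2 - q\<^sup>2 * t3)"
    unfolding qq[symmetric] pp pm by (simp add: field_simps power2_eq_square power3_eq_cube)
  finally have K3: "qe * H 3 1 q = t2 - q\<^sup>2 * t3" using c0 q(2) by simp
  have "c * (qe * H 2 1 q) = qe * (c * H 2 1 q)" by (simp only: mult_ac)
  also have "\<dots> = c * ((qo * qe * pp + qo * qe * pm) / 2) + (qo * qe * pp - qo * qe * pm) / 2"
    unfolding h2 by (simp add: field_simps)
  also have "\<dots> = c * (t1 + q ^ 3 * t3)"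
    unfolding qq[symmetric] pp pm by (simp add: field_simps)
  finally have K2: "qe * H 2 1 q = t1 + q ^ 3 * t3" using c0 by simp
  have K1: "qe * H 1 1 q = t1 + q * t2"
    using K2 K3 unfolding H1 by (simp add: distrib_left mult.left_commute[of qe q]) (simp add: algebra_simps power2_eq_square power3_eq_cube)

  let ?X = "\<lambda>r. qpoch_inf (q ^ r) (q ^ 12)"
  have nz: "?X r \<noteq> 0" if "r > 0" for r
    using that by (intro qpoch_inf_nonzero norm_power_less_1 q) auto
  have qe: "qe = ?X 2 * ?X 4 * ?X 6 * ?X 8 * ?X 10 * ?X 12"
    using qpoch_inf_dissect_power[OF q(1), of 2 6 2] unfolding prod_lessThan_small qe_def
    by (simp add: mult_ac numeral_eq_Suc del: power_Suc)
  \<comment> \<open>Each of the three combinations is a left-hand side of the quintuple product, for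
    \<open>a = 1\<close>, \<open>a = 3\<close> and \<open>a = 5\<close> respectively.\<close>
  have P1: "(t1 + q * t2) * (?X 1 * ?X 11) = ?X 12 * (?X 2 * ?X 10)"
    using quintuple_product_12[OF q, of 1] by (simp add: t1_def t2_def)
  have P2: "(t1 + q ^ 3 * t3) * (?X 3 * ?X 9) = ?X 12 * (?X 6 * ?X 6)"
    using quintuple_product_12[OF q, of 3] by (simp add: t1_def t3_def theta_36[OF q])
  have "q ^ 5 = q\<^sup>2 * q ^ 3" by (simp flip: power_add)
  then have "q ^ 5 * theta (q ^ 39) (q ^ 36) = q\<^sup>2 * (q ^ 3 * theta (q ^ 39) (q ^ 36))" by (simp only: mult.assoc)
  then have "q ^ 5 * theta (q ^ 39) (q ^ 36) = - (q\<^sup>2 * t3)" unfolding theta_36[OF q] by (simp add: t3_def)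
  then have P3: "(t2 - q\<^sup>2 * t3) * (?X 5 * ?X 7) = ?X 12 * (?X 10 * ?X 2)"
    using quintuple_product_12[OF q, of 5] by (simp add: t2_def)
  have cancel: "h * (x4 * x6 * x8 * (a * b)) = 1"
    if "x2 * x4 * x6 * x8 * x10 * x12 * h = t" "t * (a * b) = x12 * (x2 * x10)" "x2 \<noteq> 0" "x10 \<noteq> 0" "x12 \<noteq> 0"
    for h t a b x2 x4 x6 x8 x10 x12 :: complex
  proof -
    have "x2 * x10 * x12 * (h * (x4 * x6 * x8 * (a * b))) = x2 * x10 * x12 * 1"
      using that(2) unfolding that(1)[symmetric] by (simp add: mult_ac)
    then show ?thesis using that(3-5) by (simp only: mult_cancel_left mult_eq_0_iff simp_thms)
  qed
  have "H 1 1 q * (?X 4 * ?X 6 * ?X 8 * (?X 1 * ?X 11)) = 1"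
    by (rule cancel[OF K1[unfolded qe] P1]) (use nz in simp_all)
  then show "H 1 1 q = 1 / qpochs_inf [q, q ^ 4, q ^ 6, q ^ 8, q ^ 11] (q ^ 12)"
    using nz[of 1] nz[of 4] nz[of 6] nz[of 8] nz[of 11] by (simp add: qpochs_inf_def field_simps)
  have "H 3 1 q * (?X 4 * ?X 6 * ?X 8 * (?X 5 * ?X 7)) = 1"
    by (rule cancel[OF K3[unfolded qe] P3[unfolded mult.commute[of "?X 10" "?X 2"]]]) (use nz in simp_all)
  then show "H 3 1 q = 1 / qpochs_inf [q ^ 4, q ^ 5, q ^ 6, q ^ 7, q ^ 8] (q ^ 12)"
    using nz[of 4] nz[of 5] nz[of 6] nz[of 7] nz[of 8] by (simp add: qpochs_inf_def field_simps)
  have six: "qpoch_inf (q ^ 2) (q ^ 6) = ?X 2 * ?X 8" "qpoch_inf (q ^ 3) (q ^ 6) = ?X 3 * ?X 9"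
      "qpoch_inf (q ^ 4) (q ^ 6) = ?X 4 * ?X 10"
    using qpoch_inf_dissect_power[OF q(1), of 6 2 2] qpoch_inf_dissect_power[OF q(1), of 6 2 3]
      qpoch_inf_dissect_power[OF q(1), of 6 2 4] unfolding prod_lessThan_small
    by (simp_all add: numeral_eq_Suc del: power_Suc)
  have "?X 6 * ?X 12 * (H 2 1 q * (?X 2 * ?X 8 * (?X 3 * ?X 9 * (?X 4 * ?X 10)))) = ?X 6 * ?X 12 * ?X 6"
    using P2 unfolding K2[symmetric] qe by (simp add: mult_ac)
  then have "H 2 1 q * (?X 2 * ?X 8 * (?X 3 * ?X 9 * (?X 4 * ?X 10))) = ?X 6"
    using nz[of 6] nz[of 12] by simp
  then show "H 2 1 q = qpoch_inf (q ^ 6) (q ^ 12) / qpochs_inf [q ^ 2, q ^ 3, q ^ 4] (q ^ 6)"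
    using nz[of 2] nz[of 3] nz[of 4] nz[of 8] nz[of 9] nz[of 10]
    by (simp add: qpochs_inf_def six eq_divide_eq mult_ac)
qed

section \<open>The degenerate case \<open>q = 0\<close>\<close>

lemma quad_sum_0: "quad_sum 0 f = f $ 0 + f $ Suc 0"
proof -
  have "(\<lambda>n. 0 ^ (n choose 2) * f $ n) sums (\<Sum>n\<in>{0, Suc 0}. 0 ^ (n choose 2) * f $ n)"
  proof (rule sums_finite)
    fix n assume "n \<notin> {0, Suc 0}"
    then have "n choose 2 > 0" by (intro zero_less_binomial) auto
    then show "0 ^ (n choose 2) * f $ n = 0" by (simp add: power_0_left)
  qed simp
  then show ?thesis by (simp add: quad_sum_def sums_iff)
qed

text \<open>The weight \<open>0 ^ (n choose 2)\<close> keeps only the coefficients 0 and 1, and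
  coefficient 1 of each factor vanishes: for the first factor because the coefficient of
  \<open>i\<close> in \<open>A\<close> is positive, for the others because 2 and 3 do not divide 1.
  \<open>H6\<close> and \<open>H7\<close> are absent since their evaluation never divides by
  \<open>q\<close>.\<close>

lemma H_at_0:
  assumes "l \<in> {1, 2, 3, 10, 11}"
  shows "H l 1 0 = 1"
proof -
  have nd: "\<not> 2 dvd Suc 0" "\<not> 3 dvd Suc 0" by simp_all
  have *: "quad_sum 0 (fps_euler1 (Suc 0) 0 0 * g * h) = 1"
    if "g $ 0 = 1" "g $ Suc 0 = 0" "h $ 0 = 1" "h $ Suc 0 = 0" for g h
    using that by (simp add: quad_sum_0 fps_mult_nth)
  have 1: "H 1 1 0 = 1" using H_first[of 0 1 1 6 6] * by (simp add: A_def fps_euler_nth_not_dvd nd)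
  have 2: "H 2 1 0 = 1" using H_first[of 0 2 2 2 6] * by (simp add: A_def fps_euler_nth_not_dvd nd)
  have 3: "H 3 1 0 = 1" using H_first[of 0 3 4 6 12] * by (simp add: A_def fps_euler_nth_not_dvd nd)
  have 4: "H 10 1 0 = 1" using H_second[of 0 10 1 2 4] * by (simp add: A_def fps_euler_nth_not_dvd nd)
  have 5: "H 11 1 0 = 1" using H_second[of 0 11 2 4 5] * by (simp add: A_def fps_euler_nth_not_dvd nd)
  from assms 1 2 3 4 5 show ?thesis by auto
qed

theorem theorem1p1:
  fixes q :: complex
  assumes "norm q < 1"
  shows
    "H 1 1 q = 1 / qpochs_inf [q, q ^ 4, q ^ 6, q ^ 8, q ^ 11] (q ^ 12) \<and>
     H 2 1 q = qpoch_inf (q ^ 6) (q ^ 12) / qpochs_inf [q ^ 2, q ^ 3, q ^ 4] (q ^ 6) \<and>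
     H 3 1 q = 1 / qpochs_inf [q ^ 4, q ^ 5, q ^ 6, q ^ 7, q ^ 8] (q ^ 12) \<and>
     H 6 1 q = qpoch_inf (q ^ 3) (q ^ 12) / qpochs_inf [q, q ^ 2] (q ^ 4) \<and>
     H 7 1 q = qpoch_inf (q ^ 9) (q ^ 12) / qpochs_inf [q ^ 2, q ^ 3] (q ^ 4) \<and>
     H 10 1 q = 1 / (qpoch_inf q (q ^ 3) * qpochs_inf [q ^ 3, q ^ 6, q ^ 11] (q ^ 12)) \<and>
     H 11 1 q = 1 / (qpoch_inf (q ^ 2) (q ^ 3) * qpochs_inf [q ^ 3, q ^ 6, q ^ 7] (q ^ 12))"
proof (cases "q = 0")
  case True
  then show ?thesis
    using H6_eq[OF assms] H7_eq[OF assms] by (simp add: H_at_0 qpochs_inf_def)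
next
  case False
  show ?thesis
    by (intro conjI H1_H2_H3_eq[OF assms False] H6_eq[OF assms] H7_eq[OF assms]
        H10_eq[OF assms False] H11_eq[OF assms False])
qed

end
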